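(* Let $N\subseteq H\subseteq G$ be closed subgroups of a compact Lie group $G$ with $N$ normal in $G$; put $J=G/N$, $J_0=H/N$, and let $i\colon H\to G$ and $i_J\colon J_0\to J$ be the inclusions. Assume that $N\subseteq G$ is orthogonally final. Then taking geometric $N$-fixed points commutes with the restriction to $H$-spectra: if $Y$ is an orthogonal $G$-spectrum, the restriction functor $j^*\colon\mathcal O_E\to\mathcal O_{E_0}$ induces an isomorphism of orthogonal $J_0$-spectra, natural in $Y$, $$i_J^*\Phi^NY\xrightarrow{\ \cong\ }\Phi^N(i^*Y).$$
   Context: **Orthogonal spectra.** $\mathcal T$ is the category of based compactly generated weak Hausdorff spaces. For finite dimensional real inner product spaces $V,W$, $\mathbf O(V,W)$ is the space of points $f\wedge x$ with $f\colon V\to W$ a linear isometric embedding and $x$ in the one-point compactification of the orthogonal complement of $f(V)$ (a subspace of $\mathcal L(V,W)_+\wedge S^W$), with composition $(f\wedge x)(g\wedge y)=fg\wedge(x+f(y))$. An orthogonal spectrum is a continuous functor to $\mathcal T$ from the full subcategory on the Euclidean spaces $\mathbb R^m$; an orthogonal $G$-spectrum is one with continuous $G$-action, evaluated on an $n$-dimensional orthogonal $G$-representation $V$ by $A_V=\mathcal L(\mathbb R^n,V)_+\wedge_{\mathrm O_{\mathbb R^n}}A_{\mathbb R^n}$ with diagonal action. $i^*$ and $i_J^*$ denote restriction of group actions. **Geometric fixed points.** $\mathcal O_E$ (resp. $\mathcal O_{E_0}$) is the category of orthogonal $G$-representations (resp. $H$-representations) with morphism spaces $\mathbf O(V,W)^N$,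 the $N$-fixed points of the conjugation action. $j^*\colon\mathcal O_E\to\mathcal O_{E_0}$ is $V\mapsto i^*V$ on objects and the identity $\mathbf O(V,W)^N=\mathbf O(i^*V,i^*W)^N$ on morphisms. For an orthogonal $G$-spectrum $A$, $\Phi^NA$ is the orthogonal $J$-spectrum $(\Phi^NA)_U=\int^{W\in\mathcal O_E}\mathbf O(W^N,U)\wedge(A_W)^N$ ($U$ with trivial action); for an orthogonal $H$-spectrum $X$ the orthogonal $J_0$-spectrum $\Phi^NX$ is defined in the same way using $\mathcal O_{E_0}$. **Orthogonally final.** $N\subseteq G$ is orthogonally final if for every orthogonal $N$-representation $W$ there is an orthogonal $G$-representation $V$ and an $N$-linear isometric embedding of $W$ into the restriction of $V$ to $N$ inducing an isomorphism $W^N\cong V^N$. *)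

theory Defs
  imports "HOL-Analysis.Analysis" "HOL-Algebra.Coset"
begin

section \<open>The real inner product space of finitely supported sequences\<close>

text \<open>
  Every finite dimensional real inner product space is isometric to a subspace of the
  inner product space below. Its finite dimensional subspaces serve as a small model of all
  finite dimensional inner product spaces; such a model is needed for the coends anyway.
\<close>

typedef rseq = "{x :: nat \<Rightarrow> real. finite {i. x i \<noteq> 0}}"
  morphisms coord Abs_rseq
  by (rule exI[of _ "\<lambda>_. 0"]) simp

lemma coord_inject_ext: "x = y \<longleftrightarrow> (\<forall>i. coord x i = coord y i)"
  by (metis coord_inject ext)

lemma finite_coord: "finite {i. coord x i \<noteq> 0}"
  using coord[of x] by simp

lemma coord_Abs: "finite {i. f i \<noteq> 0} \<Longrightarrow> coord (Abs_rseq f) = f"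
  by (simp add: Abs_rseq_inverse)

instantiation rseq :: real_inner
begin

definition zero_rseq :: rseq where "zero_rseq = Abs_rseq (\<lambda>_. 0)"
definition plus_rseq :: "rseq \<Rightarrow> rseq \<Rightarrow> rseq"
  where "plus_rseq x y = Abs_rseq (\<lambda>i. coord x i + coord y i)"
definition uminus_rseq :: "rseq \<Rightarrow> rseq"
  where "uminus_rseq x = Abs_rseq (\<lambda>i. - coord x i)"
definition minus_rseq :: "rseq \<Rightarrow> rseq \<Rightarrow> rseq"
  where "minus_rseq x y = Abs_rseq (\<lambda>i. coord x i - coord y i)"
definition scaleR_rseq :: "real \<Rightarrow> rseq \<Rightarrow> rseq"
  where "scaleR_rseq c x = Abs_rseq (\<lambda>i. c * coord x i)"
definition inner_rseq :: "rseq \<Rightarrow> rseq \<Rightarrow> real"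
  where "inner_rseq x y = (\<Sum>i | coord x i \<noteq> 0. coord x i * coord y i)"
definition norm_rseq :: "rseq \<Rightarrow> real" where "norm_rseq x = sqrt (inner x x)"
definition sgn_rseq :: "rseq \<Rightarrow> rseq" where "sgn_rseq x = inverse (norm x) *\<^sub>R x"
definition dist_rseq :: "rseq \<Rightarrow> rseq \<Rightarrow> real" where "dist_rseq x y = norm (x - y)"
definition uniformity_rseq :: "(rseq \<times> rseq) filter"
  where "uniformity_rseq = (INF e\<in>{0<..}. principal {(x, y). dist x y < e})"
definition open_rseq :: "rseq set \<Rightarrow> bool"
  where "open_rseq U \<longleftrightarrow> (\<forall>x\<in>U. eventually (\<lambda>(x', y). x' = x \<longrightarrow> y \<in> U) uniformity)"

lemma coord_zero: "coord 0 i = 0"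
  by (simp add: zero_rseq_def coord_Abs)

lemma coord_plus: "coord (x + y) i = coord x i + coord y i"
proof -
  have "finite {i. coord x i + coord y i \<noteq> 0}"
    by (rule finite_subset[of _ "{i. coord x i \<noteq> 0} \<union> {i. coord y i \<noteq> 0}"])
      (auto simp: finite_coord)
  then show ?thesis by (simp add: plus_rseq_def coord_Abs)
qed

lemma coord_minus: "coord (x - y) i = coord x i - coord y i"
proof -
  have "finite {i. coord x i - coord y i \<noteq> 0}"
    by (rule finite_subset[of _ "{i. coord x i \<noteq> 0} \<union> {i. coord y i \<noteq> 0}"])
      (auto simp: finite_coord)
  then show ?thesis by (simp add: minus_rseq_def coord_Abs)
qed

lemma coord_uminus: "coord (- x) i = - coord x i"
  using finite_coord[of x] by (simp add: uminus_rseq_def coord_Abs)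

lemma coord_scaleR: "coord (c *\<^sub>R x) i = c * coord x i"
proof -
  have "finite {i. c * coord x i \<noteq> 0}"
    by (rule finite_subset[of _ "{i. coord x i \<noteq> 0}"]) (auto simp: finite_coord)
  then show ?thesis by (simp add: scaleR_rseq_def coord_Abs)
qed

lemma inner_rseq_superset:
  assumes "finite S" "{i. coord x i \<noteq> 0} \<subseteq> S"
  shows "inner x y = (\<Sum>i\<in>S. coord x i * coord y i)"
  unfolding inner_rseq_def using assms by (intro sum.mono_neutral_left) auto

instance
proof
  fix x y z :: rseq and a b :: real
  show "x + y + z = x + (y + z)" "x + y = y + x" "0 + x = x" "- x + x = 0" "x - y = x + - y"
    "a *\<^sub>R (x + y) = a *\<^sub>R x + a *\<^sub>R y" "(a + b) *\<^sub>R x = a *\<^sub>R x + b *\<^sub>R x"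
    "a *\<^sub>R b *\<^sub>R x = (a * b) *\<^sub>R x" "1 *\<^sub>R x = x"
    by (simp_all add: coord_inject_ext coord_plus coord_zero coord_uminus coord_minus
        coord_scaleR algebra_simps)
  let ?S = "{i. coord x i \<noteq> 0} \<union> {i. coord y i \<noteq> 0}"
  have S: "finite ?S" by (simp add: finite_coord)
  show "inner x y = inner y x"
    using inner_rseq_superset[OF S, of x y] inner_rseq_superset[OF S, of y x]
    by (simp add: mult.commute)
  have xy: "{i. coord (x + y) i \<noteq> 0} \<subseteq> ?S"
    by (auto simp: coord_plus)
  show "inner (x + y) z = inner x z + inner y z"
    using inner_rseq_superset[OF S xy, of z] inner_rseq_superset[OF S, of x z]
      inner_rseq_superset[OF S, of y z]
    by (simp add: coord_plus sum.distrib algebra_simps)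
  have "{i. coord (a *\<^sub>R x) i \<noteq> 0} \<subseteq> {i. coord x i \<noteq> 0}"
    by (auto simp: coord_scaleR)
  from inner_rseq_superset[OF finite_coord this, of y]
  show "inner (a *\<^sub>R x) y = a * inner x y"
    by (simp add: coord_scaleR inner_rseq_def sum_distrib_left algebra_simps)
  show "0 \<le> inner x x" by (simp add: inner_rseq_def sum_nonneg)
  show "inner x x = 0 \<longleftrightarrow> x = 0"
  proof
    assume "inner x x = 0"
    then have "\<forall>i\<in>{i. coord x i \<noteq> 0}. coord x i * coord x i = 0"
      unfolding inner_rseq_def by (subst (asm) sum_nonneg_eq_0_iff) (auto simp: finite_coord)
    then show "x = 0" by (auto simp: coord_inject_ext coord_zero)
  qed (simp add: inner_rseq_def coord_zero)
qed (rule norm_rseq_def sgn_rseq_def dist_rseq_def uniformity_rseq_def open_rseq_def)+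

end

definition Rn :: "nat \<Rightarrow> rseq set" where
  "Rn n = {x. \<forall>i\<ge>n. coord x i = 0}"

definition fd_subspace :: "rseq set \<Rightarrow> bool" where
  "fd_subspace V \<longleftrightarrow> subspace V \<and> (\<exists>B. finite B \<and> V = span B)"


section \<open>Compactly generated weak Hausdorff spaces and their colimits\<close>

text \<open>
  In both definitions \<open>K\<close> is meant to range over all compact Hausdorff spaces. Carrying the test
  spaces on the type \<open>'a set set\<close> loses nothing: given \<open>u: K \<rightarrow> X\<close>, choose one point in each fibre;
  the closure of the chosen points is compact Hausdorff, has the same image under \<open>u\<close>, and has at
  most as many points as there are sets of subsets of \<open>X\<close>. Hence weak Hausdorffness is not
  changed; and in a weak Hausdorff space compact generation is detected by the (compact
  Hausdorff) images \<open>u(K)\<close> alone.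
\<close>

definition weak_Hausdorff_space :: "'a topology \<Rightarrow> bool" where
  "weak_Hausdorff_space X \<longleftrightarrow>
     (\<forall>(K :: 'a set set topology) u.
        compact_space K \<and> Hausdorff_space K \<and> continuous_map K X u
          \<longrightarrow> closedin X (u ` topspace K))"

definition compactly_generated_space :: "'a topology \<Rightarrow> bool" where
  "compactly_generated_space X \<longleftrightarrow>
     (\<forall>A \<subseteq> topspace X.
        (\<forall>(K :: 'a set set topology) u.
           compact_space K \<and> Hausdorff_space K \<and> continuous_map K X u
             \<longrightarrow> closedin K {k \<in> topspace K. u k \<in> A})
        \<longrightarrow> closedin X A)"

definition CGWH_space :: "'a topology \<Rightarrow> bool" where
  "CGWH_space X \<longleftrightarrow> compactly_generated_space X \<and> weak_Hausdorff_space X"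

definition final_topology :: "'a topology \<Rightarrow> ('a \<Rightarrow> 'b) \<Rightarrow> 'b topology" where
  "final_topology X f =
     topology (\<lambda>U. U \<subseteq> f ` topspace X \<and> openin X {x \<in> topspace X. f x \<in> U})"

lemma openin_final_topology:
  "openin (final_topology X f) U \<longleftrightarrow>
     U \<subseteq> f ` topspace X \<and> openin X {x \<in> topspace X. f x \<in> U}"
proof -
  have "istopology (\<lambda>U. U \<subseteq> f ` topspace X \<and> openin X {x \<in> topspace X. f x \<in> U})"
    unfolding istopology_def
  proof (intro conjI allI impI)
    fix S T assume "S \<subseteq> f ` topspace X \<and> openin X {x \<in> topspace X. f x \<in> S}"
      and "T \<subseteq> f ` topspace X \<and> openin X {x \<in> topspace X. f x \<in> T}"
    then show "S \<inter> T \<subseteq> f ` topspace X" and "openin X {x \<in> topspace X. f x \<in> S \<inter> T}"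
      using openin_Int[of X "{x \<in> topspace X. f x \<in> S}" "{x \<in> topspace X. f x \<in> T}"]
      by (auto simp: Int_def conj_ac)
  next
    fix \<K> assume K: "\<forall>S\<in>\<K>. S \<subseteq> f ` topspace X \<and> openin X {x \<in> topspace X. f x \<in> S}"
    then show "\<Union>\<K> \<subseteq> f ` topspace X" by blast
    have "openin X (\<Union>S\<in>\<K>. {x \<in> topspace X. f x \<in> S})" using K by blast
    then show "openin X {x \<in> topspace X. f x \<in> \<Union>\<K>}"
      by (rule back_subst[of "openin X"]) blast
  qed
  then show ?thesis by (simp add: final_topology_def)
qed

text \<open>
  The largest weak Hausdorff quotient of \<open>X\<close> in which the pairs in \<open>R\<close> are identified. For compactly
  generated \<open>X\<close> this is the quotient of \<open>X\<close> by the relation generated by \<open>R\<close>, formed in the category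
  of compactly generated weak Hausdorff spaces (coequalizers there are weak Hausdorffifications
  of the ordinary ones).
\<close>

definition cgwh_kernel :: "'a topology \<Rightarrow> ('a \<times> 'a) set \<Rightarrow> ('a \<times> 'a) set" where
  "cgwh_kernel X R =
     \<Inter>{E. equiv (topspace X) E \<and> R \<subseteq> E
          \<and> weak_Hausdorff_space (final_topology X (\<lambda>x. E `` {x}))}"

definition cgwh_class :: "'a topology \<Rightarrow> ('a \<times> 'a) set \<Rightarrow> 'a \<Rightarrow> 'a set" where
  "cgwh_class X R x = cgwh_kernel X R `` {x}"

definition cgwh_quotient :: "'a topology \<Rightarrow> ('a \<times> 'a) set \<Rightarrow> 'a set topology" where
  "cgwh_quotient X R = final_topology X (cgwh_class X R)"


section \<open>Compact Lie groups\<close>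

text \<open>
  For \<open>S\<close> open in the finite dimensional subspace \<open>E\<close>: all iterated directional derivatives
  of \<open>f\<close> along \<open>E\<close> exist and are continuous on \<open>S\<close>.
\<close>

coinductive smooth_on ::
  "'a::real_normed_vector set \<Rightarrow> 'a set \<Rightarrow> ('a \<Rightarrow> 'b::real_normed_vector) \<Rightarrow> bool"
  for E S where
  "\<lbrakk>continuous_on S f;
    \<forall>v\<in>E. \<exists>g. (\<forall>x\<in>S. ((\<lambda>t. f (x + t *\<^sub>R v)) has_vector_derivative g x) (at 0)) \<and> smooth_on E S g\<rbrakk>
   \<Longrightarrow> smooth_on E S f"

definition topological_group :: "'g monoid \<Rightarrow> 'g topology \<Rightarrow> bool" where
  "topological_group G T \<longleftrightarrow>
     group G \<and> topspace T = carrier G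
     \<and> continuous_map (prod_topology T T) T (\<lambda>(x, y). x \<otimes>\<^bsub>G\<^esub> y)
     \<and> continuous_map T T (\<lambda>x. inv\<^bsub>G\<^esub> x)"

definition chart :: "'g topology \<Rightarrow> nat \<Rightarrow> 'g set \<times> ('g \<Rightarrow> rseq) \<Rightarrow> bool" where
  "chart T n = (\<lambda>(U, c). openin T U \<and> openin (top_of_set (Rn n)) (c ` U)
     \<and> homeomorphic_map (subtopology T U) (top_of_set (c ` U)) c)"

definition smooth_atlas :: "'g topology \<Rightarrow> nat \<Rightarrow> ('g set \<times> ('g \<Rightarrow> rseq)) set \<Rightarrow> bool" where
  "smooth_atlas T n \<A> \<longleftrightarrow>
     (\<forall>C\<in>\<A>. chart T n C) \<and> topspace T = (\<Union>(U, c)\<in>\<A>. U)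
     \<and> (\<forall>(U, c)\<in>\<A>. \<forall>(V, d)\<in>\<A>. smooth_on (Rn n) (c ` (U \<inter> V)) (\<lambda>u. d (inv_into U c u)))"

definition Lie_group :: "'g monoid \<Rightarrow> 'g topology \<Rightarrow> bool" where
  "Lie_group G T \<longleftrightarrow>
     topological_group G T \<and> Hausdorff_space T \<and> second_countable T
     \<and> (\<exists>n \<A>. smooth_atlas T n \<A>
         \<and> (\<forall>(U, c)\<in>\<A>. \<forall>(V, d)\<in>\<A>. \<forall>(W, e)\<in>\<A>.
              smooth_on (Rn n \<times> Rn n) {(c x, d y) |x y. x \<in> U \<and> y \<in> V \<and> x \<otimes>\<^bsub>G\<^esub> y \<in> W}
                (\<lambda>(u, v). e (inv_into U c u \<otimes>\<^bsub>G\<^esub> inv_into V d v)))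
         \<and> (\<forall>(U, c)\<in>\<A>. \<forall>(V, d)\<in>\<A>.
              smooth_on (Rn n) {c x |x. x \<in> U \<and> inv\<^bsub>G\<^esub> x \<in> V}
                (\<lambda>u. d (inv\<^bsub>G\<^esub> (inv_into U c u)))))"

definition compact_Lie_group :: "'g monoid \<Rightarrow> 'g topology \<Rightarrow> bool" where
  "compact_Lie_group G T \<longleftrightarrow> Lie_group G T \<and> compact_space T"

definition quot_topology :: "'g monoid \<Rightarrow> 'g topology \<Rightarrow> 'g set \<Rightarrow> 'g set topology" where
  "quot_topology G T N = final_topology T (\<lambda>g. N #>\<^bsub>G\<^esub> g)"


section \<open>The category of inner product spaces and orthogonal spectra\<close>

definition isoms :: "rseq set \<Rightarrow> rseq set \<Rightarrow> (rseq \<Rightarrow> rseq) set" where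
  "isoms V W = {f \<in> V \<rightarrow>\<^sub>E W.
     (\<forall>x\<in>V. \<forall>y\<in>V. f (x + y) = f x + f y) \<and> (\<forall>c. \<forall>x\<in>V. f (c *\<^sub>R x) = c *\<^sub>R f x)
     \<and> (\<forall>x\<in>V. \<forall>y\<in>V. inner (f x) (f y) = inner x y)}"

text \<open>On a finite dimensional \<open>V\<close>, pointwise convergence gives the usual topology.\<close>

definition isom_space :: "rseq set \<Rightarrow> rseq set \<Rightarrow> (rseq \<Rightarrow> rseq) topology" where
  "isom_space V W = subtopology (product_topology (\<lambda>_. top_of_set W) V) (isoms V W)"

text \<open>
  \<open>Some (f, x)\<close> is the point \<open>f \<and> x\<close> and \<open>None\<close> is the base point. As \<open>L(V,W)\<close> is compact,
  \<open>L(V,W)\<^sub>+ \<and> S\<^sup>W\<close> is the one-point compactification of \<open>L(V,W) \<times> W\<close>.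
\<close>

type_synonym omor = "((rseq \<Rightarrow> rseq) \<times> rseq) option"

definition omors :: "rseq set \<Rightarrow> rseq set \<Rightarrow> omor set" where
  "omors V W =
     insert None (Some ` {(f, x). f \<in> isoms V W \<and> x \<in> W \<and> (\<forall>v\<in>V. inner (f v) x = 0)})"

definition omor_space :: "rseq set \<Rightarrow> rseq set \<Rightarrow> omor topology" where
  "omor_space V W =
     subtopology (Alexandroff_compactification (prod_topology (isom_space V W) (top_of_set W)))
       (omors V W)"

definition isom_omor :: "(rseq \<Rightarrow> rseq) \<Rightarrow> omor" where
  "isom_omor f = Some (f, 0)"

text \<open>The composite of \<open>\<phi> \<in> O(V,W)\<close> followed by \<open>\<theta> \<in> O(W,U)\<close> is \<open>ocomp V \<theta> \<phi>\<close>.\<close>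

fun ocomp :: "rseq set \<Rightarrow> omor \<Rightarrow> omor \<Rightarrow> omor" where
  "ocomp V (Some (f, x)) (Some (g, y)) = Some (compose V f g, x + f y)"
| "ocomp V _ _ = None"

record ('g, 'a) gspectrum =
  level :: "nat \<Rightarrow> 'a topology"
  basept :: "nat \<Rightarrow> 'a"
  strmap :: "nat \<Rightarrow> nat \<Rightarrow> omor \<Rightarrow> 'a \<Rightarrow> 'a"
  gact :: "'g \<Rightarrow> nat \<Rightarrow> 'a \<Rightarrow> 'a"

text \<open>
  Orthogonal \<open>G\<close>-spectra for a compact Hausdorff group \<open>G\<close>. The spaces \<open>O(V,W)\<close> and \<open>G\<close> are
  compact Hausdorff, so their ordinary products with compactly generated spaces are already
  compactly generated, and continuity of the functor and of the action can be stated in adjoint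
  form on ordinary products.
\<close>

definition orthogonal_spectrum :: "'g monoid \<Rightarrow> 'g topology \<Rightarrow> ('g, 'a) gspectrum \<Rightarrow> bool" where
  "orthogonal_spectrum G T A \<longleftrightarrow>
     (\<forall>m. CGWH_space (level A m) \<and> basept A m \<in> topspace (level A m))
   \<and> (\<forall>m n. continuous_map (prod_topology (omor_space (Rn m) (Rn n)) (level A m)) (level A n)
               (\<lambda>(\<theta>, a). strmap A m n \<theta> a))
   \<and> (\<forall>m n. \<forall>a\<in>topspace (level A m). strmap A m n None a = basept A n)
   \<and> (\<forall>m n. \<forall>\<theta>\<in>omors (Rn m) (Rn n). strmap A m n \<theta> (basept A m) = basept A n)
   \<and> (\<forall>m. \<forall>a\<in>topspace (level A m). strmap A m m (isom_omor (\<lambda>x\<in>Rn m. x)) a = a)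
   \<and> (\<forall>l m n. \<forall>\<theta>\<in>omors (Rn m) (Rn n). \<forall>\<phi>\<in>omors (Rn l) (Rn m). \<forall>a\<in>topspace (level A l).
        strmap A l n (ocomp (Rn l) \<theta> \<phi>) a = strmap A m n \<theta> (strmap A l m \<phi> a))
   \<and> (\<forall>m. continuous_map (prod_topology T (level A m)) (level A m) (\<lambda>(g, a). gact A g m a))
   \<and> (\<forall>m. \<forall>a\<in>topspace (level A m). gact A \<one>\<^bsub>G\<^esub> m a = a)
   \<and> (\<forall>m. \<forall>g\<in>carrier G. \<forall>h\<in>carrier G. \<forall>a\<in>topspace (level A m).
        gact A (g \<otimes>\<^bsub>G\<^esub> h) m a = gact A g m (gact A h m a))
   \<and> (\<forall>m. \<forall>g\<in>carrier G. gact A g m (basept A m) = basept A m)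
   \<and> (\<forall>m n. \<forall>\<theta>\<in>omors (Rn m) (Rn n). \<forall>g\<in>carrier G. \<forall>a\<in>topspace (level A m).
        gact A g n (strmap A m n \<theta> a) = strmap A m n \<theta> (gact A g m a))"

definition spectrum_hom ::
  "'g monoid \<Rightarrow> 'g topology \<Rightarrow> ('g, 'a) gspectrum \<Rightarrow> ('g, 'b) gspectrum
     \<Rightarrow> (nat \<Rightarrow> 'a \<Rightarrow> 'b) \<Rightarrow> bool" where
  "spectrum_hom G T A B h \<longleftrightarrow>
     orthogonal_spectrum G T A \<and> orthogonal_spectrum G T B
   \<and> (\<forall>m. continuous_map (level A m) (level B m) (h m) \<and> h m (basept A m) = basept B m)
   \<and> (\<forall>m n. \<forall>\<theta>\<in>omors (Rn m) (Rn n). \<forall>a\<in>topspace (level A m).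
        h n (strmap A m n \<theta> a) = strmap B m n \<theta> (h m a))
   \<and> (\<forall>m. \<forall>g\<in>carrier G. \<forall>a\<in>topspace (level A m). h m (gact A g m a) = gact B g m (h m a))"

definition spectrum_iso ::
  "'g monoid \<Rightarrow> 'g topology \<Rightarrow> ('g, 'a) gspectrum \<Rightarrow> ('g, 'b) gspectrum
     \<Rightarrow> (nat \<Rightarrow> 'a \<Rightarrow> 'b) \<Rightarrow> bool" where
  "spectrum_iso G T A B h \<longleftrightarrow>
     spectrum_hom G T A B h
   \<and> (\<exists>k. spectrum_hom G T B A k
        \<and> (\<forall>m. \<forall>a\<in>topspace (level A m). k m (h m a) = a)
        \<and> (\<forall>m. \<forall>b\<in>topspace (level B m). h m (k m b) = b))"

definition res_spectrum :: "'g set \<Rightarrow> ('g, 'a) gspectrum \<Rightarrow> ('g, 'a) gspectrum" where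
  "res_spectrum H A = A\<lparr>gact := restrict (gact A) H\<rparr>"


section \<open>Representations and evaluation of spectra on them\<close>

type_synonym 'g rep = "rseq set \<times> ('g \<Rightarrow> rseq \<Rightarrow> rseq)"

definition orthogonal_rep :: "'g monoid \<Rightarrow> 'g topology \<Rightarrow> 'g rep \<Rightarrow> bool" where
  "orthogonal_rep G T = (\<lambda>(V, \<rho>).
     fd_subspace V \<and> \<rho> \<in> carrier G \<rightarrow>\<^sub>E isoms V V
   \<and> (\<forall>v\<in>V. \<rho> \<one>\<^bsub>G\<^esub> v = v)
   \<and> (\<forall>g\<in>carrier G. \<forall>h\<in>carrier G. \<forall>v\<in>V. \<rho> (g \<otimes>\<^bsub>G\<^esub> h) v = \<rho> g (\<rho> h v))
   \<and> continuous_map (prod_topology T (top_of_set V)) (top_of_set V) (\<lambda>(g, v). \<rho> g v))"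

definition res_rep :: "'g set \<Rightarrow> 'g rep \<Rightarrow> 'g rep" where
  "res_rep H V = (fst V, restrict (snd V) H)"

definition fixed_space :: "'g set \<Rightarrow> 'g rep \<Rightarrow> rseq set" where
  "fixed_space N V = {v \<in> fst V. \<forall>n\<in>N. snd V n v = v}"

definition omor_conj :: "'g monoid \<Rightarrow> 'g rep \<Rightarrow> 'g rep \<Rightarrow> 'g \<Rightarrow> omor \<Rightarrow> omor" where
  "omor_conj G V W g =
     map_option (\<lambda>(f, x). (\<lambda>v\<in>fst V. snd W g (f (snd V (inv\<^bsub>G\<^esub> g) v)), snd W g x))"

text \<open>The morphism set \<open>O(V,W)\<^sup>N\<close> of the category \<open>\<O>\<^sub>E\<close>.\<close>

definition fixed_omors :: "'g monoid \<Rightarrow> 'g set \<Rightarrow> 'g rep \<Rightarrow> 'g rep \<Rightarrow> omor set" where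
  "fixed_omors G N V W =
     {\<phi> \<in> omors (fst V) (fst W). \<forall>n\<in>N. omor_conj G V W n \<phi> = \<phi>}"

text \<open>The map \<open>O(V,W)\<^sup>N \<rightarrow> O(V\<^sup>N,W\<^sup>N)\<close> by which \<open>W \<mapsto> W\<^sup>N\<close> is a functor.\<close>

definition omor_fix :: "'g set \<Rightarrow> 'g rep \<Rightarrow> omor \<Rightarrow> omor" where
  "omor_fix N V = map_option (\<lambda>(f, x). (restrict f (fixed_space N V), x))"

text \<open>
  \<open>A\<^sub>V\<close> is the quotient of \<open>L(\<real>\<^sup>n,V) \<times> A\<^sub>n\<close>, where \<open>n = dim V\<close>, in which the base point of \<open>A\<^sub>n\<close> is
  collapsed (giving \<open>L(\<real>\<^sup>n,V)\<^sub>+ \<and> A\<^sub>n\<close>) and the right action of \<open>O(\<real>\<^sup>n)\<close> on \<open>L(\<real>\<^sup>n,V)\<close> is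
  balanced against its left action on \<open>A\<^sub>n\<close>. Points of \<open>A\<^sub>V\<close> are equivalence classes of pairs.
\<close>

type_synonym 'a evpt = "((rseq \<Rightarrow> rseq) \<times> 'a) set"

definition ev_pre :: "('g, 'a) gspectrum \<Rightarrow> rseq set \<Rightarrow> ((rseq \<Rightarrow> rseq) \<times> 'a) topology" where
  "ev_pre A V = prod_topology (isom_space (Rn (dim V)) V) (level A (dim V))"

definition ev_rel :: "('g, 'a) gspectrum \<Rightarrow> rseq set
    \<Rightarrow> (((rseq \<Rightarrow> rseq) \<times> 'a) \<times> ((rseq \<Rightarrow> rseq) \<times> 'a)) set" where
  "ev_rel A V = (let n = dim V in
     {((compose (Rn n) f r, a), (f, strmap A n n (isom_omor r) a)) |f r a.
        f \<in> isoms (Rn n) V \<and> r \<in> isoms (Rn n) (Rn n) \<and> a \<in> topspace (level A n)}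
   \<union> {((f, basept A n), (f', basept A n)) |f f'. f \<in> isoms (Rn n) V \<and> f' \<in> isoms (Rn n) V})"

definition ev_class :: "('g, 'a) gspectrum \<Rightarrow> rseq set \<Rightarrow> (rseq \<Rightarrow> rseq) \<times> 'a \<Rightarrow> 'a evpt" where
  "ev_class A V = cgwh_class (ev_pre A V) (ev_rel A V)"

definition ev_space :: "('g, 'a) gspectrum \<Rightarrow> rseq set \<Rightarrow> 'a evpt topology" where
  "ev_space A V = cgwh_quotient (ev_pre A V) (ev_rel A V)"

text \<open>
  Maps out of quotients are written \<open>the_elem (F ` c)\<close>: the common value of \<open>F\<close> on the
  representatives of the class \<open>c\<close>.
\<close>

definition ev_base :: "('g, 'a) gspectrum \<Rightarrow> rseq set \<Rightarrow> 'a evpt" where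
  "ev_base A V = the_elem ((\<lambda>f. ev_class A V (f, basept A (dim V))) ` isoms (Rn (dim V)) V)"

text \<open>
  Functoriality in \<open>\<phi> \<in> O(V,W)\<close>: with \<open>n = dim V\<close> and \<open>m = dim W\<close>, the class of \<open>(f, a)\<close> goes to that
  of \<open>(b, A(b\<^sup>-\<^sup>1 \<phi> f) a)\<close> for any isometry \<open>b: \<real>\<^sup>m \<cong> W\<close>.
\<close>

definition ev_map ::
  "('g, 'a) gspectrum \<Rightarrow> rseq set \<Rightarrow> rseq set \<Rightarrow> omor \<Rightarrow> 'a evpt \<Rightarrow> 'a evpt" where
  "ev_map A V W \<phi> p = (let n = dim V; m = dim W in
     the_elem ((\<lambda>(b, f, a). ev_class A W (b,
         strmap A n m
           (ocomp (Rn n) (isom_omor (restrict (inv_into (Rn m) b) W))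
              (ocomp (Rn n) \<phi> (isom_omor f))) a))
       ` (isoms (Rn m) W \<times> p)))"

definition ev_act :: "('g, 'a) gspectrum \<Rightarrow> 'g rep \<Rightarrow> 'g \<Rightarrow> 'a evpt \<Rightarrow> 'a evpt" where
  "ev_act A V g p = (let n = dim (fst V) in
     the_elem ((\<lambda>(f, a). ev_class A (fst V) (compose (Rn n) (snd V g) f, gact A g n a)) ` p))"

definition ev_hom ::
  "('g, 'b) gspectrum \<Rightarrow> (nat \<Rightarrow> 'a \<Rightarrow> 'b) \<Rightarrow> rseq set \<Rightarrow> 'a evpt \<Rightarrow> 'b evpt" where
  "ev_hom B h V p = the_elem ((\<lambda>(f, a). ev_class B V (f, h (dim V) a)) ` p)"

definition ev_fixed :: "('g, 'a) gspectrum \<Rightarrow> 'g set \<Rightarrow> 'g rep \<Rightarrow> 'a evpt set" where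
  "ev_fixed A N V = {p \<in> topspace (ev_space A (fst V)). \<forall>n\<in>N. ev_act A V n p = p}"


section \<open>Geometric fixed points\<close>

text \<open>
  At level \<open>m\<close> the coend \<open>\<integral>\<^sup>W O(W\<^sup>N,\<real>\<^sup>m) \<and> (A\<^sub>W)\<^sup>N\<close> is the quotient of the disjoint union of the
  spaces \<open>O(W\<^sup>N,\<real>\<^sup>m) \<times> (A\<^sub>W)\<^sup>N\<close> in which all points having a base point coordinate are identified
  (giving the wedge of the smash products) and
  \<open>(\<psi> \<phi>\<^sup>N, p)\<close> at \<open>V\<close> is identified with \<open>(\<psi>, A\<^sub>\<phi> p)\<close> at \<open>W\<close> for \<open>\<phi> \<in> O(V,W)\<^sup>N\<close>.
\<close>

type_synonym ('g, 'a) geo_pre = "'g rep \<times> omor \<times> 'a evpt"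

definition geo_pre :: "'g monoid \<Rightarrow> 'g topology \<Rightarrow> 'g set \<Rightarrow> ('g, 'a) gspectrum \<Rightarrow> nat
    \<Rightarrow> ('g, 'a) geo_pre topology" where
  "geo_pre G T N A m =
     sum_topology
       (\<lambda>W. prod_topology (omor_space (fixed_space N W) (Rn m))
               (subtopology (ev_space A (fst W)) (ev_fixed A N W)))
       {W. orthogonal_rep G T W}"

definition geo_basepts :: "'g monoid \<Rightarrow> 'g topology \<Rightarrow> 'g set \<Rightarrow> ('g, 'a) gspectrum \<Rightarrow> nat
    \<Rightarrow> ('g, 'a) geo_pre set" where
  "geo_basepts G T N A m =
     {(W, \<psi>, p). (W, \<psi>, p) \<in> topspace (geo_pre G T N A m)
        \<and> (\<psi> = None \<or> p = ev_base A (fst W))}"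

definition geo_rel :: "'g monoid \<Rightarrow> 'g topology \<Rightarrow> 'g set \<Rightarrow> ('g, 'a) gspectrum \<Rightarrow> nat
    \<Rightarrow> (('g, 'a) geo_pre \<times> ('g, 'a) geo_pre) set" where
  "geo_rel G T N A m =
     {((V, ocomp (fixed_space N V) \<psi> (omor_fix N V \<phi>), p),
       (W, \<psi>, ev_map A (fst V) (fst W) \<phi> p)) |V W \<phi> \<psi> p.
        orthogonal_rep G T V \<and> orthogonal_rep G T W \<and> \<phi> \<in> fixed_omors G N V W
        \<and> \<psi> \<in> omors (fixed_space N W) (Rn m) \<and> p \<in> ev_fixed A N V}
   \<union> geo_basepts G T N A m \<times> geo_basepts G T N A m"

definition geo_class :: "'g monoid \<Rightarrow> 'g topology \<Rightarrow> 'g set \<Rightarrow> ('g, 'a) gspectrum \<Rightarrow> nat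
    \<Rightarrow> ('g, 'a) geo_pre \<Rightarrow> ('g, 'a) geo_pre set" where
  "geo_class G T N A m = cgwh_class (geo_pre G T N A m) (geo_rel G T N A m)"

text \<open>
  A coset \<open>gN\<close> sends the class of \<open>(\<psi>, p)\<close> at \<open>W\<close> to that of \<open>(\<psi> g\<^sup>-\<^sup>1, g p)\<close>: this is the conjugation
  action on \<open>O(W\<^sup>N,\<real>\<^sup>m)\<close> with \<open>\<real>\<^sup>m\<close> trivial, smashed with the action on \<open>(A\<^sub>W)\<^sup>N\<close>.
\<close>

definition geo_fix :: "'g monoid \<Rightarrow> 'g topology \<Rightarrow> 'g set \<Rightarrow> ('g, 'a) gspectrum
    \<Rightarrow> ('g set, ('g, 'a) geo_pre set) gspectrum" where
  "geo_fix G T N A =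
     \<lparr>level = (\<lambda>m. cgwh_quotient (geo_pre G T N A m) (geo_rel G T N A m)),
      basept = (\<lambda>m. the_elem (geo_class G T N A m ` geo_basepts G T N A m)),
      strmap = (\<lambda>m n \<theta> c.
        the_elem ((\<lambda>(W, \<psi>, p). geo_class G T N A n (W, ocomp (fixed_space N W) \<theta> \<psi>, p)) ` c)),
      gact = (\<lambda>C m c.
        the_elem ((\<lambda>(g, W, \<psi>, p). geo_class G T N A m
            (W,
             ocomp (fixed_space N W) \<psi>
               (isom_omor (restrict (snd W (inv\<^bsub>G\<^esub> g)) (fixed_space N W))),
             ev_act A W g p))
          ` (C \<times> c)))\<rparr>"

definition geo_fix_hom :: "'g monoid \<Rightarrow> 'g topology \<Rightarrow> 'g set \<Rightarrow> ('g, 'b) gspectrum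
    \<Rightarrow> (nat \<Rightarrow> 'a \<Rightarrow> 'b) \<Rightarrow> nat \<Rightarrow> ('g, 'a) geo_pre set \<Rightarrow> ('g, 'b) geo_pre set" where
  "geo_fix_hom G T N B h m c =
     the_elem ((\<lambda>(W, \<psi>, p). geo_class G T N B m (W, \<psi>, ev_hom B h (fst W) p)) ` c)"

abbreviation subgrp :: "'g monoid \<Rightarrow> 'g set \<Rightarrow> 'g monoid" where
  "subgrp G H \<equiv> G\<lparr>carrier := H\<rparr>"

text \<open>
  The map on coends induced by \<open>V \<mapsto> i\<^sup>*V\<close>. The spaces \<open>V\<^sup>N\<close> and \<open>(A\<^sub>V)\<^sup>N\<close> only depend on the
  restricted representation, so the coordinates \<open>\<psi>\<close> and \<open>p\<close> stay the same.
\<close>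

definition geo_compare :: "'g monoid \<Rightarrow> 'g topology \<Rightarrow> 'g set \<Rightarrow> 'g set \<Rightarrow> ('g, 'a) gspectrum
    \<Rightarrow> nat \<Rightarrow> ('g, 'a) geo_pre set \<Rightarrow> ('g, 'a) geo_pre set" where
  "geo_compare G T N H A m c =
     the_elem ((\<lambda>(V, \<psi>, p). geo_class (subgrp G H) (subtopology T H) N (res_spectrum H A) m
                   (res_rep H V, \<psi>, p)) ` c)"

definition orthogonally_final :: "'g monoid \<Rightarrow> 'g topology \<Rightarrow> 'g set \<Rightarrow> bool" where
  "orthogonally_final G T N \<longleftrightarrow>
     (\<forall>W. orthogonal_rep (subgrp G N) (subtopology T N) W \<longrightarrow>
       (\<exists>V e. orthogonal_rep G T V \<and> e \<in> isoms (fst W) (fst V)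
          \<and> (\<forall>n\<in>N. \<forall>w\<in>fst W. e (snd W n w) = snd V n (e w))
          \<and> e ` fixed_space N W = fixed_space N V))"

end

theory Submission
  imports Defs
begin

text \<open>
  Morphisms in both indexing categories are only required to be \<open>N\<close>-equivariant, so \<open>V \<mapsto> i\<^sup>*V\<close> is
  fully faithful, and the point is that every \<open>H\<close>-representation \<open>W\<close> can be replaced by a restricted one.
  Finality yields an \<open>N\<close>-linear embedding \<open>e: W \<rightarrow> V\<close> into a \<open>G\<close>-representation with \<open>e(W\<^sup>N) = V\<^sup>N\<close>, and in
  the coend the class of \<open>(\<psi>, p)\<close> at \<open>W\<close> equals that of \<open>(\<psi> e\<^sup>-\<^sup>1, A\<^sub>e p)\<close> at \<open>V\<close>; this formula defines the inverse.
  It respects the relation given by a morphism \<open>W\<^sub>1 \<rightarrow> W\<^sub>2\<close> (for the identity: it does not depend on \<open>e\<close>)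
  because two targets \<open>V\<^sub>1\<close> and \<open>V\<^sub>2\<close> have an amalgamated sum along \<open>W\<^sub>1\<close>, an \<open>N\<close>-representation without
  new fixed points, which finality embeds into a third \<open>G\<close>-representation.

  The topology enters through the universal property of weak Hausdorff quotients, which is compatible with products
  with compact Hausdorff spaces; this makes the coends spectra and the two maps continuous.
\<close>

section \<open>Compactly generated weak Hausdorff spaces\<close>

text \<open>The equivalence relation behind a weak Hausdorff quotient is known only as an
  intersection, so equality of classes is not analysed directly. Classes are shown equal by a
  generating relation, and a map on classes is well defined once it comes from a continuous map to a
  weak Hausdorff space that respects the generators. Continuity must thus be proved before a map of
  coends exists. The amalgamation is shaped by the vector x of a morphism \<phi> = (f, x): it is
  fixed by N and orthogonal to f(W1). The arrow from V1 to the common target V3 has to carry the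
  image of x, which must then be orthogonal to the image of all of V1, not only to that of W1. It
  is, because in the amalgamated sum the complements of the common part are orthogonal to each
  other. In turn \<psi> has to be pulled back to V3^N, which needs V2^N -> V3^N to be bijective;
  hence no fixed vectors may be added. The embeddings are only N-linear, so equivariance of the
  inverse under H/N is not read off its formula; it follows because the inverse inverts an
  equivariant map.\<close>

lemma topspace_final_topology [simp]: "topspace (final_topology X f) = f ` topspace X"
proof
  show "topspace (final_topology X f) \<subseteq> f ` topspace X"
    using openin_final_topology[of X f "topspace (final_topology X f)"] by auto
  have "{x \<in> topspace X. f x \<in> f ` topspace X} = topspace X" by auto
  then have "openin (final_topology X f) (f ` topspace X)"
    by (simp add: openin_final_topology)
  then show "f ` topspace X \<subseteq> topspace (final_topology X f)" by (rule openin_subset)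
qed

lemma quotient_map_final_topology: "quotient_map X (final_topology X f) f"
  unfolding quotient_map_def by (auto simp: openin_final_topology)

text \<open>These subsets replace the test maps u: K -> X; in a weak Hausdorff space they are
  exactly the images of compact Hausdorff spaces. Hausdorffness is demanded of the subspace, since a
  compact subset of a weak Hausdorff space need not have it.\<close>

definition compact_Hausdorff_in :: "'a topology \<Rightarrow> 'a set \<Rightarrow> bool" where
  "compact_Hausdorff_in X C \<longleftrightarrow> compactin X C \<and> Hausdorff_space (subtopology X C)"

lemma compact_Hausdorff_in_subset: "compact_Hausdorff_in X C \<Longrightarrow> C \<subseteq> topspace X"
  by (simp add: compact_Hausdorff_in_def compactin_subset_topspace)

lemma compact_Hausdorff_in_subtopology:
  assumes "compact_Hausdorff_in X C"
  shows "compact_space (subtopology X C)" "Hausdorff_space (subtopology X C)"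
    "topspace (subtopology X C) = C"
  using assms compactin_subset_topspace topspace_subtopology_subset
  by (auto simp: compact_Hausdorff_in_def compact_space_subtopology)

text \<open>
  The closure of a section of \<open>u\<close> embeds into the sets of subsets of the image, by sending a point
  to the traces of its neighbourhoods on the dense set of chosen points.
\<close>

lemma weak_Hausdorff_closedin_image:
  fixes X :: "'a topology" and K :: "'k topology"
  assumes X: "weak_Hausdorff_space X" and K: "compact_space K" "Hausdorff_space K"
    and u: "continuous_map K X u"
  shows "closedin X (u ` topspace K)"
proof -
  define s where "s y = (SOME k. k \<in> topspace K \<and> u k = y)" for y
  define D where "D = s ` (u ` topspace K)"
  have s: "s y \<in> topspace K \<and> u (s y) = y" if "y \<in> u ` topspace K" for y
    unfolding s_def by (rule someI_ex) (use that in auto)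
  have D: "D \<subseteq> topspace K" "u ` D = u ` topspace K" "inj_on u D"
    using s by (auto simp: D_def image_iff inj_on_def) 
  define L where "L = subtopology K (K closure_of D)"
  have L: "compact_space L" "Hausdorff_space L" "topspace L = K closure_of D"
    using K topspace_subtopology_subset[OF closure_of_subset_topspace[of K D]]
    by (simp_all add: L_def closedin_compact_space compact_space_subtopology
        Hausdorff_space_subtopology)
  have DL: "D \<subseteq> topspace L" unfolding L(3) using D(1) by (rule closure_of_subset)
  have uL: "u ` topspace L = u ` topspace K"
  proof
    show "u ` topspace L \<subseteq> u ` topspace K"
      unfolding L(3) by (rule image_mono[OF closure_of_subset_topspace])
    show "u ` topspace K \<subseteq> u ` topspace L" using D(2) DL by blast
  qed
  have dense: "V \<inter> D \<noteq> {}" if "openin K V" "k \<in> V" "k \<in> topspace L" for V k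
    using that unfolding L(3) in_closure_of by blast
  define j where "j k = {u ` (V \<inter> D) |V. openin K V \<and> k \<in> V}" for k
  have inj: "inj_on j (topspace L)"
  proof (rule inj_onI, rule ccontr)
    fix k l assume kl: "k \<in> topspace L" "l \<in> topspace L" "j k = j l" "k \<noteq> l"
    then have "k \<in> topspace K" "l \<in> topspace K"
      using closure_of_subset_topspace[of K D] by (auto simp: L(3))
    with K kl obtain V W where VW: "openin K V" "openin K W" "k \<in> V" "l \<in> W" "disjnt V W"
      unfolding Hausdorff_space_def by metis
    then have "u ` (V \<inter> D) \<in> j l" using kl by (auto simp: j_def)
    then obtain V' where V': "u ` (V \<inter> D) = u ` (V' \<inter> D)" "openin K V'" "l \<in> V'"
      by (auto simp: j_def)
    then have eq: "V \<inter> D = V' \<inter> D"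
      using D(3) by (metis inf_le2 inj_on_image_eq_iff)
    \<comment> \<open>A neighbourhood of a point in the closure of \<open>D\<close> contains a
      chosen point. Here that point lies in \<open>V\<close> as well, because \<open>V\<close> and
      \<open>V'\<close> have the same trace, and this contradicts the separation of \<open>V\<close>
      and \<open>W\<close>.\<close>
    have "(V' \<inter> W) \<inter> D \<noteq> {}"
      using dense[of "V' \<inter> W" l] V' VW kl by auto
    then show False using eq VW(5) by (auto simp: disjnt_def)
  qed
  \<comment> \<open>\<open>M\<close> is a copy of \<open>L\<close> on the type of sets of sets, the
    only type over which the definition of weak Hausdorffness quantifies.\<close>
  define M where "M = final_topology L j"
  have "homeomorphic_map L M j"
    using quotient_map_final_topology[of L j] inj
    by (simp add: M_def homeomorphic_map_def)
  then obtain i where i: "homeomorphic_maps L M j i" 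
    by (auto simp: homeomorphic_map_maps)
  then have "L homeomorphic_space M" by (auto simp: homeomorphic_space_def)
  then have M: "compact_space M" "Hausdorff_space M"
    using L homeomorphic_compact_space homeomorphic_Hausdorff_space by blast+
  have iL: "i ` topspace M = topspace L" and ic: "continuous_map M L i"
    using i homeomorphic_imp_surjective_map[of M L i]
    by (simp_all add: homeomorphic_maps_map homeomorphic_imp_continuous_map)
  have "continuous_map L X u"
    unfolding L_def using u by (rule continuous_map_from_subtopology)
  then have "continuous_map M X (u \<circ> i)" using ic continuous_map_compose by blast
  with X M have "closedin X ((u \<circ> i) ` topspace M)"
    unfolding weak_Hausdorff_space_def by blast
  then show ?thesis using iL uL by (metis image_comp)
qed

lemma weak_Hausdorff_closedin_in:
  assumes "weak_Hausdorff_space X" "compact_Hausdorff_in X C"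
  shows "closedin X C"
  using weak_Hausdorff_closedin_image[OF assms(1), of "subtopology X C" id]
    compact_Hausdorff_in_subtopology[OF assms(2)]
  by (simp add: continuous_map_from_subtopology)

text \<open>A closed subset of K is again a compact Hausdorff test space, so u is a closed map onto
  its image; and a closed continuous image of a normal Hausdorff space is Hausdorff.\<close>

lemma weak_Hausdorff_compact_Hausdorff_image:
  assumes X: "weak_Hausdorff_space X" and K: "compact_space K" "Hausdorff_space K"
    and u: "continuous_map K X u"
  shows "compact_Hausdorff_in X (u ` topspace K)"
proof -
  let ?U = "u ` topspace K"
  have comp: "compactin X ?U"
    using K u image_compactin compact_space_def by metis
  have top: "topspace (subtopology X ?U) = ?U"
    by (rule topspace_subtopology_subset[OF compactin_subset_topspace[OF comp]])
  have cont: "continuous_map K (subtopology X ?U) u"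
    using u by (simp add: continuous_map_in_subtopology)
  have "closed_map K (subtopology X ?U) u"
    unfolding closed_map_def
  proof (intro allI impI)
    fix C assume C: "closedin K C"
    then have "C \<subseteq> topspace K" by (rule closedin_subset)
    then have "topspace (subtopology K C) = C" by (rule topspace_subtopology_subset)
    moreover have "compact_space (subtopology K C)"
      using K C by (simp add: closedin_compact_space compact_space_subtopology)
    ultimately have "closedin X (u ` C)"
      using weak_Hausdorff_closedin_image[OF X, of "subtopology K C" u] K u
      by (simp add: Hausdorff_space_subtopology continuous_map_from_subtopology del: topspace_subtopology)
    then show "closedin (subtopology X ?U) (u ` C)"
      using \<open>C \<subseteq> topspace K\<close> by (intro closedin_subset_topspace) auto
  qed
  moreover have "normal_space K"
    using K by (simp add: compact_Hausdorff_or_regular_imp_normal_space)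
  ultimately have "Hausdorff_space (subtopology X ?U)"
    using normal_Hausdorff_space_closed_continuous_map_image[of K "subtopology X ?U" u]
      K cont top by blast
  with comp show ?thesis by (simp add: compact_Hausdorff_in_def)
qed

lemma compact_Hausdorff_in_image:
  assumes "compact_Hausdorff_in X C" "continuous_map X Y f" "weak_Hausdorff_space Y"
  shows "compact_Hausdorff_in Y (f ` C)"
  using weak_Hausdorff_compact_Hausdorff_image[OF assms(3), of "subtopology X C" f]
    compact_Hausdorff_in_subtopology[OF assms(1)] assms(2)
  by (simp add: continuous_map_from_subtopology)

section \<open>Permanence properties of weak Hausdorff spaces\<close>

lemma Hausdorff_imp_weak_Hausdorff:
  assumes "Hausdorff_space X"
  shows "weak_Hausdorff_space X"
  unfolding weak_Hausdorff_space_def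
  using assms compactin_imp_closedin image_compactin compact_space_def by metis

text \<open>By injectivity the image of a test space in X is the full preimage of its image in Y.
  The weak Hausdorff property of quotients is always obtained in this way, from an injective
  continuous map to a known space.\<close>

lemma weak_Hausdorff_injection:
  assumes f: "continuous_map X Y f" "inj_on f (topspace X)" and Y: "weak_Hausdorff_space Y"
  shows "weak_Hausdorff_space X"
  unfolding weak_Hausdorff_space_def
proof (intro allI impI, elim conjE)
  fix K :: "'a set set topology" and u
  assume K: "compact_space K" "Hausdorff_space K" and u: "continuous_map K X u"
  have "closedin Y ((f \<circ> u) ` topspace K)"
    using weak_Hausdorff_closedin_image[OF Y K] u f continuous_map_compose by blast
  then have "closedin X {x \<in> topspace X. f x \<in> (f \<circ> u) ` topspace K}"
    using f closedin_continuous_map_preimage by blast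
  moreover have "u ` topspace K \<subseteq> topspace X"
    using u by (simp add: continuous_map_image_subset_topspace)
  then have "{x \<in> topspace X. f x \<in> (f \<circ> u) ` topspace K} = u ` topspace K"
    using f(2) by (auto simp: inj_on_def)
  ultimately show "closedin X (u ` topspace K)" by simp
qed

lemma weak_Hausdorff_subtopology:
  "weak_Hausdorff_space X \<Longrightarrow> weak_Hausdorff_space (subtopology X S)"
  by (rule weak_Hausdorff_injection[of _ X id]) (auto simp: continuous_map_from_subtopology)

text \<open>Products are reduced to this: the image of a test map lies in the box of its coordinate
  images, and that box is closed, compact and Hausdorff because each factor is weak
  Hausdorff.\<close>

lemma closedin_compact_image_of_closed:
  assumes "closedin X B" "compact_space (subtopology X B)" "Hausdorff_space (subtopology X B)"
    "compact_space K" "continuous_map K X u" "u ` topspace K \<subseteq> B"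
  shows "closedin X (u ` topspace K)"
proof -
  have "continuous_map K (subtopology X B) u"
    using assms by (simp add: continuous_map_in_subtopology image_subset_iff)
  then have "compactin (subtopology X B) (u ` topspace K)"
    using assms(4) image_compactin compact_space_def by metis
  then have "closedin (subtopology X B) (u ` topspace K)"
    using assms(3) compactin_imp_closedin by blast
  then show ?thesis using assms(1) closedin_trans_full by blast
qed

lemma weak_Hausdorff_prod:
  assumes "weak_Hausdorff_space X" "weak_Hausdorff_space Y"
  shows "weak_Hausdorff_space (prod_topology X Y)"
  unfolding weak_Hausdorff_space_def
proof (intro allI impI, elim conjE)
  fix K :: "('a \<times> 'b) set set topology" and u
  assume K: "compact_space K" "Hausdorff_space K" and u: "continuous_map K (prod_topology X Y) u"
  let ?A = "(fst \<circ> u) ` topspace K" and ?B = "(snd \<circ> u) ` topspace K"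
  have c: "continuous_map K X (fst \<circ> u)" "continuous_map K Y (snd \<circ> u)"
    using u by (simp_all add: continuous_map_pairwise)
  have A: "compact_Hausdorff_in X ?A" and B: "compact_Hausdorff_in Y ?B"
    using weak_Hausdorff_compact_Hausdorff_image assms K c by blast+
  have cl: "closedin (prod_topology X Y) (?A \<times> ?B)"
    using weak_Hausdorff_closedin_in[OF assms(1) A] weak_Hausdorff_closedin_in[OF assms(2) B]
    by (simp add: closedin_prod_Times_iff)
  have sub: "subtopology (prod_topology X Y) (?A \<times> ?B)
      = prod_topology (subtopology X ?A) (subtopology Y ?B)"
    by (rule subtopology_Times)
  show "closedin (prod_topology X Y) (u ` topspace K)"
  proof (rule closedin_compact_image_of_closed[OF cl _ _ K(1) u])
    show "compact_space (subtopology (prod_topology X Y) (?A \<times> ?B))"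
      "Hausdorff_space (subtopology (prod_topology X Y) (?A \<times> ?B))"
      unfolding sub using compact_Hausdorff_in_subtopology(1,2)[OF A]
        compact_Hausdorff_in_subtopology(1,2)[OF B]
      by (simp_all add: compact_space_prod_topology Hausdorff_space_prod_topology)
    show "u ` topspace K \<subseteq> ?A \<times> ?B"
    proof
      fix z assume "z \<in> u ` topspace K"
      then obtain k where "k \<in> topspace K" "z = u k" by blast
      then have "fst z \<in> ?A" "snd z \<in> ?B" by simp_all
      then show "z \<in> ?A \<times> ?B" by (simp add: mem_Times_iff)
    qed
  qed
qed

lemma weak_Hausdorff_product:
  fixes X :: "'i \<Rightarrow> 'a topology"
  assumes "\<And>i. i \<in> I \<Longrightarrow> weak_Hausdorff_space (X i)"
  shows "weak_Hausdorff_space (product_topology X I)"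
  unfolding weak_Hausdorff_space_def
proof (intro allI impI, elim conjE)
  fix K :: "('i \<Rightarrow> 'a) set set topology" and u
  assume K: "compact_space K" "Hausdorff_space K" and u: "continuous_map K (product_topology X I) u"
  let ?A = "\<lambda>i. (\<lambda>k. u k i) ` topspace K"
  have c: "continuous_map K (X i) (\<lambda>k. u k i)" if "i \<in> I" for i
    using u that by (simp add: continuous_map_componentwise)
  have A: "compact_Hausdorff_in (X i) (?A i)" if "i \<in> I" for i
    using weak_Hausdorff_compact_Hausdorff_image assms K c that by blast
  have cl: "closedin (product_topology X I) (PiE I ?A)"
    using A assms weak_Hausdorff_closedin_in by (subst closedin_product_topology) blast
  have sub: "subtopology (product_topology X I) (PiE I ?A)
      = product_topology (\<lambda>i. subtopology (X i) (?A i)) I"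
    by (rule subtopology_product_topology)
  have "u ` topspace K \<subseteq> PiE I ?A"
    using u by (auto simp: continuous_map_componentwise)
  moreover have "compact_space (subtopology (product_topology X I) (PiE I ?A))"
    unfolding sub using A compact_Hausdorff_in_subtopology
    by (subst compact_space_product_topology) blast
  moreover have "Hausdorff_space (subtopology (product_topology X I) (PiE I ?A))"
    unfolding sub using A compact_Hausdorff_in_subtopology
    by (subst Hausdorff_space_product_topology) blast
  ultimately show "closedin (product_topology X I) (u ` topspace K)"
    using closedin_compact_image_of_closed[OF cl _ _ K(1) u] by blast
qed

text \<open>Closedness in a sum is tested on each summand, and the part of K that lies over one
  summand is closed in K, hence again a compact Hausdorff test space.\<close>

lemma weak_Hausdorff_sum:
  fixes X :: "'i \<Rightarrow> 'a topology"
  assumes "\<And>i. i \<in> I \<Longrightarrow> weak_Hausdorff_space (X i)"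
  shows "weak_Hausdorff_space (sum_topology X I)"
  unfolding weak_Hausdorff_space_def
proof (intro allI impI, elim conjE)
  fix K :: "('i \<times> 'a) set set topology" and u
  assume K: "compact_space K" "Hausdorff_space K" and u: "continuous_map K (sum_topology X I) u"
  have ut: "u k \<in> Sigma I (topspace \<circ> X)" if "k \<in> topspace K" for k
    using u that by (auto simp: continuous_map_def)
  have "closedin (X i) {x. (i, x) \<in> u ` topspace K}" if i: "i \<in> I" for i
  proof -
    let ?K = "{k \<in> topspace K. u k \<in> Pair i ` topspace (X i)}"
    have "closedin (sum_topology X I) (Pair i ` topspace (X i))"
      using closed_map_component_injection[OF i, of X] by (simp add: closed_map_def)
    then have cK: "closedin K ?K"
      using u closedin_continuous_map_preimage by blast
    have emb: "embedding_map (X i) (sum_topology X I) (Pair i)"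
      by (simp add: closed_map_component_injection[OF i] continuous_map_component_injection[OF i]
          injective_closed_imp_embedding_map inj_on_def)
    have "continuous_map (subtopology K ?K) (subtopology (sum_topology X I) (Pair i ` topspace (X i))) u"
      using u by (auto simp: continuous_map_in_subtopology continuous_map_from_subtopology)
    moreover have "continuous_map (subtopology (sum_topology X I) (Pair i ` topspace (X i))) (X i) snd"
      unfolding continuous_map_def
    proof (intro conjI allI impI)
      show "snd \<in> topspace (subtopology (sum_topology X I) (Pair i ` topspace (X i))) \<rightarrow> topspace (X i)"
        by auto
      fix U assume U: "openin (X i) U"
      then have "openin (sum_topology X I) (Pair i ` U)"
        using open_map_component_injection[OF i, of X] by (simp add: open_map_def)
      moreover have "{x \<in> topspace (subtopology (sum_topology X I) (Pair i ` topspace (X i))). snd x \<in> U}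
        = Pair i ` U \<inter> Pair i ` topspace (X i)" 
        using openin_subset[OF U] i by auto
      ultimately show "openin (subtopology (sum_topology X I) (Pair i ` topspace (X i)))
          {x \<in> topspace (subtopology (sum_topology X I) (Pair i ` topspace (X i))). snd x \<in> U}"
        by (metis openin_subtopology)
    qed
    ultimately have "continuous_map (subtopology K ?K) (X i) (snd \<circ> u)"
      using continuous_map_compose by blast
    moreover have "compact_space (subtopology K ?K)"
      using cK K closedin_compact_space compact_space_subtopology by blast
    moreover have "Hausdorff_space (subtopology K ?K)"
      using K Hausdorff_space_subtopology by blast
    ultimately have "closedin (X i) ((snd \<circ> u) ` topspace (subtopology K ?K))"
      using weak_Hausdorff_closedin_image assms i by blast
    moreover have "(snd \<circ> u) ` topspace (subtopology K ?K) = {x. (i, x) \<in> u ` topspace K}"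
      using ut by (force simp: image_iff)
    ultimately show ?thesis by simp
  qed
  then show "closedin (sum_topology X I) (u ` topspace K)"
    using ut by (subst closedin_sum_topology) blast
qed

text \<open>Intrinsic form of the definition. A test map u pulls \<open>A\<close> and the
  intersection of \<open>A\<close> with its image back to the same set; conversely a compact
  Hausdorff subset is tested by its inclusion.\<close>

lemma CGWH_space_iff:
  fixes X :: "'a topology"
  shows "CGWH_space X \<longleftrightarrow> weak_Hausdorff_space X
    \<and> (\<forall>A \<subseteq> topspace X. (\<forall>C. compact_Hausdorff_in X C \<longrightarrow> closedin X (A \<inter> C)) \<longrightarrow> closedin X A)"
    (is "?l \<longleftrightarrow> ?r")
proof
  assume l: ?l
  then have X: "weak_Hausdorff_space X" by (simp add: CGWH_space_def)
  have "closedin X A"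
    if A: "A \<subseteq> topspace X" and C: "\<And>C. compact_Hausdorff_in X C \<Longrightarrow> closedin X (A \<inter> C)" for A
  proof -
    have "closedin K {k \<in> topspace K. u k \<in> A}"
      if K: "compact_space K" "Hausdorff_space K" and u: "continuous_map K X u"
      for K :: "'a set set topology" and u
    proof -
      have "closedin X (A \<inter> u ` topspace K)"
        using C weak_Hausdorff_compact_Hausdorff_image X K u by blast
      then have "closedin K {k \<in> topspace K. u k \<in> A \<inter> u ` topspace K}"
        using closedin_continuous_map_preimage[OF u] by blast
      moreover have "{k \<in> topspace K. u k \<in> A \<inter> u ` topspace K} = {k \<in> topspace K. u k \<in> A}"
        by blast
      ultimately show ?thesis by simp
    qed
    then show ?thesis
      using l A unfolding CGWH_space_def compactly_generated_space_def by blast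
  qed
  with X show ?r by blast
next
  assume r: ?r
  have "closedin X A"
    if A: "A \<subseteq> topspace X" and K: "\<And>(K :: 'a set set topology) u. compact_space K \<Longrightarrow> Hausdorff_space K
      \<Longrightarrow> continuous_map K X u \<Longrightarrow> closedin K {k \<in> topspace K. u k \<in> A}" for A
  proof -
    have "closedin X (A \<inter> C)" if C: "compact_Hausdorff_in X C" for C
    proof -
      let ?C = "subtopology X C"
      \<comment> \<open>Double singletons copy \<open>C\<close> injectively into the type prescribed
        for test spaces.\<close>
      define j where "j = (\<lambda>x::'a. {{x}})"
      have tC: "topspace ?C = C" by (rule compact_Hausdorff_in_subtopology[OF C])
      define M where "M = final_topology ?C j"
      have inj: "inj_on j (topspace ?C)" by (auto simp: inj_on_def j_def)
      then have hj: "homeomorphic_map ?C M j"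
        using quotient_map_final_topology[of ?C j] by (simp add: M_def homeomorphic_map_def)
      then obtain i where i: "homeomorphic_maps ?C M j i" by (auto simp: homeomorphic_map_maps)
      have "?C homeomorphic_space M" using i by (auto simp: homeomorphic_space_def)
      then have M: "compact_space M" "Hausdorff_space M"
        using compact_Hausdorff_in_subtopology[OF C] homeomorphic_compact_space
          homeomorphic_Hausdorff_space by blast+
      have "continuous_map M X i"
        using i by (simp add: homeomorphic_maps_def continuous_map_in_subtopology)
      from K[OF M this] have "closedin M {k \<in> topspace M. i k \<in> A}" .
      then have "closedin ?C {x \<in> topspace ?C. j x \<in> {k \<in> topspace M. i k \<in> A}}"
        using closedin_continuous_map_preimage homeomorphic_imp_continuous_map[OF hj] by blast
      moreover have "{x \<in> topspace ?C. j x \<in> {k \<in> topspace M. i k \<in> A}} = A \<inter> C"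
        using i homeomorphic_imp_surjective_map[OF hj] unfolding tC homeomorphic_maps_def tC by auto
      moreover have "closedin X C" using r C weak_Hausdorff_closedin_in by blast
      ultimately show ?thesis using closedin_trans_full by metis
    qed
    with r A show ?thesis by blast
  qed
  then have "compactly_generated_space X"
    unfolding compactly_generated_space_def by (intro allI impI) metis
  with r show ?l by (simp add: CGWH_space_def)
qed

section \<open>Constructions preserving compactly generated weak Hausdorff spaces\<close>

lemma CGWH_imp_weak_Hausdorff: "CGWH_space X \<Longrightarrow> weak_Hausdorff_space X"
  by (simp add: CGWH_space_def)

lemma CGWH_closedinI:
  assumes "CGWH_space X" "A \<subseteq> topspace X" "\<And>C. compact_Hausdorff_in X C \<Longrightarrow> closedin X (A \<inter> C)"
  shows "closedin X A"
  using assms CGWH_space_iff by blast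

text \<open>For compact Hausdorff D the image f(D) is compact Hausdorff, since Y is weak Hausdorff.
  The preimage of A meets D in the same set as the preimage of A \<inter> f(D) does, which is
  closed.\<close>

lemma CGWH_quotient_map:
  assumes X: "CGWH_space X" and f: "quotient_map X Y f" and Y: "weak_Hausdorff_space Y"
  shows "CGWH_space Y"
  unfolding CGWH_space_iff
proof (intro conjI allI impI Y)
  fix A assume A: "A \<subseteq> topspace Y" and C: "\<forall>C. compact_Hausdorff_in Y C \<longrightarrow> closedin Y (A \<inter> C)"
  have cf: "continuous_map X Y f" using f by (rule quotient_imp_continuous_map)
  have "closedin X {x \<in> topspace X. f x \<in> A}"
  proof (rule CGWH_closedinI[OF X])
    fix D assume D: "compact_Hausdorff_in X D"
    then have "closedin Y (A \<inter> f ` D)" using C compact_Hausdorff_in_image[OF D cf Y] by blast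
    then have "closedin X {x \<in> topspace X. f x \<in> A \<inter> f ` D}"
      using closedin_continuous_map_preimage[OF cf] by blast
    moreover have "closedin X D"
      using weak_Hausdorff_closedin_in CGWH_imp_weak_Hausdorff X D by blast
    ultimately have "closedin X ({x \<in> topspace X. f x \<in> A \<inter> f ` D} \<inter> D)" by blast
    then show "closedin X ({x \<in> topspace X. f x \<in> A} \<inter> D)"
      by (rule back_subst[of "closedin X"]) auto
  qed auto
  then show "closedin Y A" using f A unfolding quotient_map_closedin by blast
qed

lemma CGWH_closed_subspace:
  assumes X: "CGWH_space X" and S: "closedin X S"
  shows "CGWH_space (subtopology X S)"
  unfolding CGWH_space_iff
proof (intro conjI allI impI)
  show "weak_Hausdorff_space (subtopology X S)"
    using X by (simp add: CGWH_imp_weak_Hausdorff weak_Hausdorff_subtopology)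
  have tS: "topspace (subtopology X S) = S"
    by (rule topspace_subtopology_subset[OF closedin_subset[OF S]])
  fix A assume A: "A \<subseteq> topspace (subtopology X S)"
    and C: "\<forall>C. compact_Hausdorff_in (subtopology X S) C \<longrightarrow> closedin (subtopology X S) (A \<inter> C)"
  have "closedin X A"
  proof (rule CGWH_closedinI[OF X])
    show "A \<subseteq> topspace X" using A by auto
    fix D assume D: "compact_Hausdorff_in X D"
    have cD: "compactin X D" "Hausdorff_space (subtopology X D)"
      using D by (auto simp: compact_Hausdorff_in_def)
    have "compactin X (S \<inter> D)" using closed_Int_compactin S cD by blast
    moreover have "subtopology (subtopology X S) (S \<inter> D) = subtopology (subtopology X D) S"
      by (simp add: subtopology_subtopology Int_ac)
    ultimately have "compact_Hausdorff_in (subtopology X S) (S \<inter> D)"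
      using cD by (simp add: compact_Hausdorff_in_def compactin_subtopology Hausdorff_space_subtopology)
    then have "closedin (subtopology X S) (A \<inter> (S \<inter> D))" using C by blast
    then have "closedin X (A \<inter> (S \<inter> D))" using S closedin_trans_full by blast
    moreover have "A \<inter> (S \<inter> D) = A \<inter> D" using A tS by blast
    ultimately show "closedin X (A \<inter> D)" by simp
  qed
  then show "closedin (subtopology X S) A"
    using A tS by (metis closedin_subset_topspace)
qed

text \<open>A tube argument. Near a point (k, x) outside A the slice of A over x avoids a closed
  neighbourhood V of k. The shadow on X of the part of A over V is closed and misses x, and this
  yields an open box around (k, x) that misses A.\<close>

lemma CGWH_prod_compact:
  assumes K: "compact_space K" "Hausdorff_space K" and X: "CGWH_space X"
  shows "CGWH_space (prod_topology K X)"
  unfolding CGWH_space_iff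
proof (intro conjI allI impI)
  show "weak_Hausdorff_space (prod_topology K X)"
    using K X by (simp add: CGWH_imp_weak_Hausdorff Hausdorff_imp_weak_Hausdorff weak_Hausdorff_prod)
  fix A assume A: "A \<subseteq> topspace (prod_topology K X)"
    and C: "\<forall>C. compact_Hausdorff_in (prod_topology K X) C \<longrightarrow> closedin (prod_topology K X) (A \<inter> C)"
  have slab: "closedin (prod_topology K X) (A \<inter> (topspace K \<times> D))" if D: "compact_Hausdorff_in X D" for D
  proof -
    have "compactin (prod_topology K X) (topspace K \<times> D)"
      using D K by (simp add: compactin_Times compact_Hausdorff_in_def compact_space_def)
    moreover have "Hausdorff_space (subtopology (prod_topology K X) (topspace K \<times> D))"
      using D K by (simp add: subtopology_Times Hausdorff_space_prod_topology compact_Hausdorff_in_def)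
    ultimately show ?thesis using C by (simp add: compact_Hausdorff_in_def)
  qed
  have "openin (prod_topology K X) (topspace (prod_topology K X) - A)"
  proof (subst openin_subopen, intro ballI)
    fix z assume z: "z \<in> topspace (prod_topology K X) - A"
    obtain k x where kx: "z = (k, x)" "k \<in> topspace K" "x \<in> topspace X" "(k, x) \<notin> A"
      using z by (cases z) auto
    have "compact_Hausdorff_in X {x}"
      using kx by (simp add: compact_Hausdorff_in_def Hausdorff_space_def)
    then have "closedin (prod_topology K X) (A \<inter> (topspace K \<times> {x}))" by (rule slab)
    moreover have "continuous_map K (prod_topology K X) (\<lambda>k. (k, x))"
      using kx by (simp add: continuous_map_pairedI)
    ultimately have "closedin K {k \<in> topspace K. (k, x) \<in> A \<inter> (topspace K \<times> {x})}"
      using closedin_continuous_map_preimage by blast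
    moreover have "{k \<in> topspace K. (k, x) \<in> A \<inter> (topspace K \<times> {x})} = {k \<in> topspace K. (k, x) \<in> A}"
      by auto
    ultimately have "closedin K {k \<in> topspace K. (k, x) \<in> A}" by simp
    then have "openin K (topspace K - {k \<in> topspace K. (k, x) \<in> A})" by blast
    moreover have "neighbourhood_base_of (closedin K) K"
      using K by (simp add: compact_Hausdorff_imp_regular_space neighbourhood_base_of_closedin)
    ultimately obtain U V where UV: "openin K U" "closedin K V" "k \<in> U" "U \<subseteq> V"
      "V \<subseteq> topspace K - {k \<in> topspace K. (k, x) \<in> A}"
      using kx unfolding neighbourhood_base_of by (metis (no_types, lifting) DiffI mem_Collect_eq)
    \<comment> \<open>The shadow of \<open>A\<close> over \<open>V\<close>. Over each compact
      Hausdorff \<open>D\<close> the relevant part of \<open>A\<close> is closed in a compact box,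
      so its projection is compact; hence \<open>B\<close> meets each \<open>D\<close> in a closed
      set.\<close>
    define B where "B = snd ` (A \<inter> (V \<times> topspace X))"
    have "closedin X B"
    proof (rule CGWH_closedinI[OF X])
      show "B \<subseteq> topspace X" by (auto simp: B_def)
      fix D assume D: "compact_Hausdorff_in X D"
      have Dt: "D \<subseteq> topspace X" using D by (rule compact_Hausdorff_in_subset)
      have cD: "closedin X D" using D X CGWH_imp_weak_Hausdorff weak_Hausdorff_closedin_in by blast
      have "closedin (prod_topology K X) (V \<times> topspace X)"
        using UV(2) by (simp add: closedin_prod_Times_iff)
      then have "closedin (prod_topology K X) ((A \<inter> (topspace K \<times> D)) \<inter> (V \<times> topspace X))"
        using slab[OF D] closedin_Int by blast
      moreover have "compactin (prod_topology K X) (topspace K \<times> D)"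
        using D K by (simp add: compactin_Times compact_Hausdorff_in_def compact_space_def)
      ultimately have "compactin (prod_topology K X) ((A \<inter> (topspace K \<times> D)) \<inter> (V \<times> topspace X))"
        using closed_compactin by (metis (no_types, lifting) inf_assoc inf_le1 inf_left_commute)
      then have "compactin X (snd ` ((A \<inter> (topspace K \<times> D)) \<inter> (V \<times> topspace X)))"
        using image_compactin continuous_map_snd by blast
      moreover have "snd ` ((A \<inter> (topspace K \<times> D)) \<inter> (V \<times> topspace X)) = B \<inter> D"
        using A Dt unfolding B_def by force
      ultimately have "compactin (subtopology X D) (B \<inter> D)" by (simp add: compactin_subtopology)
      then have "closedin (subtopology X D) (B \<inter> D)"
        using D by (simp add: compact_Hausdorff_in_def compactin_imp_closedin)
      then show "closedin X (B \<inter> D)" using cD closedin_trans_full by blast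
    qed
    moreover have "x \<notin> B" using UV(5) by (auto simp: B_def)
    ultimately have "openin (prod_topology K X) (U \<times> (topspace X - B))"
      using UV by (simp add: openin_prod_Times_iff openin_diff)
    moreover have "U \<times> (topspace X - B) \<subseteq> topspace (prod_topology K X) - A"
      using openin_subset[OF UV(1)] UV(4) unfolding B_def by force
    ultimately show "\<exists>T. openin (prod_topology K X) T \<and> z \<in> T \<and> T \<subseteq> topspace (prod_topology K X) - A"
      using kx UV \<open>x \<notin> B\<close> by blast
  qed
  then show "closedin (prod_topology K X) A" using A by (simp add: closedin_def)
qed

lemma CGWH_sum:
  assumes X: "\<And>i. i \<in> I \<Longrightarrow> CGWH_space (X i)"
  shows "CGWH_space (sum_topology X I)"
  unfolding CGWH_space_iff
proof (intro conjI allI impI)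
  show wh: "weak_Hausdorff_space (sum_topology X I)"
    using X by (intro weak_Hausdorff_sum CGWH_imp_weak_Hausdorff)
  fix A assume A: "A \<subseteq> topspace (sum_topology X I)"
    and C: "\<forall>C. compact_Hausdorff_in (sum_topology X I) C \<longrightarrow> closedin (sum_topology X I) (A \<inter> C)"
  have "closedin (X i) {x. (i, x) \<in> A}" if i: "i \<in> I" for i
  proof (rule CGWH_closedinI[OF X[OF i]])
    show "{x. (i, x) \<in> A} \<subseteq> topspace (X i)" using A by auto
    fix D assume D: "compact_Hausdorff_in (X i) D"
    have "compact_Hausdorff_in (sum_topology X I) (Pair i ` D)"
      using compact_Hausdorff_in_image[OF D continuous_map_component_injection[OF i] wh] .
    then have "closedin (sum_topology X I) (A \<inter> Pair i ` D)" using C by blast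
    then have "closedin (X i) {x. (i, x) \<in> A \<inter> Pair i ` D}"
      using i unfolding closedin_sum_topology by blast
    moreover have "{x. (i, x) \<in> A \<inter> Pair i ` D} = {x. (i, x) \<in> A} \<inter> D" by auto
    ultimately show "closedin (X i) ({x. (i, x) \<in> A} \<inter> D)" by simp
  qed
  then show "closedin (sum_topology X I) A" using A by (auto simp: closedin_sum_topology)
qed

lemma CGWH_homeomorphic_map:
  assumes X: "CGWH_space X" and f: "homeomorphic_map X Y f"
  shows "CGWH_space Y"
proof -
  obtain g where g: "homeomorphic_maps X Y f g" using f by (auto simp: homeomorphic_map_maps)
  then have "continuous_map Y X g" "inj_on g (topspace Y)"
    unfolding homeomorphic_maps_def inj_on_def by metis+
  then have "weak_Hausdorff_space Y"
    using weak_Hausdorff_injection CGWH_imp_weak_Hausdorff[OF X] by blast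
  moreover have "quotient_map X Y f" using f by (simp add: homeomorphic_map_def)
  ultimately show ?thesis using CGWH_quotient_map[OF X] by blast
qed

text \<open>The diagonal of a weak Hausdorff space need not be closed in the ordinary product. On a
  compact Hausdorff C the values stay in f(C) and g(C), and inside the Hausdorff product of these
  two subspaces the diagonal is compact, hence closed.\<close>

lemma closedin_equalizer:
  assumes X: "CGWH_space X" and Y: "weak_Hausdorff_space Y"
    and f: "continuous_map X Y f" and g: "continuous_map X Y g"
  shows "closedin X {x \<in> topspace X. f x = g x}"
proof (rule CGWH_closedinI[OF X])
  fix C assume C: "compact_Hausdorff_in X C"
  let ?D = "f ` C" and ?E = "g ` C"
  let ?P = "prod_topology (subtopology Y ?D) (subtopology Y ?E)"
  have D: "compact_Hausdorff_in Y ?D" and E: "compact_Hausdorff_in Y ?E"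
    using compact_Hausdorff_in_image C f g Y by blast+
  have tC: "topspace (subtopology X C) = C" using compact_Hausdorff_in_subtopology(3)[OF C] .
  have "compactin Y (?D \<inter> ?E)"
    using D E Y closed_Int_compactin weak_Hausdorff_closedin_in unfolding compact_Hausdorff_in_def
    by (metis compact_Hausdorff_in_def)
  then have "compactin (subtopology Y (?D \<inter> ?E)) (?D \<inter> ?E)" by (simp add: compactin_subtopology)
  moreover have "continuous_map (subtopology Y (?D \<inter> ?E)) ?P (\<lambda>y. (y, y))"
    by (intro continuous_map_pairedI) (auto simp: continuous_map_in_subtopology continuous_map_from_subtopology)
  ultimately have "compactin ?P ((\<lambda>y. (y, y)) ` (?D \<inter> ?E))" using image_compactin by blast
  moreover have "Hausdorff_space ?P"
    using D E by (simp add: Hausdorff_space_prod_topology compact_Hausdorff_in_def)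
  ultimately have "closedin ?P ((\<lambda>y. (y, y)) ` (?D \<inter> ?E))" using compactin_imp_closedin by blast
  moreover have "continuous_map (subtopology X C) ?P (\<lambda>x. (f x, g x))"
    using f g by (intro continuous_map_pairedI)
      (auto simp: continuous_map_in_subtopology continuous_map_from_subtopology)
  ultimately have "closedin (subtopology X C)
      {x \<in> topspace (subtopology X C). (f x, g x) \<in> (\<lambda>y. (y, y)) ` (?D \<inter> ?E)}"
    using closedin_continuous_map_preimage by blast
  moreover have "{x \<in> topspace (subtopology X C). (f x, g x) \<in> (\<lambda>y. (y, y)) ` (?D \<inter> ?E)}
      = {x \<in> topspace X. f x = g x} \<inter> C"
    unfolding tC using compact_Hausdorff_in_subset[OF C] by auto
  moreover have "closedin X C"
    using C X CGWH_imp_weak_Hausdorff weak_Hausdorff_closedin_in by blast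
  ultimately show "closedin X ({x \<in> topspace X. f x = g x} \<inter> C)"
    using closedin_trans_full by metis
qed auto

subsection \<open>Weak Hausdorff quotients\<close>

lemma equiv_fibres: "equiv S {(x, y) \<in> S \<times> S. f x = f y}"
  by (rule equivI) (auto simp: refl_on_def sym_def trans_def)

text \<open>
  The quotient by the fibre relation of \<open>F\<close> injects into \<open>Z\<close>, so that relation is one of those
  whose intersection is the kernel.
\<close>

lemma cgwh_kernel_lift:
  assumes F: "continuous_map X Z F" and Z: "weak_Hausdorff_space Z"
    and R: "R \<subseteq> topspace X \<times> topspace X" "\<And>x y. (x, y) \<in> R \<Longrightarrow> F x = F y"
    and xy: "(x, y) \<in> cgwh_kernel X R"
  shows "F x = F y"
proof -
  define E where "E = {(x, y) \<in> topspace X \<times> topspace X. F x = F y}"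
  have E: "equiv (topspace X) E" unfolding E_def by (rule equiv_fibres)
  let ?q = "\<lambda>x. E `` {x}"
  let ?Q = "final_topology X ?q"
  define h where "h c = F (SOME x. x \<in> c)" for c
  have h: "h (?q x) = F x" if "x \<in> topspace X" for x
  proof -
    have "x \<in> ?q x" using that by (simp add: E_def)
    then have "(SOME y. y \<in> ?q x) \<in> ?q x" by (rule someI)
    then have "(x, SOME y. y \<in> ?q x) \<in> E" by (rule Image_singleton_iff[THEN iffD1])
    moreover have "F a = F b" if "(a, b) \<in> E" for a b using that by (simp add: E_def)
    ultimately have "F x = F (SOME y. y \<in> ?q x)" by blast
    then show ?thesis by (simp add: h_def)
  qed
  have "continuous_map X Z (h \<circ> ?q)"
    by (rule continuous_map_eq[OF F]) (simp add: h)
  then have "continuous_map ?Q Z h"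
    using quotient_map_final_topology continuous_compose_quotient_map by blast
  moreover have "inj_on h (topspace ?Q)"
  proof (rule inj_onI)
    fix c d assume "c \<in> topspace ?Q" "d \<in> topspace ?Q" "h c = h d"
    then obtain x y where "x \<in> topspace X" "y \<in> topspace X" "c = ?q x" "d = ?q y" "F x = F y"
      using h by auto
    then show "c = d" by (auto simp: E_def)
  qed
  ultimately have "weak_Hausdorff_space ?Q" using weak_Hausdorff_injection Z by blast
  moreover have "R \<subseteq> E" using R by (auto simp: E_def)
  ultimately have "(x, y) \<in> E" using xy E unfolding cgwh_kernel_def by blast
  then show ?thesis by (simp add: E_def)
qed

context
  fixes X :: "'a topology" and R :: "('a \<times> 'a) set"
  assumes R: "R \<subseteq> topspace X \<times> topspace X"
begin

definition wh_relations :: "('a \<times> 'a) set set" where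
  "wh_relations = {E. equiv (topspace X) E \<and> R \<subseteq> E
     \<and> weak_Hausdorff_space (final_topology X (\<lambda>x. E `` {x}))}"

lemma cgwh_kernel_eq: "cgwh_kernel X R = \<Inter>wh_relations"
  by (simp add: cgwh_kernel_def wh_relations_def)

text \<open>The family must be nonempty for its intersection to be a relation on the space. The
  total relation belongs to it, as its quotient has at most one point.\<close>

lemma top_wh_relation: "topspace X \<times> topspace X \<in> wh_relations"
proof -
  let ?Q = "final_topology X (\<lambda>x. (topspace X \<times> topspace X) `` {x})"
  have "topspace ?Q \<subseteq> {topspace X}" by auto
  then have "Hausdorff_space ?Q" 
    unfolding Hausdorff_space_def by (metis (no_types) singletonD subsetD)
  then have "weak_Hausdorff_space ?Q" by (rule Hausdorff_imp_weak_Hausdorff)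
  moreover have "equiv (topspace X) (topspace X \<times> topspace X)"
    by (rule equivI) (auto simp: refl_on_def sym_def trans_def)
  ultimately show ?thesis by (simp only: wh_relations_def mem_Collect_eq R simp_thms)
qed

lemma equiv_cgwh_kernel: "equiv (topspace X) (cgwh_kernel X R)"
proof (rule equivI)
  have E: "equiv (topspace X) E" if "E \<in> wh_relations" for E
    using that by (simp add: wh_relations_def)
  show "cgwh_kernel X R \<subseteq> topspace X \<times> topspace X"
    unfolding cgwh_kernel_eq using top_wh_relation by blast
  show "refl_on (topspace X) (cgwh_kernel X R)"
    unfolding cgwh_kernel_eq refl_on_def
    using E equiv_class_self by fastforce
  show "sym (cgwh_kernel X R)"
    unfolding cgwh_kernel_eq sym_def using E by (meson InterE InterI equivE symD)
  show "trans (cgwh_kernel X R)"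
    unfolding cgwh_kernel_eq trans_def using E by (meson InterE InterI equivE transD)
qed

lemma cgwh_class_eq_iff:
  "x \<in> topspace X \<Longrightarrow> y \<in> topspace X \<Longrightarrow> cgwh_class X R x = cgwh_class X R y \<longleftrightarrow> (x, y) \<in> cgwh_kernel X R"
  unfolding cgwh_class_def using equiv_cgwh_kernel by (simp add: eq_equiv_class_iff)

lemma cgwh_class_rel: "(x, y) \<in> R \<Longrightarrow> cgwh_class X R x = cgwh_class X R y"
  using R by (subst cgwh_class_eq_iff) (auto simp: cgwh_kernel_eq wh_relations_def)

lemma cgwh_class_self: "x \<in> topspace X \<Longrightarrow> x \<in> cgwh_class X R x"
  unfolding cgwh_class_def using equiv_cgwh_kernel equiv_class_self by metis

lemma mem_cgwh_class:
  assumes "y \<in> cgwh_class X R x"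
  shows "x \<in> topspace X" "y \<in> topspace X" "cgwh_class X R y = cgwh_class X R x"
proof -
  have "(x, y) \<in> cgwh_kernel X R" using assms by (simp add: cgwh_class_def)
  then show "x \<in> topspace X" "y \<in> topspace X" "cgwh_class X R y = cgwh_class X R x"
    using equiv_cgwh_kernel cgwh_class_eq_iff by (auto simp: equiv_def refl_on_def)
qed

lemma topspace_cgwh_quotient: "topspace (cgwh_quotient X R) = cgwh_class X R ` topspace X"
  by (simp add: cgwh_quotient_def)

lemma quotient_map_cgwh_class: "quotient_map X (cgwh_quotient X R) (cgwh_class X R)"
  unfolding cgwh_quotient_def by (rule quotient_map_final_topology)

lemma continuous_map_cgwh_class: "continuous_map X (cgwh_quotient X R) (cgwh_class X R)"
  using quotient_map_cgwh_class by (rule quotient_imp_continuous_map)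

text \<open>The quotient maps to the product of all competing weak Hausdorff quotients. This map is
  injective because the kernel is the intersection of the competing relations.\<close>

lemma weak_Hausdorff_cgwh_quotient: "weak_Hausdorff_space (cgwh_quotient X R)"
proof -
  let ?Q = "\<lambda>E. final_topology X (\<lambda>x. E `` {x})"
  let ?P = "product_topology ?Q wh_relations"
  define h where "h c = (\<lambda>E\<in>wh_relations. E `` c)" for c
  have h: "E `` cgwh_class X R x = E `` {x}" if "E \<in> wh_relations" "x \<in> topspace X" for E x
  proof -
    have E: "equiv (topspace X) E" "cgwh_kernel X R \<subseteq> E"
      using that by (auto simp: wh_relations_def cgwh_kernel_eq)
    then show ?thesis
      using cgwh_class_self[OF that(2)] unfolding cgwh_class_def
      by (auto simp: equiv_def dest: transD)
  qed
  have "continuous_map (cgwh_quotient X R) ?P h"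
    unfolding continuous_map_componentwise
  proof (intro conjI ballI)
    show "h ` topspace (cgwh_quotient X R) \<subseteq> extensional wh_relations"
      by (auto simp: h_def)
    fix E assume E: "E \<in> wh_relations"
    have "continuous_map X (?Q E) (\<lambda>x. E `` {x})"
      by (simp add: quotient_imp_continuous_map quotient_map_final_topology)
    then have "continuous_map X (?Q E) ((\<lambda>c. h c E) \<circ> cgwh_class X R)"
      by (rule continuous_map_eq) (simp add: h_def E h)
    then show "continuous_map (cgwh_quotient X R) (?Q E) (\<lambda>c. h c E)"
      using continuous_compose_quotient_map quotient_map_cgwh_class by blast
  qed
  moreover have "inj_on h (topspace (cgwh_quotient X R))"
  proof (rule inj_onI, unfold topspace_cgwh_quotient, elim imageE, simp)
    fix x y assume xy: "x \<in> topspace X" "y \<in> topspace X"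
      and eq: "h (cgwh_class X R x) = h (cgwh_class X R y)"
    have "(x, y) \<in> E" if E: "E \<in> wh_relations" for E
    proof -
      have "E `` {x} = E `` {y}"
        using fun_cong[OF eq, of E] xy E by (simp add: h_def h)
      then show ?thesis using E xy eq_equiv_class_iff[of "topspace X" E x y] by (simp add: wh_relations_def)
    qed
    then show "cgwh_class X R x = cgwh_class X R y"
      using xy by (simp add: cgwh_class_eq_iff cgwh_kernel_eq)
  qed
  moreover have "weak_Hausdorff_space ?P"
    by (rule weak_Hausdorff_product) (simp add: wh_relations_def)
  ultimately show ?thesis using weak_Hausdorff_injection by blast
qed

lemma CGWH_cgwh_quotient: "CGWH_space X \<Longrightarrow> CGWH_space (cgwh_quotient X R)"
  using CGWH_quotient_map quotient_map_cgwh_class weak_Hausdorff_cgwh_quotient by blast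

lemma the_elem_cgwh_class:
  assumes "\<And>y. y \<in> cgwh_class X R x \<Longrightarrow> F y = F x" "x \<in> topspace X"
  shows "the_elem (F ` cgwh_class X R x) = F x"
proof -
  have "F ` cgwh_class X R x = {F x}" using assms(1) cgwh_class_self[OF assms(2)] by blast
  then show ?thesis by simp
qed

text \<open>The universal property: F has to respect the generators only, and continuity into a weak
  Hausdorff target extends this to the whole kernel.\<close>

lemma cgwh_quotient_lift_unique:
  assumes "continuous_map X Z F" "weak_Hausdorff_space Z" "\<And>x y. (x, y) \<in> R \<Longrightarrow> F x = F y"
    and y: "y \<in> cgwh_class X R x"
  shows "F y = F x"
  using cgwh_kernel_lift[OF assms(1,2) R assms(3), of x y] y by (auto simp: cgwh_class_def)

lemma cgwh_quotient_lift:
  assumes "continuous_map X Z F" "weak_Hausdorff_space Z" "\<And>x y. (x, y) \<in> R \<Longrightarrow> F x = F y"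
    and "x \<in> topspace X"
  shows "the_elem (F ` cgwh_class X R x) = F x"
  by (rule the_elem_cgwh_class[OF cgwh_quotient_lift_unique[OF assms(1-3)] assms(4)])

lemma continuous_map_from_cgwh_quotient:
  assumes "continuous_map X Z F" "\<And>x. x \<in> topspace X \<Longrightarrow> f (cgwh_class X R x) = F x"
  shows "continuous_map (cgwh_quotient X R) Z f"
proof -
  have "continuous_map X Z (f \<circ> cgwh_class X R)"
    by (rule continuous_map_eq[OF assms(1)]) (simp add: assms(2))
  then show ?thesis using continuous_compose_quotient_map quotient_map_cgwh_class by blast
qed

text \<open>The product of a quotient map with the identity of a locally compact Hausdorff space is
  a quotient map. This gives joint continuity of structure maps (K a morphism space) and of actions
  (K the group).\<close>

lemma continuous_map_from_prod_cgwh_quotient: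
  assumes K: "compact_space K" "Hausdorff_space K"
    and "continuous_map (prod_topology K X) Z (\<lambda>(k, x). F k x)"
    and "\<And>k x. k \<in> topspace K \<Longrightarrow> x \<in> topspace X \<Longrightarrow> f k (cgwh_class X R x) = F k x"
  shows "continuous_map (prod_topology K (cgwh_quotient X R)) Z (\<lambda>(k, c). f k c)"
proof -
  have "quotient_map (prod_topology K X) (prod_topology K (cgwh_quotient X R))
      (\<lambda>(k, x). (k, cgwh_class X R x))"
    using quotient_map_prod_right[OF compact_imp_locally_compact_space[OF K(1)] _ quotient_map_cgwh_class]
      K(2) by simp
  moreover have "continuous_map (prod_topology K X) Z
      ((\<lambda>(k, c). f k c) \<circ> (\<lambda>(k, x). (k, cgwh_class X R x)))"
    by (rule continuous_map_eq[OF assms(3)]) (auto simp: assms(4))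
  ultimately show ?thesis using continuous_compose_quotient_map by blast
qed

end

section \<open>Maps out of disjoint sums\<close>

lemma continuous_map_from_sum:
  assumes "\<And>i. i \<in> I \<Longrightarrow> continuous_map (X i) Z (\<lambda>x. F (i, x))"
  shows "continuous_map (sum_topology X I) Z F"
  unfolding continuous_map_def
proof (intro conjI allI impI)
  show "F \<in> topspace (sum_topology X I) \<rightarrow> topspace Z"
    using assms[THEN continuous_map_funspace] by (auto simp: Pi_iff)
  fix U assume U: "openin Z U"
  have "openin (X i) {x \<in> topspace (X i). F (i, x) \<in> U}" if "i \<in> I" for i
    using assms[OF that] U by (auto simp: continuous_map_def)
  then have "openin (sum_topology X I) (Sigma I (\<lambda>i. {x \<in> topspace (X i). F (i, x) \<in> U}))"
    by (simp add: openin_disjoint_union)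
  then show "openin (sum_topology X I) {x \<in> topspace (sum_topology X I). F x \<in> U}"
    by (rule back_subst[of "openin (sum_topology X I)"]) auto
qed

lemma continuous_map_from_prod_sum:
  assumes "\<And>i. i \<in> I \<Longrightarrow> continuous_map (prod_topology K (X i)) Z (\<lambda>(k, x). F k (i, x))"
  shows "continuous_map (prod_topology K (sum_topology X I)) Z (\<lambda>(k, z). F k z)"
  unfolding continuous_map_def
proof (intro conjI allI impI)
  show "(\<lambda>(k, z). F k z) \<in> topspace (prod_topology K (sum_topology X I)) \<rightarrow> topspace Z"
    using assms[THEN continuous_map_funspace] by (auto simp: Pi_iff)
  fix U assume U: "openin Z U"
  let ?W = "{z \<in> topspace (prod_topology K (sum_topology X I)). (\<lambda>(k, z). F k z) z \<in> U}"
  show "openin (prod_topology K (sum_topology X I)) ?W"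
    unfolding openin_prod_topology_alt
  proof (intro allI impI)
    fix k z assume kz: "(k, z) \<in> ?W"
    obtain i x where z: "z = (i, x)" by fastforce
    with kz have i: "i \<in> I" "x \<in> topspace (X i)" "k \<in> topspace K" "F k (i, x) \<in> U" by auto
    let ?V = "{z \<in> topspace (prod_topology K (X i)). (\<lambda>(k, x). F k (i, x)) z \<in> U}"
    have "(k, x) \<in> ?V" using i by simp
    moreover have "openin (prod_topology K (X i)) ?V"
      using assms[OF i(1)] U by (simp add: continuous_map_def)
    ultimately obtain S B where SB: "openin K S" "openin (X i) B" "k \<in> S" "x \<in> B" "S \<times> B \<subseteq> ?V"
      unfolding openin_prod_topology_alt by meson
    have "openin (sum_topology X I) (Pair i ` B)"
      using open_map_component_injection[OF i(1), of X] SB(2) by (simp add: open_map_def)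
    moreover have "S \<times> Pair i ` B \<subseteq> ?W" using SB(5) i(1) by auto
    ultimately show "\<exists>U V. openin K U \<and> openin (sum_topology X I) V \<and> k \<in> U \<and> z \<in> V \<and> U \<times> V \<subseteq> ?W"
      using SB z by blast
  qed
qed

section \<open>Finite dimensional spaces of sequences\<close>

lemma span_insert_cong: "span A = span B \<Longrightarrow> span (insert x A) = span (insert x B)"
  by (simp add: span_insert)

section \<open>Orthonormal sets and orthogonal projections\<close>

definition orthonormal :: "'a::real_inner set \<Rightarrow> bool" where
  "orthonormal C \<longleftrightarrow> pairwise orthogonal C \<and> (\<forall>c\<in>C. norm c = 1)"

lemma orthonormal_inner:
  "orthonormal C \<Longrightarrow> c \<in> C \<Longrightarrow> d \<in> C \<Longrightarrow> inner c d = (if c = d then 1 else 0)"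
  by (auto simp: orthonormal_def pairwise_def orthogonal_def dot_square_norm)

lemma orthonormal_independent:
  fixes C :: "'a::real_inner set"
  assumes "orthonormal C"
  shows "independent C"
proof
  assume "dependent C"
  then obtain T u where T: "finite T" "T \<subseteq> C" "(\<Sum>v\<in>T. u v *\<^sub>R v) = 0" "\<exists>v\<in>T. u v \<noteq> 0"
    unfolding dependent_explicit by blast
  then obtain w where w: "w \<in> T" "u w \<noteq> 0" by blast
  have "0 = inner (\<Sum>v\<in>T. u v *\<^sub>R v) w" using T by simp
  also have "\<dots> = (\<Sum>v\<in>T. if v = w then u w else 0)"
    unfolding inner_sum_left using T(2) w(1) orthonormal_inner[OF assms]
    by (intro sum.cong) (auto simp: subset_iff)
  also have "\<dots> = u w" using T w by simp
  finally show False using w by simp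
qed

definition projection :: "'a::real_inner set \<Rightarrow> 'a \<Rightarrow> 'a" where
  "projection C v = (\<Sum>c\<in>C. inner v c *\<^sub>R c)"

lemma projection_in_span: "projection C v \<in> span C"
  unfolding projection_def by (intro span_sum span_scale span_base)

lemma projection_orthogonal:
  assumes C: "finite C" "orthonormal C" and u: "u \<in> span C"
  shows "inner u (v - projection C v) = 0"
proof -
  have c: "inner c (v - projection C v) = 0" if "c \<in> C" for c
  proof -
    have "inner c (projection C v) = (\<Sum>d\<in>C. if d = c then inner v c else 0)"
      unfolding projection_def inner_sum_right using that orthonormal_inner[OF C(2)]
      by (intro sum.cong) auto
    also have "\<dots> = inner c v" using that C(1) by (simp add: inner_commute)
    finally show ?thesis by (simp add: inner_diff_right)
  qed
  have "subspace {u. inner u (v - projection C v) = 0}"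
    by (auto simp: subspace_def inner_add_left)
  then show ?thesis using span_minimal[of C "{u. inner u (v - projection C v) = 0}"] c u by auto
qed

lemma projection_ident:
  assumes C: "finite C" "orthonormal C" and v: "v \<in> span C"
  shows "projection C v = v"
proof -
  have "v - projection C v \<in> span C" using v projection_in_span span_diff by blast
  from projection_orthogonal[OF C this, of v] show ?thesis by simp
qed

text \<open>Gram-Schmidt: the residual of the new vector is orthogonal to the span so far. If it
  vanishes nothing is added, otherwise it is normalized.\<close>

lemma orthonormal_basis_exists:
  fixes B :: "'a::real_inner set"
  assumes "finite B"
  shows "\<exists>C. finite C \<and> orthonormal C \<and> span C = span B"
  using assms
proof induction
  case empty
  show ?case by (rule exI[of _ "{}"]) (simp add: orthonormal_def)
next
  case (insert a B)
  then obtain C where C: "finite C" "orthonormal C" "span C = span B" by blast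
  define a' where "a' = a - projection C a"
  have aB: "span (insert a B) = span (insert a C)" using C(3) span_insert_cong by metis
  show ?case
  proof (cases "a' = 0")
    case True
    then have "a \<in> span C" using projection_in_span[of C a] by (simp add: a'_def)
    then show ?thesis using C aB span_redundant by metis
  next
    case False
    let ?c = "a' /\<^sub>R norm a'"
    have orth: "inner u a' = 0" if "u \<in> span C" for u
      using projection_orthogonal[OF C(1,2) that] by (simp add: a'_def)
    have "orthonormal (insert ?c C)"
      using C(2) False orth[OF span_base]
      unfolding orthonormal_def pairwise_insert
      by (auto simp: orthogonal_def inner_commute)
    moreover have "span (insert ?c C) = span (insert a C)"
    proof (rule span_eq[THEN iffD2], intro conjI insert_subsetI)
      have p: "projection C a \<in> span (insert x C)" for x
        using projection_in_span span_mono[of C "insert x C"] by blast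
      have "a' \<in> span (insert a C)" unfolding a'_def by (intro span_diff span_base p) simp
      then show "?c \<in> span (insert a C)" by (rule span_scale)
      have "norm a' *\<^sub>R ?c + projection C a \<in> span (insert ?c C)"
        by (intro span_add span_scale span_base p) simp
      then show "a \<in> span (insert ?c C)" using False by (simp add: a'_def)
    qed (auto intro: span_base)
    ultimately show ?thesis using C(1) aB by (intro exI[of _ "insert ?c C"]) simp
  qed
qed

section \<open>Finite dimensional subspaces and coordinate spaces\<close>

lemma fd_subspace_imp_subspace: "fd_subspace V \<Longrightarrow> subspace V"
  by (simp add: fd_subspace_def)

lemma fd_subspace_span: "finite B \<Longrightarrow> fd_subspace (span B)"
  by (auto simp: fd_subspace_def)

lemma fd_subspace_orthonormal:
  assumes "fd_subspace V"
  obtains C where "finite C" "orthonormal C" "V = span C" "card C = dim V"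
proof -
  from assms obtain B where "finite B" "V = span B" by (auto simp: fd_subspace_def)
  with orthonormal_basis_exists[of B] obtain C where C: "finite C" "orthonormal C" "V = span C" by auto
  then have "card C = dim V"
    using dim_span_eq_card_independent[of C] orthonormal_independent[of C] by simp
  with C show ?thesis using that by blast
qed

lemma fd_subspace_subset:
  assumes "subspace U" "U \<subseteq> V" "fd_subspace V"
  shows "fd_subspace U"
proof -
  obtain B where B: "B \<subseteq> U" "independent B" "U \<subseteq> span B" by (rule maximal_independent_subset)
  obtain C where C: "finite C" "V = span C" using assms by (auto simp: fd_subspace_def)
  have "finite B" using independent_span_bound[OF C(1) B(2)] B(1) assms(2) C(2) by auto
  moreover have "U = span B" using B assms(1) span_minimal by blast
  ultimately show ?thesis using fd_subspace_span by blast
qed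

lemma subspace_Rn: "subspace (Rn n)"
  by (auto simp: subspace_def Rn_def coord_zero coord_plus coord_scaleR)

definition unit_vec :: "nat \<Rightarrow> rseq" where
  "unit_vec i = Abs_rseq (\<lambda>j. if j = i then 1 else 0)"

lemma coord_unit_vec: "coord (unit_vec i) j = (if j = i then 1 else 0)"
  by (simp add: unit_vec_def coord_Abs)

lemma coord_sum: "coord (sum f A) i = (\<Sum>x\<in>A. coord (f x) i)"
  by (induction A rule: infinite_finite_induct) (auto simp: coord_zero coord_plus)

lemma Rn_expand:
  assumes "x \<in> Rn n"
  shows "x = (\<Sum>i<n. coord x i *\<^sub>R unit_vec i)"
proof -
  have "coord x j = (\<Sum>i<n. if j = i then coord x i else 0)" for j
    using assms by (auto simp: Rn_def)
  then show ?thesis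
    by (auto simp: coord_inject_ext coord_sum coord_scaleR coord_unit_vec if_distrib cong: if_cong)
qed

lemma unit_vec_Rn: "i < n \<Longrightarrow> unit_vec i \<in> Rn n"
  by (auto simp: Rn_def coord_unit_vec)

lemma fd_subspace_Rn: "fd_subspace (Rn n)"
proof -
  have "Rn n = span (unit_vec ` {..<n})"
  proof
    show "Rn n \<subseteq> span (unit_vec ` {..<n})"
    proof
      fix x assume "x \<in> Rn n"
      then have "x = (\<Sum>i<n. coord x i *\<^sub>R unit_vec i)" by (rule Rn_expand)
      also have "\<dots> \<in> span (unit_vec ` {..<n})"
        by (intro span_sum span_scale span_base) auto
      finally show "x \<in> span (unit_vec ` {..<n})" .
    qed
    show "span (unit_vec ` {..<n}) \<subseteq> Rn n"
      by (rule span_minimal) (auto simp: unit_vec_Rn subspace_Rn)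
  qed
  then show ?thesis using fd_subspace_span[of "unit_vec ` {..<n}"] by simp
qed

lemma inner_Rn:
  assumes "x \<in> Rn n"
  shows "inner x y = (\<Sum>i<n. coord x i * coord y i)"
proof -
  have "{i. coord x i \<noteq> 0} \<subseteq> {..<n}" using assms by (auto simp: Rn_def simp flip: not_le)
  then show ?thesis by (simp add: inner_rseq_superset)
qed

subsection \<open>Isometric embeddings\<close>

lemma isomsD:
  assumes "f \<in> isoms V W"
  shows "x \<in> V \<Longrightarrow> f x \<in> W" "x \<in> V \<Longrightarrow> y \<in> V \<Longrightarrow> f (x + y) = f x + f y"
    "x \<in> V \<Longrightarrow> f (c *\<^sub>R x) = c *\<^sub>R f x" "x \<in> V \<Longrightarrow> y \<in> V \<Longrightarrow> inner (f x) (f y) = inner x y"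
    "f \<in> extensional V"
  using assms by (auto simp: isoms_def PiE_iff)

lemma isomsI:
  assumes "\<And>x. x \<in> V \<Longrightarrow> f x \<in> W" "f \<in> extensional V"
    "\<And>x y. x \<in> V \<Longrightarrow> y \<in> V \<Longrightarrow> f (x + y) = f x + f y"
    "\<And>c x. x \<in> V \<Longrightarrow> f (c *\<^sub>R x) = c *\<^sub>R f x"
    "\<And>x y. x \<in> V \<Longrightarrow> y \<in> V \<Longrightarrow> inner (f x) (f y) = inner x y"
  shows "f \<in> isoms V W"
  using assms by (auto simp: isoms_def PiE_iff)

lemma isoms_norm: "f \<in> isoms V W \<Longrightarrow> x \<in> V \<Longrightarrow> norm (f x) = norm x"
  by (simp add: norm_eq_sqrt_inner isomsD)

lemma isoms_zero: "f \<in> isoms V W \<Longrightarrow> subspace V \<Longrightarrow> f 0 = 0"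
  using isomsD(3)[of f V W 0 0] subspace_0 by fastforce

lemma isoms_diff:
  assumes "f \<in> isoms V W" "subspace V" "x \<in> V" "y \<in> V"
  shows "f (x - y) = f x - f y"
  using isomsD(2)[OF assms(1), of "x - y" y] assms by (simp add: subspace_diff)

lemma isoms_dist:
  assumes "f \<in> isoms V W" "subspace V" "x \<in> V" "y \<in> V"
  shows "dist (f x) (f y) = dist x y"
  using isoms_norm[OF assms(1) subspace_diff[OF assms(2-4)]] isoms_diff[OF assms] by (simp add: dist_norm)

lemma isoms_inj: "f \<in> isoms V W \<Longrightarrow> subspace V \<Longrightarrow> inj_on f V"
  by (rule inj_onI) (metis dist_eq_0_iff isoms_dist)

lemma isoms_compose: "f \<in> isoms W U \<Longrightarrow> g \<in> isoms V W \<Longrightarrow> subspace V \<Longrightarrow> compose V f g \<in> isoms V U"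
  by (rule isomsI) (simp_all add: compose_eq isomsD subspace_add subspace_scale)

lemma isoms_id: "V \<subseteq> W \<Longrightarrow> subspace V \<Longrightarrow> (\<lambda>x\<in>V. x) \<in> isoms V W"
  by (rule isomsI) (auto simp: subspace_add subspace_scale)

lemma isoms_restrict:
  "f \<in> isoms V W \<Longrightarrow> U \<subseteq> V \<Longrightarrow> subspace U \<Longrightarrow> f ` U \<subseteq> W' \<Longrightarrow> restrict f U \<in> isoms U W'"
  by (rule isomsI) (auto simp: subspace_add subspace_scale isomsD subset_iff)

lemma isoms_ext: "f \<in> isoms V W \<Longrightarrow> g \<in> isoms V W' \<Longrightarrow> (\<And>x. x \<in> V \<Longrightarrow> f x = g x) \<Longrightarrow> f = g"
  by (metis extensionalityI isomsD(5))

lemma isoms_inv: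
  assumes b: "b \<in> isoms V W" "b ` V = W" and V: "subspace V"
  shows "restrict (inv_into V b) W \<in> isoms W V"
proof -
  have inv: "b x \<in> W \<and> inv_into V b (b x) = x" if "x \<in> V" for x
    using that inv_into_f_f[OF isoms_inj[OF b(1) V]] b(2) by blast
  have W: "\<exists>x\<in>V. y = b x" if "y \<in> W" for y using that b(2) by blast
  have add: "b x + b y = b (x + y)" and sc: "c *\<^sub>R b x = b (c *\<^sub>R x)" if "x \<in> V" "y \<in> V" for x y c
    using isomsD[OF b(1)] that by auto
  show ?thesis
  proof (rule isomsI)
    fix y z c assume "y \<in> W" "z \<in> W"
    then obtain u v where uv: "u \<in> V" "v \<in> V" "y = b u" "z = b v" using W by blast
    then have "y + z = b (u + v)" "c *\<^sub>R y = b (c *\<^sub>R u)" "u + v \<in> V" "c *\<^sub>R u \<in> V"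
      using add sc V by (auto simp: subspace_add subspace_scale)
    then show "restrict (inv_into V b) W y \<in> V"
      "restrict (inv_into V b) W (y + z) = restrict (inv_into V b) W y + restrict (inv_into V b) W z"
      "restrict (inv_into V b) W (c *\<^sub>R y) = c *\<^sub>R restrict (inv_into V b) W y"
      "inner (restrict (inv_into V b) W y) (restrict (inv_into V b) W z) = inner y z"
      using uv inv isomsD(4)[OF b(1)] by auto
  qed auto
qed

lemma subspace_isoms_image:
  assumes "f \<in> isoms V W" "subspace V"
  shows "subspace (f ` V)"
proof (rule subspaceI)
  show "0 \<in> f ` V" using isoms_zero[OF assms] subspace_0[OF assms(2)] by force
  fix y z c assume "y \<in> f ` V" "z \<in> f ` V"
  then obtain u v where "u \<in> V" "v \<in> V" "y = f u" "z = f v" by blast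
  then have "y + z = f (u + v)" "c *\<^sub>R y = f (c *\<^sub>R u)" "u + v \<in> V" "c *\<^sub>R u \<in> V"
    using isomsD(2,3)[OF assms(1)] assms(2) by (auto simp: subspace_add subspace_scale)
  then show "y + z \<in> f ` V" "c *\<^sub>R y \<in> f ` V" by auto
qed

text \<open>The image of an orthonormal basis is orthonormal. A vector outside its span would give
  one independent vector more than the dimension allows.\<close>

lemma isoms_self_surj:
  assumes V: "fd_subspace V" and f: "f \<in> isoms V V"
  shows "f ` V = V"
proof -
  have sV: "subspace V" using V by (rule fd_subspace_imp_subspace)
  obtain C where C: "finite C" "orthonormal C" "V = span C" using fd_subspace_orthonormal[OF V] by blast
  have CV: "C \<subseteq> V" using C(3) span_superset by blast
  have inj: "inj_on f C" using isoms_inj[OF f sV] CV inj_on_subset by blast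
  have on: "orthonormal (f ` C)"
    unfolding orthonormal_def pairwise_def orthogonal_def
  proof (intro conjI ballI impI)
    fix c assume "c \<in> f ` C"
    then show "norm c = 1" using isoms_norm[OF f] CV C(2) by (auto simp: orthonormal_def subset_iff)
    fix d assume d: "d \<in> f ` C" "c \<noteq> d"
    then obtain x y where "x \<in> C" "y \<in> C" "c = f x" "d = f y" "x \<noteq> y" using \<open>c \<in> f ` C\<close> by blast
    then show "inner c d = 0" using orthonormal_inner[OF C(2)] isomsD(4)[OF f] CV by (simp add: subset_iff)
  qed
  have fV: "f ` V \<subseteq> V" using isomsD(1)[OF f] by blast
  have "V \<subseteq> span (f ` C)"
  proof (rule ccontr)
    assume "\<not> V \<subseteq> span (f ` C)"
    then obtain v where v: "v \<in> V" "v \<notin> span (f ` C)" by blast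
    then have "independent (insert v (f ` C))"
      using orthonormal_independent[OF on] independent_insertI by blast
    moreover have "insert v (f ` C) \<subseteq> span C" using v(1) fV CV C(3) by blast
    ultimately have "card (insert v (f ` C)) \<le> card C"
      using independent_span_bound[OF C(1)] by simp
    moreover have "v \<notin> f ` C" using v(2) span_base[of v "f ` C"] by blast
    ultimately show False using C(1) card_image[OF inj] by simp
  qed
  moreover have "span (f ` C) \<subseteq> f ` V"
    using subspace_isoms_image[OF f sV] CV by (intro span_minimal) auto
  ultimately show ?thesis using fV by blast
qed

lemma isoms_Rn_dim_exists:
  assumes V: "fd_subspace V"
  obtains b where "b \<in> isoms (Rn (dim V)) V" "b ` Rn (dim V) = V"
proof -
  obtain C where C: "finite C" "orthonormal C" "V = span C" "card C = dim V"
    by (rule fd_subspace_orthonormal[OF V])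
  let ?n = "dim V"
  obtain h where "bij_betw h {0..<?n} C" using ex_bij_betw_nat_finite[OF C(1)] C(4) by auto
  then have h: "bij_betw h {..<?n} C" by (simp add: atLeast0LessThan)
  have hC: "h i \<in> C" if "i < ?n" for i using h that by (auto simp: bij_betw_def)
  have hh: "inner (h i) (h j) = (if i = j then 1 else 0)" if "i < ?n" "j < ?n" for i j
    using orthonormal_inner[OF C(2)] hC that h by (auto simp: bij_betw_def inj_on_def)
  \<comment> \<open>The isometry that carries the i-th unit vector to the i-th vector of an
    enumerated orthonormal basis.\<close>
  define b where "b = (\<lambda>x\<in>Rn ?n. \<Sum>i<?n. coord x i *\<^sub>R h i)"
  have "b \<in> isoms (Rn ?n) V"
  proof (rule isomsI)
    fix x y c assume x: "x \<in> Rn ?n" and y: "y \<in> Rn ?n"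
    have "(\<Sum>i<?n. coord x i *\<^sub>R h i) \<in> span C"
      using hC by (intro span_sum span_scale span_base) auto
    then show "b x \<in> V" using x C(3) by (simp add: b_def)
    show "b (x + y) = b x + b y" "b (c *\<^sub>R x) = c *\<^sub>R b x"
      using x y by (simp_all add: b_def subspace_Rn subspace_add subspace_scale coord_plus coord_scaleR
          algebra_simps sum.distrib scaleR_sum_right)
    have "inner (b x) (b y) = (\<Sum>i<?n. coord y i * (\<Sum>j<?n. coord x j * inner (h j) (h i)))"
      using x y by (simp add: b_def inner_sum_left inner_sum_right)
    also have "\<dots> = (\<Sum>i<?n. coord y i * (\<Sum>j<?n. if j = i then coord x j else 0))"
      by (intro sum.cong arg_cong2[of _ _ _ _ "(*)"]) (auto simp: hh)
    also have "\<dots> = inner x y" using x by (simp add: inner_Rn mult.commute)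
    finally show "inner (b x) (b y) = inner x y" .
  qed (simp add: b_def)
  moreover have "V \<subseteq> b ` Rn ?n"
  proof
    fix v assume "v \<in> V"
    then have v: "v = (\<Sum>c\<in>C. inner v c *\<^sub>R c)"
      using projection_ident[OF C(1,2)] C(3) by (simp add: projection_def)
    define x where "x = (\<Sum>i<?n. inner v (h i) *\<^sub>R unit_vec i)"
    have "x \<in> Rn ?n" unfolding x_def
      by (intro subspace_sum subspace_scale subspace_Rn unit_vec_Rn) auto
    moreover have "coord x i = inner v (h i)" if "i < ?n" for i
      using that by (simp add: x_def coord_sum coord_scaleR coord_unit_vec if_distrib cong: if_cong)
    ultimately have "b x = (\<Sum>i<?n. inner v (h i) *\<^sub>R h i)" by (simp add: b_def)
    also have "\<dots> = v" using v sum.reindex_bij_betw[OF h, of "\<lambda>c. inner v c *\<^sub>R c"] by simp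
    finally show "v \<in> b ` Rn ?n" using \<open>x \<in> Rn ?n\<close> by blast
  qed
  ultimately show ?thesis using that isomsD(1) by blast
qed

text \<open>Composing f with the inverse of one known bijective frame gives an isometric self-map of
  V. Thus every frame is invertible.\<close>

lemma isoms_Rn_dim_surj:
  assumes V: "fd_subspace V" and f: "f \<in> isoms (Rn (dim V)) V"
  shows "f ` Rn (dim V) = V"
proof -
  obtain b where b: "b \<in> isoms (Rn (dim V)) V" "b ` Rn (dim V) = V" by (rule isoms_Rn_dim_exists[OF V])
  let ?c = "restrict (inv_into (Rn (dim V)) b) V"
  have c: "?c \<in> isoms V (Rn (dim V))" using isoms_inv[OF b subspace_Rn] .
  have cV: "?c ` V = Rn (dim V)"
    using b inv_into_image_cancel[OF isoms_inj[OF b(1) subspace_Rn], of "Rn (dim V)"] by simp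
  have "compose V f ?c ` V = V"
    by (rule isoms_self_surj[OF V isoms_compose[OF f c fd_subspace_imp_subspace[OF V]]])
  then show ?thesis using cV by (metis (no_types, lifting) image_comp image_cong compose_eq o_apply)
qed

definition isom_inv :: "nat \<Rightarrow> rseq set \<Rightarrow> (rseq \<Rightarrow> rseq) \<Rightarrow> rseq \<Rightarrow> rseq" where
  "isom_inv n V b = restrict (inv_into (Rn n) b) V"

lemma isom_inv:
  assumes V: "fd_subspace V" and b: "b \<in> isoms (Rn (dim V)) V"
  shows "isom_inv (dim V) V b \<in> isoms V (Rn (dim V))"
    "x \<in> Rn (dim V) \<Longrightarrow> isom_inv (dim V) V b (b x) = x"
    "y \<in> V \<Longrightarrow> b (isom_inv (dim V) V b y) = y"
proof -
  have s: "b ` Rn (dim V) = V" by (rule isoms_Rn_dim_surj[OF assms])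
  show "isom_inv (dim V) V b \<in> isoms V (Rn (dim V))"
    unfolding isom_inv_def by (rule isoms_inv[OF b s subspace_Rn])
  show "x \<in> Rn (dim V) \<Longrightarrow> isom_inv (dim V) V b (b x) = x"
    using isomsD(1)[OF b] inv_into_f_f[OF isoms_inj[OF b subspace_Rn]] by (simp add: isom_inv_def)
  show "y \<in> V \<Longrightarrow> b (isom_inv (dim V) V b y) = y"
    using f_inv_into_f[of y b "Rn (dim V)"] s by (simp add: isom_inv_def)
qed

text \<open>In orthonormal coordinates the ball lies in the continuous image of a cube, by
  Cauchy-Schwarz. It is therefore the intersection of a compact set with a closed ball.\<close>

lemma compact_fd_ball:
  assumes V: "fd_subspace V"
  shows "compact (V \<inter> cball 0 r)"
proof -
  obtain C where C: "finite C" "orthonormal C" "V = span C" using fd_subspace_orthonormal[OF V] by blast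
  let ?P = "product_topology (\<lambda>c. top_of_set {-r..r}) C"
  define F where "F a = (\<Sum>c\<in>C. a c *\<^sub>R c)" for a :: "rseq \<Rightarrow> real"
  have "compact_space ?P"
    by (simp add: compact_space_product_topology compact_space_subtopology)
  moreover have "continuous_map ?P euclidean F"
    unfolding F_def
  proof (intro continuous_map_sum C(1))
    fix c assume "c \<in> C"
    then have "continuous_map ?P euclideanreal (\<lambda>a. a c)"
      using continuous_map_product_projection[of c C "\<lambda>c. top_of_set {-r..r}"]
      by (simp add: continuous_map_in_subtopology)
    moreover have "continuous_map euclideanreal euclidean (\<lambda>t. t *\<^sub>R c)"
      by (simp add: continuous_on_scaleR)
    ultimately show "continuous_map ?P euclidean (\<lambda>a. a c *\<^sub>R c)"
      using continuous_map_compose[of ?P euclideanreal "\<lambda>a. a c" euclidean "\<lambda>t. t *\<^sub>R c"]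
      by (simp add: o_def)
  qed
  ultimately have "compact (F ` topspace ?P)"
    using image_compactin compact_space_def by (metis compactin_euclidean_iff)
  moreover have "V \<inter> cball 0 r = F ` topspace ?P \<inter> cball 0 r"
  proof -
    have "F a \<in> V" for a unfolding F_def C(3) by (intro span_sum span_scale span_base)
    moreover have "v \<in> F ` topspace ?P" if v: "v \<in> V" "norm v \<le> r" for v
    proof
      show "v = F (\<lambda>c\<in>C. inner v c)"
        using projection_ident[OF C(1,2), of v] v C(3) by (simp add: F_def projection_def)
      have "\<bar>inner v c\<bar> \<le> r" if "c \<in> C" for c
        using Cauchy_Schwarz_ineq2[of v c] that C(2) v(2) by (simp add: orthonormal_def)
      then show "(\<lambda>c\<in>C. inner v c) \<in> topspace ?P" by (auto simp: abs_le_iff minus_le_iff)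
    qed
    ultimately show ?thesis by auto
  qed
  ultimately show ?thesis by (simp add: compact_Int_closed)
qed

subsection \<open>Orthogonal sums\<close>

text \<open>Even and odd positions carry two mutually orthogonal isometric copies of the whole
  sequence space, so an orthogonal sum of two subspaces can be formed inside the same type.\<close>

definition even_part :: "rseq \<Rightarrow> rseq" where
  "even_part x = Abs_rseq (\<lambda>i. if even i then coord x (i div 2) else 0)"

definition odd_part :: "rseq \<Rightarrow> rseq" where
  "odd_part x = Abs_rseq (\<lambda>i. if odd i then coord x (i div 2) else 0)"

lemma coord_even_odd:
  "coord (even_part x) i = (if even i then coord x (i div 2) else 0)"
  "coord (odd_part x) i = (if odd i then coord x (i div 2) else 0)"
proof -
  have "finite ((\<lambda>i. 2 * i) ` {i. coord x i \<noteq> 0})" "finite ((\<lambda>i. 2 * i + 1) ` {i. coord x i \<noteq> 0})"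
    by (simp_all add: finite_coord)
  moreover have "{i. (if even i then coord x (i div 2) else 0) \<noteq> 0} \<subseteq> (\<lambda>i. 2 * i) ` {i. coord x i \<noteq> 0}"
    "{i. (if odd i then coord x (i div 2) else 0) \<noteq> 0} \<subseteq> (\<lambda>i. 2 * i + 1) ` {i. coord x i \<noteq> 0}"
    by (auto simp: image_iff elim!: evenE oddE)
  ultimately show "coord (even_part x) i = (if even i then coord x (i div 2) else 0)"
    "coord (odd_part x) i = (if odd i then coord x (i div 2) else 0)"
    unfolding even_part_def odd_part_def using finite_subset by (subst coord_Abs; blast)+
qed

lemma linear_even_odd: "linear even_part" "linear odd_part"
  by (auto intro!: linearI simp: coord_inject_ext coord_even_odd coord_plus coord_scaleR)

lemma inner_even_odd:
  "inner (even_part x) (even_part y) = inner x y" "inner (odd_part x) (odd_part y) = inner x y"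
  "inner (even_part x) (odd_part y) = 0" "inner (odd_part x) (even_part y) = 0"
proof -
  have "inner (even_part x) (even_part y)
      = (\<Sum>i\<in>(\<lambda>i. 2 * i) ` {i. coord x i \<noteq> 0}. coord (even_part x) i * coord (even_part y) i)"
    by (rule inner_rseq_superset)
      (auto simp: coord_even_odd finite_coord image_iff elim!: evenE)
  also have "\<dots> = inner x y"
    by (subst sum.reindex) (auto simp: inj_on_def coord_even_odd inner_rseq_def)
  finally show "inner (even_part x) (even_part y) = inner x y" .
  have "inner (odd_part x) (odd_part y)
      = (\<Sum>i\<in>(\<lambda>i. 2 * i + 1) ` {i. coord x i \<noteq> 0}. coord (odd_part x) i * coord (odd_part y) i)"
    by (rule inner_rseq_superset)
      (auto simp: coord_even_odd finite_coord image_iff elim!: oddE)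
  also have "\<dots> = inner x y"
    by (subst sum.reindex) (auto simp: inj_on_def coord_even_odd inner_rseq_def)
  finally show "inner (odd_part x) (odd_part y) = inner x y" .
  show "inner (even_part x) (odd_part y) = 0" "inner (odd_part x) (even_part y) = 0"
    unfolding inner_rseq_def by (auto intro!: sum.neutral simp: coord_even_odd)
qed

lemma fd_subspace_orthogonal_sum:
  assumes "fd_subspace V" "fd_subspace U"
  shows "fd_subspace {even_part v + odd_part u |v u. v \<in> V \<and> u \<in> U}"
proof -
  obtain B C where BC: "finite B" "V = span B" "finite C" "U = span C"
    using assms by (auto simp: fd_subspace_def)
  have "span (even_part ` B \<union> odd_part ` C) = {even_part v + odd_part u |v u. v \<in> V \<and> u \<in> U}"
    unfolding span_Un BC linear_span_image[OF linear_even_odd(1)] linear_span_image[OF linear_even_odd(2)]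
    by blast
  then show ?thesis using fd_subspace_span[of "even_part ` B \<union> odd_part ` C"] BC by simp
qed

section \<open>Spaces of isometric embeddings and the category of inner product spaces\<close>

lemma continuous_map_euclidean_dist:
  fixes f :: "'z \<Rightarrow> 'a::metric_space"
  shows "continuous_map Z euclidean f \<longleftrightarrow>
    (\<forall>z\<in>topspace Z. \<forall>e>0. \<exists>U. openin Z U \<and> z \<in> U \<and> (\<forall>y\<in>U. dist (f y) (f z) < e))"
proof
  assume f: "continuous_map Z euclidean f"
  show "\<forall>z\<in>topspace Z. \<forall>e>0. \<exists>U. openin Z U \<and> z \<in> U \<and> (\<forall>y\<in>U. dist (f y) (f z) < e)"
  proof (intro ballI allI impI)
    fix z and e :: real assume "z \<in> topspace Z" "e > 0"
    moreover have "openin Z {y \<in> topspace Z. f y \<in> ball (f z) e}"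
      by (rule openin_continuous_map_preimage[OF f]) simp
    ultimately show "\<exists>U. openin Z U \<and> z \<in> U \<and> (\<forall>y\<in>U. dist (f y) (f z) < e)"
      by (intro exI[of _ "{y \<in> topspace Z. f y \<in> ball (f z) e}"]) (auto simp: dist_commute)
  qed
next
  assume R: "\<forall>z\<in>topspace Z. \<forall>e>0. \<exists>U. openin Z U \<and> z \<in> U \<and> (\<forall>y\<in>U. dist (f y) (f z) < e)"
  show "continuous_map Z euclidean f"
    unfolding continuous_map_def
  proof (intro conjI allI impI)
    fix U :: "'a set" assume "openin euclidean U"
    then have U: "open U" by simp
    show "openin Z {z \<in> topspace Z. f z \<in> U}"
    proof (subst openin_subopen, intro ballI)
      fix z assume z: "z \<in> {z \<in> topspace Z. f z \<in> U}"
      then obtain e where e: "e > 0" "\<And>y. dist y (f z) < e \<Longrightarrow> y \<in> U"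
        using U by (auto simp: open_dist)
      from z have "z \<in> topspace Z" by simp
      with R e(1) obtain O' where O': "openin Z O'" "z \<in> O'" "\<forall>y\<in>O'. dist (f y) (f z) < e"
        by meson
      then have "O' \<subseteq> {z \<in> topspace Z. f z \<in> U}" using e(2) openin_subset[OF O'(1)] by auto
      then show "\<exists>T. openin Z T \<and> z \<in> T \<and> T \<subseteq> {z \<in> topspace Z. f z \<in> U}"
        using O' by blast
    qed
  qed simp
qed

lemma openin_trans_Collect:
  assumes "openin Z {z \<in> topspace Z. P z}" "openin (subtopology Z {z. P z}) A"
  shows "openin Z A"
proof -
  have "topspace Z \<inter> {z. P z} = {z \<in> topspace Z. P z}" by blast
  then have "subtopology Z {z. P z} = subtopology Z {z \<in> topspace Z. P z}"
    using subtopology_restrict[of Z "{z. P z}"] by simp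
  then show ?thesis using assms openin_trans_full by simp
qed

lemma topspace_isom_space [simp]: "topspace (isom_space V W) = isoms V W"
  by (auto simp: isom_space_def isoms_def)

lemma continuous_map_isom_space:
  "continuous_map Z (isom_space V W) F \<longleftrightarrow>
    (\<forall>z\<in>topspace Z. F z \<in> isoms V W) \<and> (\<forall>v\<in>V. continuous_map Z euclidean (\<lambda>z. F z v))"
  unfolding isom_space_def continuous_map_in_subtopology continuous_map_componentwise
  by (auto simp: isomsD continuous_map_in_subtopology image_subset_iff)

text \<open>The topology on isometries is that of pointwise convergence. Joint continuity of
  evaluation holds because isometries preserve distances and so form an equicontinuous
  family.\<close>

lemma continuous_map_isom_eval:
  assumes F: "continuous_map Z (isom_space V W) F" and g: "continuous_map Z euclidean g"
    and gV: "\<And>z. z \<in> topspace Z \<Longrightarrow> g z \<in> V" and V: "subspace V"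
  shows "continuous_map Z euclidean (\<lambda>z. F z (g z))"
  unfolding continuous_map_euclidean_dist
proof (intro ballI allI impI)
  fix z and e :: real assume z: "z \<in> topspace Z" and e: "e > 0"
  have Fz: "F y \<in> isoms V W" if "y \<in> topspace Z" for y
    using F that by (simp add: continuous_map_isom_space)
  have "continuous_map Z euclidean (\<lambda>y. F y (g z))"
    using F gV[OF z] by (simp add: continuous_map_isom_space)
  then obtain A where A: "openin Z A" "z \<in> A" "\<And>y. y \<in> A \<Longrightarrow> dist (F y (g z)) (F z (g z)) < e/2"
    unfolding continuous_map_euclidean_dist using z e by (meson half_gt_zero)
  obtain B where B: "openin Z B" "z \<in> B" "\<And>y. y \<in> B \<Longrightarrow> dist (g y) (g z) < e/2"
    using g unfolding continuous_map_euclidean_dist using z e by (meson half_gt_zero)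
  show "\<exists>U. openin Z U \<and> z \<in> U \<and> (\<forall>y\<in>U. dist (F y (g y)) (F z (g z)) < e)"
  proof (intro exI conjI ballI)
    show "openin Z (A \<inter> B)" "z \<in> A \<inter> B" using A B by auto
    fix y assume y: "y \<in> A \<inter> B"
    then have yZ: "y \<in> topspace Z" using A(1) openin_subset by auto
    have "dist (F y (g y)) (F y (g z)) < e/2"
      using B(3)[of y] y isoms_dist[OF Fz[OF yZ] V gV[OF yZ] gV[OF z]] by simp
    then show "dist (F y (g y)) (F z (g z)) < e"
      using A(3)[of y] y dist_triangle_half_l by (metis IntD1 dist_commute dist_triangle_half_r)
  qed
qed

lemma continuous_map_isom_compose:
  assumes F: "continuous_map Z (isom_space W U) F" and G: "continuous_map Z (isom_space V W) G"
    and V: "subspace V" and W: "subspace W"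
  shows "continuous_map Z (isom_space V U) (\<lambda>z. compose V (F z) (G z))"
  unfolding continuous_map_isom_space
proof (intro conjI ballI)
  fix z assume "z \<in> topspace Z"
  then show "compose V (F z) (G z) \<in> isoms V U"
    using F G V by (auto simp: continuous_map_isom_space intro!: isoms_compose)
next
  fix v assume v: "v \<in> V"
  have "continuous_map Z euclidean (\<lambda>z. F z (G z v))"
    using G v by (intro continuous_map_isom_eval[OF F _ _ W]) (auto simp: continuous_map_isom_space isomsD)
  then show "continuous_map Z euclidean (\<lambda>z. compose V (F z) (G z) v)"
    using v by (simp add: compose_eq)
qed

lemma Hausdorff_isom_space: "Hausdorff_space (isom_space V W)"
  unfolding isom_space_def
  by (simp add: Hausdorff_space_subtopology Hausdorff_space_product_topology)

lemma closedin_Collect_Ball: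
  assumes "\<And>i. i \<in> I \<Longrightarrow> closedin X {x \<in> topspace X. P i x}"
  shows "closedin X {x \<in> topspace X. \<forall>i\<in>I. P i x}"
proof -
  have "closedin X (\<Inter>(insert (topspace X) ((\<lambda>i. {x \<in> topspace X. P i x}) ` I)))"
    using assms by (intro closedin_Inter) auto
  moreover have "\<Inter>(insert (topspace X) ((\<lambda>i. {x \<in> topspace X. P i x}) ` I))
      = {x \<in> topspace X. \<forall>i\<in>I. P i x}" by auto
  ultimately show ?thesis by simp
qed

text \<open>An isometry sends v into the ball of radius \<open>norm v\<close> in W, which is
  compact. By Tychonoff the product of these balls is compact, and linearity and preservation of
  inner products are closed conditions in it.\<close>

lemma compact_isom_space:
  assumes W: "fd_subspace W"
  shows "compact_space (isom_space V W)"
proof -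
  let ?B = "\<lambda>v. W \<inter> cball 0 (norm v)"
  let ?P = "product_topology (\<lambda>v. top_of_set (?B v)) V"
  have "?P = subtopology (product_topology (\<lambda>_. top_of_set W) V) (PiE V ?B)"
    unfolding subtopology_product_topology by (simp add: subtopology_subtopology)
  moreover have sub: "isoms V W \<subseteq> PiE V ?B"
  proof
    fix f assume f: "f \<in> isoms V W"
    then show "f \<in> PiE V ?B" using isomsD(1,5)[OF f] isoms_norm[OF f] by (simp add: PiE_iff)
  qed
  ultimately have eq: "isom_space V W = subtopology ?P (isoms V W)"
    by (simp add: isom_space_def subtopology_subtopology Int_absorb1)
  have cP: "compact_space ?P"
    using compact_fd_ball[OF W] by (simp add: compact_space_product_topology compact_space_subtopology)
  have ev: "continuous_map ?P euclidean (\<lambda>f. f v)" if "v \<in> V" for v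
    using continuous_map_product_projection[OF that, of "\<lambda>v. top_of_set (?B v)"]
    by (simp add: continuous_map_in_subtopology)
  have eqv: "closedin ?P {f \<in> topspace ?P. F f = G f}"
    if "continuous_map ?P euclidean F" "continuous_map ?P euclidean G" for F G :: "_ \<Rightarrow> rseq"
    by (rule closedin_continuous_maps_eq[OF _ that]) simp
  have eqr: "closedin ?P {f \<in> topspace ?P. F f = c}"
    if "continuous_map ?P euclideanreal F" for F and c :: real
    by (rule closedin_continuous_maps_eq[OF _ that]) simp_all
  have ext: "f v = undefined" if "f \<in> topspace ?P" "v \<notin> V" for f v
    using that by (auto simp: PiE_iff extensional_def)
  \<comment> \<open>\<open>V\<close> is not assumed to be closed under addition, so
    \<open>x + y\<close> may lie outside it. There all functions have the constant value
    \<open>undefined\<close>, and evaluation is still continuous.\<close>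
  have undef: "continuous_map ?P euclidean (\<lambda>f. f v)" for v
  proof (cases "v \<in> V")
    case False
    have "continuous_map ?P euclidean (\<lambda>f. undefined)" by simp
    then show ?thesis by (rule continuous_map_eq) (simp add: ext[OF _ False] del: topspace_product_topology)
  qed (rule ev)
  have inn: "continuous_map ?P euclideanreal (\<lambda>f. inner (f x) (f y))" for x y
  proof -
    have "continuous_map ?P euclidean (\<lambda>f. (f x, f y))"
      using continuous_map_pairedI[OF undef[of x] undef[of y]] by (simp add: euclidean_product_topology)
    moreover have "continuous_map euclidean euclideanreal (\<lambda>p::rseq \<times> rseq. inner (fst p) (snd p))"
      by (auto intro!: continuous_intros)
    ultimately show ?thesis
      using continuous_map_compose[of ?P euclidean "\<lambda>f. (f x, f y)" euclideanreal
          "\<lambda>p. inner (fst p) (snd p)"] by (simp add: o_def)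
  qed
  have sc: "continuous_map ?P euclidean (\<lambda>f. c *\<^sub>R f x)" for x and c :: real
  proof -
    have "continuous_map euclidean euclidean (\<lambda>p::rseq. c *\<^sub>R p)" by (auto intro!: continuous_intros)
    then show ?thesis using continuous_map_compose[OF undef[of x], of euclidean "\<lambda>p. c *\<^sub>R p"]
      by (simp add: o_def)
  qed
  have add: "continuous_map ?P euclidean (\<lambda>f. f x + f y)" for x y
    by (intro continuous_map_add undef)
  have "closedin ?P ({f \<in> topspace ?P. \<forall>x\<in>V. \<forall>y\<in>V. f (x + y) = f x + f y}
    \<inter> {f \<in> topspace ?P. \<forall>c\<in>UNIV. \<forall>x\<in>V. f (c *\<^sub>R x) = c *\<^sub>R f x}
    \<inter> {f \<in> topspace ?P. \<forall>x\<in>V. \<forall>y\<in>V. inner (f x) (f y) = inner x y})" (is "closedin ?P ?C")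
    by (intro closedin_Int closedin_Collect_Ball eqv eqr undef inn sc add)
  moreover have "?C = isoms V W"
  proof
    show "?C \<subseteq> isoms V W" by (auto simp: isoms_def PiE_iff)
    show "isoms V W \<subseteq> ?C"
    proof
      fix f assume f: "f \<in> isoms V W"
      then have "f \<in> topspace ?P" using sub by auto
      with f show "f \<in> ?C" by (simp add: isomsD del: topspace_product_topology)
    qed
  qed
  ultimately have "compactin ?P (isoms V W)" using cP closedin_compact_space by metis
  then show ?thesis unfolding eq by (rule compact_space_subtopology)
qed

section \<open>The compactified spaces of morphisms\<close>

lemma omors_iff:
  "Some (f, x) \<in> omors V W \<longleftrightarrow> f \<in> isoms V W \<and> x \<in> W \<and> (\<forall>v\<in>V. inner (f v) x = 0)"
  "None \<in> omors V W"
  by (auto simp: omors_def)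

lemma omorsE:
  assumes "\<phi> \<in> omors V W"
  obtains "\<phi> = None"
  | f x where "\<phi> = Some (f, x)" "f \<in> isoms V W" "x \<in> W" "\<And>v. v \<in> V \<Longrightarrow> inner (f v) x = 0"
  using assms by (auto simp: omors_def)

lemma topspace_omor_space [simp]: "topspace (omor_space V W) = omors V W"
  by (auto simp: omor_space_def omors_def)

lemma locally_compact_fd_subspace:
  assumes "fd_subspace W"
  shows "locally_compact_space (top_of_set W)"
  unfolding locally_compact_space_def
proof (intro ballI exI conjI)
  fix x assume "x \<in> topspace (top_of_set W)"
  then show "x \<in> W \<inter> ball 0 (norm x + 1)" by simp
  show "openin (top_of_set W) (W \<inter> ball 0 (norm x + 1))" by (simp add: openin_open_Int)
  show "compactin (top_of_set W) (W \<inter> cball 0 (norm x + 1))"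
    using compact_fd_ball[OF assms] by (simp add: compactin_subtopology)
  show "W \<inter> ball 0 (norm x + 1) \<subseteq> W \<inter> cball 0 (norm x + 1)" by auto
qed

lemma Hausdorff_omor_space:
  assumes "fd_subspace W"
  shows "Hausdorff_space (omor_space V W)"
proof -
  have "locally_compact_space (prod_topology (isom_space V W) (top_of_set W))"
    using locally_compact_fd_subspace[OF assms] compact_isom_space[OF assms]
    by (simp add: locally_compact_space_prod_topology compact_imp_locally_compact_space)
  moreover have "Hausdorff_space (prod_topology (isom_space V W) (top_of_set W))"
    by (simp add: Hausdorff_space_prod_topology Hausdorff_isom_space Hausdorff_space_subtopology)
  ultimately show ?thesis
    by (simp add: omor_space_def Hausdorff_space_subtopology Hausdorff_space_Alexandroff_compactification)
qed

text \<open>Inside the one-point compactification of the product, the points left out are the pairs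
  with a nonzero inner product. They form an open set that avoids the point at infinity.\<close>

lemma compact_omor_space:
  "compact_space (omor_space V W)"
proof -
  let ?P = "prod_topology (isom_space V W) (top_of_set W)"
  let ?U = "\<Union>v\<in>V. {z \<in> topspace ?P. inner (fst z v) (snd z) \<in> - {0}}"
  have "openin ?P ?U"
  proof (intro openin_Union ballI, elim imageE, hypsubst)
    fix v assume v: "v \<in> V"
    have "continuous_map ?P (isom_space V W) fst" by (rule continuous_map_fst)
    then have "continuous_map ?P euclidean (\<lambda>z. fst z v)"
      using v by (simp add: continuous_map_isom_space)
    moreover have "continuous_map ?P euclidean snd"
      using continuous_map_snd[of "isom_space V W" "top_of_set W"]
      by (simp add: continuous_map_in_subtopology)
    ultimately have "continuous_map ?P euclidean (\<lambda>z. (fst z v, snd z))"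
      using continuous_map_pairedI[of ?P euclidean "\<lambda>z. fst z v" euclidean snd]
      by (simp add: euclidean_product_topology)
    moreover have "continuous_map euclidean euclideanreal (\<lambda>p::rseq \<times> rseq. inner (fst p) (snd p))"
      by (auto intro!: continuous_intros)
    ultimately have "continuous_map ?P euclideanreal (\<lambda>z. inner (fst z v) (snd z))"
      using continuous_map_compose[of ?P euclidean "\<lambda>z. (fst z v, snd z)" euclideanreal
          "\<lambda>p. inner (fst p) (snd p)"] by (simp add: o_def)
    then show "openin ?P {z \<in> topspace ?P. inner (fst z v) (snd z) \<in> - {0}}"
      by (rule openin_continuous_map_preimage) (simp add: open_Compl)
  qed
  moreover have "omors V W = topspace (Alexandroff_compactification ?P) - Some ` ?U"
  proof (rule Set.set_eqI)
    fix \<phi> show "\<phi> \<in> omors V W \<longleftrightarrow> \<phi> \<in> topspace (Alexandroff_compactification ?P) - Some ` ?U"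
      by (cases \<phi>) (auto simp: omors_def inj_image_mem_iff)
  qed
  ultimately have "closedin (Alexandroff_compactification ?P) (omors V W)"
    unfolding closedin_Alexandroff_compactification by blast
  then show ?thesis
    unfolding omor_space_def
    using compact_space_Alexandroff_compactification closedin_compact_space compact_space_subtopology by blast
qed

text \<open>Away from the base point continuity is componentwise. At the base point only the norm of
  the vector part has to be controlled, because the isometry part ranges over a bounded
  family.\<close>

lemma continuous_map_omor_spaceI:
  assumes F: "\<And>z. z \<in> topspace Z \<Longrightarrow> F z \<in> omors V W"
    and S: "openin Z {z \<in> topspace Z. F z \<noteq> None}" (is "openin Z ?S")
    and f: "\<And>v. v \<in> V \<Longrightarrow> continuous_map (subtopology Z {z. F z \<noteq> None}) euclidean (\<lambda>z. fst (the (F z)) v)"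
    and x: "continuous_map (subtopology Z {z. F z \<noteq> None}) euclidean (\<lambda>z. snd (the (F z)))"
    and inf: "\<And>r. openin Z {z \<in> topspace Z. F z = None \<or> r < norm (snd (the (F z)))}"
  shows "continuous_map Z (omor_space V W) F"
proof -
  let ?P = "prod_topology (isom_space V W) (top_of_set W)"
  let ?Z = "subtopology Z {z. F z \<noteq> None}"
  have mem: "fst (the (F z)) \<in> isoms V W" "snd (the (F z)) \<in> W" if "z \<in> topspace ?Z" for z
    using F[of z] that by (auto simp: omors_def)
  have "continuous_map ?Z ?P (\<lambda>z. (fst (the (F z)), snd (the (F z))))"
    using f x mem by (intro continuous_map_pairedI)
      (auto simp: continuous_map_isom_space continuous_map_in_subtopology)
  then have c: "continuous_map ?Z ?P (\<lambda>z. the (F z))" by simp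
  have pre: "openin Z {z \<in> topspace Z. F z \<in> Some ` U}" if "openin ?P U" for U
  proof -
    have "openin ?Z {z \<in> topspace ?Z. the (F z) \<in> U}"
      using c that by (rule openin_continuous_map_preimage)
    then have "openin Z {z \<in> topspace ?Z. the (F z) \<in> U}" by (rule openin_trans_Collect[OF S])
    then show ?thesis by (rule back_subst[of "openin Z"]) force
  qed
  have "openin Z {z \<in> topspace Z. F z \<in> O'}" if "openin (Alexandroff_compactification ?P) O'" for O'
    using that unfolding openin_Alexandroff_compactification
  proof (elim disjE exE conjE)
    fix C assume C: "compactin ?P C" "O' = insert None (Some ` (topspace ?P - C))" "closedin ?P C"
    \<comment> \<open>The compact set \<open>C\<close> has bounded vector parts, so every point with
      vector part longer than \<open>r\<close> lies outside it. The remaining points of the preimage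
      are finite and are covered by \<open>pre\<close>.\<close>
    have "compactin (top_of_set W) (snd ` C)" using C(1) image_compactin continuous_map_snd by blast
    then have "bounded (snd ` C)" by (simp add: compactin_subtopology compact_imp_bounded)
    then obtain r where r: "\<And>c. c \<in> C \<Longrightarrow> norm (snd c) \<le> r" by (auto simp: bounded_iff)
    have "openin Z ({z \<in> topspace Z. F z = None \<or> r < norm (snd (the (F z)))}
        \<union> {z \<in> topspace Z. F z \<in> Some ` (topspace ?P - C)})"
      using inf pre C(3) by blast
    moreover have "{z \<in> topspace Z. F z \<in> O'} = {z \<in> topspace Z. F z = None \<or> r < norm (snd (the (F z)))}
        \<union> {z \<in> topspace Z. F z \<in> Some ` (topspace ?P - C)}" (is "?L = ?R")
    proof
      show "?L \<subseteq> ?R" using C(2) by blast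
      show "?R \<subseteq> ?L"
      proof
        fix z assume z: "z \<in> ?R"
        then have zZ: "z \<in> topspace Z" by blast
        show "z \<in> ?L"
        proof (cases "F z")
          case (Some p)
          have "p \<in> topspace ?P" using F[OF zZ] Some by (auto simp: omors_def)
          moreover have "p \<notin> C" using z Some r[of p] by force
          ultimately show ?thesis using zZ Some C(2) by auto
        qed (use zZ C(2) in auto)
      qed
    qed
    ultimately show ?thesis by simp
  qed (use pre in blast)
  then have "continuous_map Z (Alexandroff_compactification ?P) F"
    using F by (auto simp: continuous_map_def omors_def)
  then show ?thesis using F by (auto simp: omor_space_def continuous_map_in_subtopology)
qed

lemma openin_omor_space_Some:
  assumes "openin (prod_topology (isom_space V W) (top_of_set W)) U"
  shows "openin (omor_space V W) {\<phi> \<in> omors V W. \<phi> \<in> Some ` U}"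
proof -
  have "openin (omor_space V W) (Some ` U \<inter> omors V W)"
    unfolding omor_space_def using assms by (intro openin_subtopology_Int) simp
  then show ?thesis by (rule back_subst[of "openin (omor_space V W)"]) auto
qed

lemma openin_omor_space_not_None:
  "openin (omor_space V W) {\<phi> \<in> omors V W. \<phi> \<noteq> None}"
  using openin_omor_space_Some[OF openin_topspace, of V W]
  by (rule back_subst[of "openin (omor_space V W)"]) (auto simp: omors_def)

text \<open>Since W is finite dimensional, the pairs with vector part of norm at most r form a
  compact set; its complement is a neighbourhood of infinity.\<close>

lemma openin_omor_space_infinity:
  assumes "fd_subspace W"
  shows "openin (omor_space V W) {\<phi> \<in> omors V W. \<phi> = None \<or> r < norm (snd (the \<phi>))}"
proof -
  let ?P = "prod_topology (isom_space V W) (top_of_set W)"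
  let ?C = "isoms V W \<times> (W \<inter> cball 0 r)"
  have C: "compactin ?P ?C"
    using compact_isom_space[OF assms, of V] compact_fd_ball[OF assms]
    by (simp add: compactin_Times compact_space_def compactin_subtopology)
  have "Hausdorff_space ?P"
    by (simp add: Hausdorff_space_prod_topology Hausdorff_isom_space Hausdorff_space_subtopology)
  then have "openin (Alexandroff_compactification ?P) (insert None (Some ` (topspace ?P - ?C)))"
    unfolding openin_Alexandroff_compactification using C compactin_imp_closedin by blast
  then have "openin (omor_space V W) (insert None (Some ` (topspace ?P - ?C)) \<inter> omors V W)"
    unfolding omor_space_def by (rule openin_subtopology_Int)
  then show ?thesis
    by (rule back_subst[of "openin (omor_space V W)"]) (auto simp: omors_def)
qed

lemma continuous_map_omor_the:
  assumes F: "continuous_map Z (omor_space V W) F"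
  shows "openin Z {z \<in> topspace Z. F z \<noteq> None}"
    "continuous_map (subtopology Z {z. F z \<noteq> None}) (isom_space V W) (\<lambda>z. fst (the (F z)))"
    "continuous_map (subtopology Z {z. F z \<noteq> None}) euclidean (\<lambda>z. snd (the (F z)))"
proof -
  have Fz: "F z \<in> omors V W" if "z \<in> topspace Z" for z
    using F that by (auto simp: continuous_map_def)
  show "openin Z {z \<in> topspace Z. F z \<noteq> None}"
    using openin_continuous_map_preimage[OF F openin_omor_space_not_None]
    by (rule back_subst[of "openin Z"]) (use Fz in auto)
  let ?P = "prod_topology (isom_space V W) (top_of_set W)"
  let ?Z = "subtopology Z {z. F z \<noteq> None}"
  have c: "continuous_map ?Z ?P (\<lambda>z. the (F z))"
    unfolding continuous_map_def
  proof (intro conjI allI impI)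
    show "(\<lambda>z. the (F z)) \<in> topspace ?Z \<rightarrow> topspace ?P"
      using Fz by (fastforce simp: omors_def)
    fix U assume "openin ?P U"
    then have "openin Z {z \<in> topspace Z. F z \<in> {\<phi> \<in> omors V W. \<phi> \<in> Some ` U}}"
      by (intro openin_continuous_map_preimage[OF F] openin_omor_space_Some)
    then have "openin ?Z ({z \<in> topspace Z. F z \<in> {\<phi> \<in> omors V W. \<phi> \<in> Some ` U}} \<inter> {z. F z \<noteq> None})"
      by (rule openin_subtopology_Int)
    then show "openin ?Z {z \<in> topspace ?Z. the (F z) \<in> U}"
      by (rule back_subst[of "openin ?Z"]) (use Fz in force)
  qed
  show "continuous_map ?Z (isom_space V W) (\<lambda>z. fst (the (F z)))"
    using c by (simp add: continuous_map_pairwise o_def)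
  show "continuous_map ?Z euclidean (\<lambda>z. snd (the (F z)))"
    using c by (simp add: continuous_map_pairwise o_def continuous_map_in_subtopology)
qed

section \<open>Composition of morphisms\<close>

lemma ocomp_None [simp]: "ocomp V \<theta> None = None" "ocomp V None \<phi> = None"
  by (cases \<theta>; simp)+ 

lemma ocomp_eq_None: "ocomp V \<theta> \<phi> = None \<longleftrightarrow> \<theta> = None \<or> \<phi> = None"
  by (cases \<theta>; cases \<phi>) auto

lemma ocomp_omors:
  assumes "\<theta> \<in> omors W U" "\<phi> \<in> omors V W" "subspace V" "subspace U"
  shows "ocomp V \<theta> \<phi> \<in> omors V U"
proof (cases "\<theta> = None \<or> \<phi> = None")
  case True
  then show ?thesis by (auto simp: omors_iff)
next
  case False
  then obtain f x g y where fg: "\<theta> = Some (f, x)" "\<phi> = Some (g, y)" by auto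
  with assms have "f \<in> isoms W U" "g \<in> isoms V W" "x \<in> U" "y \<in> W"
    "\<And>v. v \<in> W \<Longrightarrow> inner (f v) x = 0" "\<And>v. v \<in> V \<Longrightarrow> inner (g v) y = 0"
    by (auto simp: omors_iff)
  then show ?thesis
    using assms(3,4) by (auto simp: fg omors_iff isoms_compose compose_eq isomsD inner_add_right subspace_add)
qed

lemma ocomp_assoc:
  assumes "\<theta> \<in> omors W U" "\<phi> \<in> omors V W" "\<xi> \<in> omors V' V" "subspace V'"
  shows "ocomp V' (ocomp V \<theta> \<phi>) \<xi> = ocomp V' \<theta> (ocomp V' \<phi> \<xi>)"
proof (cases "\<theta> = None \<or> \<phi> = None \<or> \<xi> = None")
  case True
  then show ?thesis by auto
next
  case False
  then obtain f x g y h z where fg: "\<theta> = Some (f, x)" "\<phi> = Some (g, y)" "\<xi> = Some (h, z)" by auto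
  with assms have "f \<in> isoms W U" "g \<in> isoms V W" "h \<in> isoms V' V" "y \<in> W" "z \<in> V"
    by (auto simp: omors_iff)
  then show ?thesis
    by (auto simp: fg compose_def fun_eq_iff isomsD)
qed

lemma isom_omor_omors: "f \<in> isoms V W \<Longrightarrow> subspace W \<Longrightarrow> isom_omor f \<in> omors V W"
  by (simp add: isom_omor_def omors_iff subspace_0)

lemma ocomp_isom_omor:
  "f \<in> isoms W U \<Longrightarrow> subspace W \<Longrightarrow> ocomp V (isom_omor f) (isom_omor g) = isom_omor (compose V f g)"
  by (simp add: isom_omor_def isoms_zero)

lemma ocomp_id_left:
  assumes "\<phi> \<in> omors V W"
  shows "ocomp V (isom_omor (\<lambda>x\<in>W. x)) \<phi> = \<phi>"
  using assms
proof (cases rule: omorsE)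
  case (2 f x)
  then have "compose V (\<lambda>x\<in>W. x) f = f"
    by (intro extensionalityI[of _ V]) (auto simp: compose_eq isomsD)
  with 2 show ?thesis by (simp add: isom_omor_def)
qed simp

lemma ocomp_id_right:
  assumes "\<phi> \<in> omors V W" "subspace V"
  shows "ocomp V \<phi> (isom_omor (\<lambda>x\<in>V. x)) = \<phi>"
  using assms(1)
proof (cases rule: omorsE)
  case (2 f x)
  then have "compose V f (\<lambda>x\<in>V. x) = f"
    by (intro extensionalityI[of _ V]) (auto simp: compose_eq isomsD)
  with 2 assms(2) show ?thesis by (simp add: isom_omor_def isoms_zero)
qed simp

text \<open>
  Near infinity, continuity rests on \<open>\<bar>x + f y\<bar>\<^sup>2 = \<bar>x\<bar>\<^sup>2 + \<bar>y\<bar>\<^sup>2\<close>: the vector part of a composite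
  is large as soon as one of the vector parts is.
\<close>

lemma continuous_map_ocomp:
  assumes F: "continuous_map Z (omor_space W U) F" and G: "continuous_map Z (omor_space V W) G"
    and V: "subspace V" and W: "fd_subspace W" and U: "fd_subspace U"
  shows "continuous_map Z (omor_space V U) (\<lambda>z. ocomp V (F z) (G z))"
proof (rule continuous_map_omor_spaceI)
  have sW: "subspace W" and sU: "subspace U" using W U by (auto simp: fd_subspace_imp_subspace)
  have Fz: "F z \<in> omors W U" and Gz: "G z \<in> omors V W" if "z \<in> topspace Z" for z
    using F G that by (auto simp: continuous_map_def)
  show "ocomp V (F z) (G z) \<in> omors V U" if "z \<in> topspace Z" for z
    using ocomp_omors Fz Gz that V sU by blast
  let ?S = "{z. ocomp V (F z) (G z) \<noteq> None}"
  let ?Z = "subtopology Z ?S"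
  have "openin Z ({z \<in> topspace Z. F z \<noteq> None} \<inter> {z \<in> topspace Z. G z \<noteq> None})"
    using continuous_map_omor_the(1)[OF F] continuous_map_omor_the(1)[OF G] by blast
  then show S: "openin Z {z \<in> topspace Z. ocomp V (F z) (G z) \<noteq> None}"
    by (rule back_subst[of "openin Z"]) (auto simp: ocomp_eq_None)
  have sub: "?S \<subseteq> {z. F z \<noteq> None}" "?S \<subseteq> {z. G z \<noteq> None}" by (auto simp: ocomp_eq_None)
  have cF: "continuous_map ?Z (isom_space W U) (\<lambda>z. fst (the (F z)))"
    "continuous_map ?Z euclidean (\<lambda>z. snd (the (F z)))"
    and cG: "continuous_map ?Z (isom_space V W) (\<lambda>z. fst (the (G z)))"
    "continuous_map ?Z euclidean (\<lambda>z. snd (the (G z)))"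
    using continuous_map_omor_the(2,3)[OF F] continuous_map_omor_the(2,3)[OF G] sub
    by (auto intro: continuous_map_from_subtopology_mono)
  have some: "\<exists>f x g y. F z = Some (f, x) \<and> G z = Some (g, y) \<and> f \<in> isoms W U \<and> x \<in> U
      \<and> (\<forall>v\<in>W. inner (f v) x = 0) \<and> g \<in> isoms V W \<and> y \<in> W" if "z \<in> topspace ?Z" for z
    using that Fz[of z] Gz[of z] by (auto simp: omors_def)
  show "continuous_map ?Z euclidean (\<lambda>z. fst (the (ocomp V (F z) (G z))) v)" if v: "v \<in> V" for v
  proof (rule continuous_map_eq)
    have gW: "fst (the (G z)) v \<in> W" if "z \<in> topspace ?Z" for z
      using some[OF that] v isomsD(1) by fastforce
    have "continuous_map ?Z euclidean (\<lambda>z. fst (the (G z)) v)"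
      using cG(1) v unfolding continuous_map_isom_space by blast
    then show "continuous_map ?Z euclidean (\<lambda>z. fst (the (F z)) (fst (the (G z)) v))"
      by (rule continuous_map_isom_eval[OF cF(1) _ gW sW])
    fix z assume "z \<in> topspace ?Z"
    then show "fst (the (F z)) (fst (the (G z)) v) = fst (the (ocomp V (F z) (G z))) v"
      using some[of z] v by (auto simp: compose_eq)
  qed
  show c: "continuous_map ?Z euclidean (\<lambda>z. snd (the (ocomp V (F z) (G z))))"
  proof (rule continuous_map_eq)
    have yW: "snd (the (G z)) \<in> W" if "z \<in> topspace ?Z" for z using some[OF that] by auto
    show "continuous_map ?Z euclidean (\<lambda>z. snd (the (F z)) + fst (the (F z)) (snd (the (G z))))"
      by (intro continuous_map_add cF(2) continuous_map_isom_eval[OF cF(1) cG(2) yW sW])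
    fix z assume "z \<in> topspace ?Z"
    then show "snd (the (F z)) + fst (the (F z)) (snd (the (G z))) = snd (the (ocomp V (F z) (G z)))"
      using some[of z] by auto
  qed
  fix r :: real
  \<comment> \<open>The preimage of a neighbourhood of infinity is the union of three open sets: one
    of the two factors is near infinity, or the composite is finite with a long vector part. That
    the first two belong to the preimage is the norm inequality.\<close>
  let ?A = "{z \<in> topspace Z. F z \<in> {\<phi> \<in> omors W U. \<phi> = None \<or> r < norm (snd (the \<phi>))}}"
  let ?B = "{z \<in> topspace Z. G z \<in> {\<phi> \<in> omors V W. \<phi> = None \<or> r < norm (snd (the \<phi>))}}"
  let ?C = "{z \<in> topspace ?Z. snd (the (ocomp V (F z) (G z))) \<in> - cball 0 r}"
  have "openin Z ?A" "openin Z ?B"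
    using openin_omor_space_infinity openin_continuous_map_preimage F G U W by blast+
  moreover have "openin ?Z ?C"
    by (rule openin_continuous_map_preimage[OF c]) (simp add: open_Compl)
  then have "openin Z ?C"
    by (rule openin_trans_Collect[OF S])
  ultimately have "openin Z (?A \<union> ?B \<union> ?C)" by blast
  moreover have "?A \<union> ?B \<union> ?C = {z \<in> topspace Z. ocomp V (F z) (G z) = None
      \<or> r < norm (snd (the (ocomp V (F z) (G z))))}" (is "_ = ?R")
  proof
    show "?R \<subseteq> ?A \<union> ?B \<union> ?C"
    proof
      fix z assume z: "z \<in> ?R"
      show "z \<in> ?A \<union> ?B \<union> ?C"
      proof (cases "ocomp V (F z) (G z) = None")
        case True
        then have "F z = None \<or> G z = None" by (simp add: ocomp_eq_None)
        then show ?thesis using z Fz Gz by blast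
      qed (use z in auto)
    qed
    show "?A \<union> ?B \<union> ?C \<subseteq> ?R"
    proof
      fix z assume z: "z \<in> ?A \<union> ?B \<union> ?C"
      show "z \<in> ?R"
      proof (cases "z \<in> topspace ?Z")
        case True
        then obtain f x g y where fg: "F z = Some (f, x)" "G z = Some (g, y)" "f \<in> isoms W U"
          "\<forall>v\<in>W. inner (f v) x = 0" "y \<in> W" using some[of z] by blast
        have "(norm (x + f y))\<^sup>2 = (norm x)\<^sup>2 + (norm y)\<^sup>2"
          using fg(4,5) isoms_norm[OF fg(3,5)]
          by (simp add: norm_add_Pythagorean orthogonal_def inner_commute)
        then have "norm x \<le> norm (x + f y)" "norm y \<le> norm (x + f y)"
          by (simp_all add: power2_le_imp_le)
        then show ?thesis using z fg True by auto
      next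
        case False
        moreover have "z \<in> topspace Z" using z by auto
        ultimately show ?thesis by (simp del: not_None_eq)
      qed
    qed
  qed
  ultimately show "openin Z {z \<in> topspace Z. ocomp V (F z) (G z) = None
      \<or> r < norm (snd (the (ocomp V (F z) (G z))))}" by simp
qed

lemma continuous_map_isom_omor:
  assumes F: "continuous_map Z (isom_space V W) F" and W: "subspace W"
  shows "continuous_map Z (omor_space V W) (\<lambda>z. isom_omor (F z))"
proof (rule continuous_map_omor_spaceI)
  show "isom_omor (F z) \<in> omors V W" if "z \<in> topspace Z" for z
    using F that W isom_omor_omors by (auto simp: continuous_map_isom_space)
  \<comment> \<open>The vector part is 0, so the condition at infinity is empty for r \<ge> 0 and
    holds everywhere for r < 0.\<close>
  have "{z \<in> topspace Z. isom_omor (F z) = None \<or> r < norm (snd (the (isom_omor (F z))))}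
      = (if r < 0 then topspace Z else {})" for r
    by (auto simp: isom_omor_def)
  then show "openin Z {z \<in> topspace Z. isom_omor (F z) = None \<or> r < norm (snd (the (isom_omor (F z))))}"
    for r by simp
qed (use F in \<open>auto simp: isom_omor_def continuous_map_isom_space\<close>)

section \<open>Evaluation of spectra on representations\<close>

text \<open>
  A frame \<open>b: \<real>\<^sup>n \<cong> V\<close> identifies \<open>A\<^sub>V\<close> with \<open>A\<^sub>n\<close>, the class of \<open>(b, a)\<close> corresponding to \<open>a\<close>. Then
  \<open>\<phi> \<in> O(V,W)\<close> acts through its matrix with respect to the frames, and so do representing isometries.
\<close>

definition omat :: "rseq set \<Rightarrow> rseq set \<Rightarrow> (rseq \<Rightarrow> rseq) \<Rightarrow> omor \<Rightarrow> (rseq \<Rightarrow> rseq) \<Rightarrow> omor" where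
  "omat V W b \<phi> f = ocomp (Rn (dim V)) (isom_omor (isom_inv (dim W) W b))
     (ocomp (Rn (dim V)) \<phi> (isom_omor f))"

abbreviation frames :: "rseq set \<Rightarrow> (rseq \<Rightarrow> rseq) set" where
  "frames V \<equiv> isoms (Rn (dim V)) V"

abbreviation omor_id :: "rseq set \<Rightarrow> omor" where
  "omor_id V \<equiv> isom_omor (\<lambda>x\<in>V. x)"

lemma frames_nonempty: "fd_subspace V \<Longrightarrow> frames V \<noteq> {}"
  using isoms_Rn_dim_exists by blast

lemma omor_id_omors: "fd_subspace V \<Longrightarrow> omor_id V \<in> omors V V"
  by (simp add: fd_subspace_imp_subspace isom_omor_omors isoms_id)

lemma isom_inv_omors:
  "fd_subspace V \<Longrightarrow> b \<in> frames V \<Longrightarrow> isom_omor (isom_inv (dim V) V b) \<in> omors V (Rn (dim V))"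
  by (simp add: isom_omor_omors isom_inv(1) subspace_Rn)

lemma frame_omors: "fd_subspace V \<Longrightarrow> b \<in> frames V \<Longrightarrow> isom_omor b \<in> omors (Rn (dim V)) V"
  by (simp add: fd_subspace_imp_subspace isom_omor_omors)

lemma omat_omors:
  "fd_subspace V \<Longrightarrow> fd_subspace W \<Longrightarrow> b \<in> frames W \<Longrightarrow> f \<in> frames V \<Longrightarrow> \<phi> \<in> omors V W
    \<Longrightarrow> omat V W b \<phi> f \<in> omors (Rn (dim V)) (Rn (dim W))"
  unfolding omat_def
  by (intro ocomp_omors[OF isom_inv_omors] ocomp_omors[OF _ frame_omors])
    (auto simp: subspace_Rn fd_subspace_imp_subspace)

lemma omat_None [simp]: "omat V W b None f = None"
  by (simp add: omat_def)

lemma frame_inv_cancel: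
  assumes "fd_subspace V" "b \<in> frames V" "\<phi> \<in> omors U V"
  shows "ocomp U (isom_omor b) (ocomp U (isom_omor (isom_inv (dim V) V b)) \<phi>) = \<phi>"
  using assms(3)
proof (cases rule: omorsE)
  case (2 f x)
  then have "compose U b (compose U (isom_inv (dim V) V b) f) = f"
    by (intro extensionalityI[of _ U]) (auto simp: compose_eq isomsD isom_inv(3)[OF assms(1,2)])
  with 2 isom_inv(3)[OF assms(1,2)] isoms_zero[OF assms(2) subspace_Rn] show ?thesis
    by (simp add: isom_omor_def)
qed simp

text \<open>As in a product of matrices, the middle frame cancels against its inverse. Combined with
  functoriality of the spectrum this becomes \<open>strmap_omat\<close>, by which independence of
  frames is checked throughout.\<close>

lemma omat_comp:
  assumes V: "fd_subspace V" and W: "fd_subspace W" and U: "fd_subspace U"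
    and c: "c \<in> frames U" and b: "b \<in> frames W" and f: "f \<in> frames V"
    and \<theta>: "\<theta> \<in> omors W U" and \<phi>: "\<phi> \<in> omors V W"
  shows "ocomp (Rn (dim V)) (omat W U c \<theta> b) (omat V W b \<phi> f) = omat V U c (ocomp V \<theta> \<phi>) f"
proof -
  let ?v = "Rn (dim V)" and ?w = "Rn (dim W)"
  let ?ci = "isom_omor (isom_inv (dim U) U c)" and ?bi = "isom_omor (isom_inv (dim W) W b)"
  let ?b = "isom_omor b" and ?f = "isom_omor f"
  have s: "subspace ?v" "subspace ?w" "subspace V" "subspace W" "subspace U"
    using V W U by (auto simp: subspace_Rn fd_subspace_imp_subspace)
  have ci: "?ci \<in> omors U (Rn (dim U))" and bi: "?bi \<in> omors W ?w" and b': "?b \<in> omors ?w W"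
    and f': "?f \<in> omors ?v V"
    using V W U c b f by (auto simp: isom_inv_omors frame_omors)
  have \<phi>f: "ocomp ?v \<phi> ?f \<in> omors ?v W" using \<phi> f' s ocomp_omors by blast
  have bi\<phi>f: "ocomp ?v ?bi (ocomp ?v \<phi> ?f) \<in> omors ?v ?w" using bi \<phi>f s ocomp_omors by blast
  have \<theta>b: "ocomp ?w \<theta> ?b \<in> omors ?w U" using \<theta> b' s ocomp_omors by blast
  have "ocomp ?v (omat W U c \<theta> b) (omat V W b \<phi> f)
      = ocomp ?v ?ci (ocomp ?v (ocomp ?w \<theta> ?b) (ocomp ?v ?bi (ocomp ?v \<phi> ?f)))"
    unfolding omat_def by (rule ocomp_assoc[OF ci \<theta>b bi\<phi>f s(1)])
  also have "\<dots> = ocomp ?v ?ci (ocomp ?v \<theta> (ocomp ?v ?b (ocomp ?v ?bi (ocomp ?v \<phi> ?f))))"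
    using ocomp_assoc[OF \<theta> b' bi\<phi>f s(1)] by simp
  also have "\<dots> = ocomp ?v ?ci (ocomp ?v \<theta> (ocomp ?v \<phi> ?f))"
    using frame_inv_cancel[OF W b \<phi>f] by simp
  also have "\<dots> = omat V U c (ocomp V \<theta> \<phi>) f"
    unfolding omat_def using ocomp_assoc[OF \<theta> \<phi> f' s(1)] by simp
  finally show ?thesis .
qed

lemma omat_id:
  assumes V: "fd_subspace V" and b: "b \<in> frames V"
  shows "omat V V b (omor_id V) b = omor_id (Rn (dim V))"
proof -
  have "ocomp (Rn (dim V)) (omor_id V) (isom_omor b) = isom_omor b"
    by (rule ocomp_id_left[OF frame_omors[OF V b]])
  moreover have "compose (Rn (dim V)) (isom_inv (dim V) V b) b = (\<lambda>x\<in>Rn (dim V). x)"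
    by (intro extensionalityI[of _ "Rn (dim V)"]) (auto simp: compose_eq isom_inv(2)[OF V b])
  ultimately show ?thesis
    unfolding omat_def
    using ocomp_isom_omor[OF isom_inv(1)[OF V b] fd_subspace_imp_subspace[OF V]] by simp
qed

text \<open>A group element acts on A_V by moving frames. This identity turns the moved frame into
  the matrix of that element.\<close>

lemma omat_frame_change:
  assumes V: "fd_subspace V" and b: "b \<in> frames V" and f: "f \<in> frames V" and g: "g \<in> isoms V V"
  shows "omat V V b (omor_id V) (compose (Rn (dim V)) g f) = omat V V b (isom_omor g) f"
proof -
  have s: "subspace V" using V by (rule fd_subspace_imp_subspace)
  have "isom_omor (compose (Rn (dim V)) g f) \<in> omors (Rn (dim V)) V"
    by (rule isom_omor_omors[OF isoms_compose[OF g f subspace_Rn] s])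
  from ocomp_id_left[OF this] show ?thesis
    unfolding omat_def using ocomp_isom_omor[OF g s] by simp
qed

lemma continuous_map_omat:
  assumes V: "fd_subspace V" and W: "fd_subspace W" and b: "b \<in> frames W" and f: "f \<in> frames V"
    and F: "continuous_map Z (omor_space V W) F"
  shows "continuous_map Z (omor_space (Rn (dim V)) (Rn (dim W))) (\<lambda>z. omat V W b (F z) f)"
  unfolding omat_def
  by (intro continuous_map_ocomp[where W = W] continuous_map_ocomp[where W = V] F)
    (auto simp: V W b f isom_inv_omors frame_omors subspace_Rn fd_subspace_Rn)

section \<open>Evaluation of a spectrum on an inner product space\<close>

locale group_spectrum =
  fixes G :: "'g monoid" and T :: "'g topology" and A :: "('g, 'a) gspectrum"
  assumes topological_group: "topological_group G T"
    and spectrum: "orthogonal_spectrum G T A"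
begin

lemma group: "group G" and topspace_T: "topspace T = carrier G"
  using topological_group by (auto simp: topological_group_def)

sublocale group G by (rule group)

abbreviation points :: "nat \<Rightarrow> 'a set" where
  "points m \<equiv> topspace (level A m)"

lemma level_CGWH: "CGWH_space (level A m)" and basept_in: "basept A m \<in> points m"
  using spectrum by (auto simp: orthogonal_spectrum_def)

lemma continuous_map_strmap:
  assumes "continuous_map Z (omor_space (Rn m) (Rn n)) F" "continuous_map Z (level A m) g"
  shows "continuous_map Z (level A n) (\<lambda>z. strmap A m n (F z) (g z))"
proof -
  have "continuous_map (prod_topology (omor_space (Rn m) (Rn n)) (level A m)) (level A n)
      (\<lambda>(\<theta>, a). strmap A m n \<theta> a)"
    using spectrum by (auto simp: orthogonal_spectrum_def)
  from continuous_map_compose[OF continuous_map_pairedI[OF assms] this]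
  show ?thesis by (simp add: o_def)
qed

lemma continuous_map_gact:
  assumes "continuous_map Z T F" "continuous_map Z (level A m) g"
  shows "continuous_map Z (level A m) (\<lambda>z. gact A (F z) m (g z))"
proof -
  have "continuous_map (prod_topology T (level A m)) (level A m) (\<lambda>(g, a). gact A g m a)"
    using spectrum by (auto simp: orthogonal_spectrum_def)
  from continuous_map_compose[OF continuous_map_pairedI[OF assms] this]
  show ?thesis by (simp add: o_def)
qed

lemma strmap_in:
  assumes "\<theta> \<in> omors (Rn m) (Rn n)" "a \<in> points m"
  shows "strmap A m n \<theta> a \<in> points n"
proof -
  have "continuous_map (prod_topology (omor_space (Rn m) (Rn n)) (level A m)) (level A n)
      (\<lambda>(\<theta>, a). strmap A m n \<theta> a)"
    using spectrum by (auto simp: orthogonal_spectrum_def)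
  from funcset_mem[OF continuous_map_funspace[OF this], of "(\<theta>, a)"] show ?thesis using assms by simp
qed

lemma gact_in:
  assumes "g \<in> carrier G" "a \<in> points m"
  shows "gact A g m a \<in> points m"
proof -
  have "continuous_map (prod_topology T (level A m)) (level A m) (\<lambda>(g, a). gact A g m a)"
    using spectrum by (auto simp: orthogonal_spectrum_def)
  from funcset_mem[OF continuous_map_funspace[OF this], of "(g, a)"] show ?thesis
    using assms topspace_T by simp
qed

lemma strmap_None: "a \<in> points m \<Longrightarrow> strmap A m n None a = basept A n"
  and strmap_basept: "\<theta> \<in> omors (Rn m) (Rn n) \<Longrightarrow> strmap A m n \<theta> (basept A m) = basept A n"
  and strmap_id: "a \<in> points m \<Longrightarrow> strmap A m m (omor_id (Rn m)) a = a"
  and strmap_ocomp: "\<theta> \<in> omors (Rn m) (Rn n) \<Longrightarrow> \<phi> \<in> omors (Rn l) (Rn m) \<Longrightarrow> a \<in> points l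
    \<Longrightarrow> strmap A m n \<theta> (strmap A l m \<phi> a) = strmap A l n (ocomp (Rn l) \<theta> \<phi>) a"
  and gact_one: "a \<in> points m \<Longrightarrow> gact A \<one>\<^bsub>G\<^esub> m a = a"
  and gact_mult: "g \<in> carrier G \<Longrightarrow> h \<in> carrier G \<Longrightarrow> a \<in> points m
    \<Longrightarrow> gact A (g \<otimes>\<^bsub>G\<^esub> h) m a = gact A g m (gact A h m a)"
  and gact_basept: "g \<in> carrier G \<Longrightarrow> gact A g m (basept A m) = basept A m"
  and gact_strmap: "\<theta> \<in> omors (Rn m) (Rn n) \<Longrightarrow> g \<in> carrier G \<Longrightarrow> a \<in> points m
    \<Longrightarrow> gact A g n (strmap A m n \<theta> a) = strmap A m n \<theta> (gact A g m a)"
  using spectrum unfolding orthogonal_spectrum_def by simp_all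

lemma topspace_ev_pre [simp]: "topspace (ev_pre A V) = frames V \<times> points (dim V)"
  by (simp add: ev_pre_def)

lemma strmap_omat:
  assumes "fd_subspace V" "fd_subspace W" "fd_subspace U" "c \<in> frames U" "b \<in> frames W" "f \<in> frames V"
    "\<theta> \<in> omors W U" "\<phi> \<in> omors V W" "a \<in> points (dim V)"
  shows "strmap A (dim W) (dim U) (omat W U c \<theta> b) (strmap A (dim V) (dim W) (omat V W b \<phi> f) a)
    = strmap A (dim V) (dim U) (omat V U c (ocomp V \<theta> \<phi>) f) a"
  using assms omat_comp[OF assms(1-8)] by (simp add: strmap_ocomp omat_omors)

context
  fixes V :: "rseq set"
  assumes V: "fd_subspace V"
begin

private abbreviation "n \<equiv> dim V"

lemma ev_rel_subset: "ev_rel A V \<subseteq> topspace (ev_pre A V) \<times> topspace (ev_pre A V)"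
  using V by (auto simp: ev_rel_def Let_def basept_in isoms_compose subspace_Rn isom_omor_omors
      strmap_in)

text \<open>The coordinate of the point (f, a) in the frame b: writing f as b composed with the
  orthogonal map b^-1 f of \<real>^n, balancing moves that map onto a.\<close>

definition triv :: "(rseq \<Rightarrow> rseq) \<Rightarrow> (rseq \<Rightarrow> rseq) \<times> 'a \<Rightarrow> 'a" where
  "triv b = (\<lambda>(f, a). strmap A n n (omat V V b (omor_id V) f) a)"

lemma triv_self: "b \<in> frames V \<Longrightarrow> a \<in> points n \<Longrightarrow> triv b (b, a) = a"
  by (simp add: triv_def omat_id strmap_id V)

lemma omat_id_isom:
  assumes "b \<in> frames V" "f \<in> frames V"
  shows "omat V V b (omor_id V) f = isom_omor (compose (Rn n) (isom_inv n V b) f)"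
    "compose (Rn n) (isom_inv n V b) f \<in> isoms (Rn n) (Rn n)"
    "compose (Rn n) b (compose (Rn n) (isom_inv n V b) f) = f"
proof -
  have s: "subspace V" using V by (rule fd_subspace_imp_subspace)
  show "omat V V b (omor_id V) f = isom_omor (compose (Rn n) (isom_inv n V b) f)"
    unfolding omat_def
    using ocomp_id_left[OF frame_omors[OF V assms(2)]] ocomp_isom_omor[OF isom_inv(1)[OF V assms(1)] s] by simp
  show "compose (Rn n) (isom_inv n V b) f \<in> isoms (Rn n) (Rn n)"
    by (rule isoms_compose[OF isom_inv(1)[OF V assms(1)] assms(2) subspace_Rn])
  show "compose (Rn n) b (compose (Rn n) (isom_inv n V b) f) = f"
    using assms by (intro extensionalityI[of _ "Rn n"])
      (auto simp: compose_eq isomsD isom_inv(3)[OF V assms(1)])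
qed

lemma continuous_map_triv:
  assumes b: "b \<in> frames V"
  shows "continuous_map (ev_pre A V) (level A n) (triv b)"
proof -
  have c: "continuous_map (ev_pre A V) (isom_space (Rn n) V) fst"
    "continuous_map (ev_pre A V) (level A n) snd"
    unfolding ev_pre_def by (auto intro: continuous_map_fst continuous_map_snd)
  have bi: "isom_inv n V b \<in> isoms V (Rn n)" by (rule isom_inv(1)[OF V b])
  have "continuous_map (ev_pre A V) (omor_space (Rn n) (Rn n))
      (\<lambda>z. isom_omor (compose (Rn n) (isom_inv n V b) (fst z)))"
    using bi c(1) by (intro continuous_map_isom_omor continuous_map_isom_compose[where W = V])
      (auto simp: subspace_Rn fd_subspace_imp_subspace V)
  from continuous_map_strmap[OF this c(2)]
  show ?thesis
    by (rule continuous_map_eq) (auto simp: triv_def omat_id_isom b)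
qed

lemma triv_rel:
  assumes b: "b \<in> frames V" and "(x, y) \<in> ev_rel A V"
  shows "triv b x = triv b y"
  using assms(2) unfolding ev_rel_def Let_def
proof (elim UnE)
  assume "(x, y) \<in> {((compose (Rn n) f r, a), (f, strmap A n n (isom_omor r) a)) |f r a.
        f \<in> frames V \<and> r \<in> isoms (Rn n) (Rn n) \<and> a \<in> points n}"
  then obtain f r a where x: "x = (compose (Rn n) f r, a)" "y = (f, strmap A n n (isom_omor r) a)"
    and f: "f \<in> frames V" and r: "r \<in> isoms (Rn n) (Rn n)" and a: "a \<in> points n" by blast
  have fr: "compose (Rn n) f r \<in> frames V" by (rule isoms_compose[OF f r subspace_Rn])
  have ro: "isom_omor r \<in> omors (Rn n) (Rn n)" by (rule isom_omor_omors[OF r subspace_Rn])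
  have "compose (Rn n) (isom_inv n V b) (compose (Rn n) f r)
      = compose (Rn n) (compose (Rn n) (isom_inv n V b) f) r"
    using isomsD(1)[OF r] by (simp add: compose_def fun_eq_iff)
  then have "omat V V b (omor_id V) (compose (Rn n) f r)
      = ocomp (Rn n) (omat V V b (omor_id V) f) (isom_omor r)"
    using ocomp_isom_omor[OF omat_id_isom(2)[OF b f] subspace_Rn]
    by (simp add: omat_id_isom(1) b f fr)
  then show ?thesis
    using strmap_ocomp[OF omat_omors[OF V V b f omor_id_omors[OF V]] ro a] by (simp add: x triv_def)
next
  assume "(x, y) \<in> {((f, basept A n), (f', basept A n)) |f f'. f \<in> frames V \<and> f' \<in> frames V}"
  then show ?thesis
    by (auto simp: triv_def strmap_basept omat_omors V b omor_id_omors)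
qed

lemma ev_class_frame:
  assumes b: "b \<in> frames V" and f: "f \<in> frames V" and a: "a \<in> points n"
  shows "ev_class A V (f, a) = ev_class A V (b, triv b (f, a))"
  unfolding ev_class_def
proof (rule cgwh_class_rel[OF ev_rel_subset])
  let ?r = "compose (Rn n) (isom_inv n V b) f"
  have "((compose (Rn n) b ?r, a), (b, strmap A n n (isom_omor ?r) a)) \<in> ev_rel A V"
    using omat_id_isom(2)[OF b f] b a by (auto simp: ev_rel_def Let_def)
  then show "((f, a), (b, triv b (f, a))) \<in> ev_rel A V"
    using omat_id_isom[OF b f] by (simp add: triv_def)
qed

text \<open>The converse of balancing. The kernel of the quotient is not explicit, so the relation
  between two representatives is read off from \<open>triv f\<close>, which is constant on classes
  by the universal property.\<close>

lemma mem_ev_class: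
  assumes "(f', a') \<in> ev_class A V (f, a)"
  shows "f \<in> frames V" "a \<in> points n" "f' \<in> frames V" "a' \<in> points n"
    "a = strmap A n n (omat V V f (omor_id V) f') a'"
proof -
  note m = mem_cgwh_class[OF ev_rel_subset assms[unfolded ev_class_def]]
  show f: "f \<in> frames V" and a: "a \<in> points n" and "f' \<in> frames V" "a' \<in> points n" using m by auto
  have "triv f (f', a') = triv f (f, a)"
    by (rule cgwh_quotient_lift_unique[OF ev_rel_subset continuous_map_triv[OF f]
          CGWH_imp_weak_Hausdorff[OF level_CGWH] triv_rel[OF f]])
      (use assms in \<open>auto simp: ev_class_def\<close>)
  then show "a = strmap A n n (omat V V f (omor_id V) f') a'"
    using triv_self[OF f a] by (simp add: triv_def)
qed

lemma ev_class_self: "f \<in> frames V \<Longrightarrow> a \<in> points n \<Longrightarrow> (f, a) \<in> ev_class A V (f, a)"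
  unfolding ev_class_def by (rule cgwh_class_self[OF ev_rel_subset]) simp

lemma the_elem_ev_class:
  assumes f: "f \<in> frames V" and a: "a \<in> points n"
    and "\<And>f' a'. f' \<in> frames V \<Longrightarrow> a' \<in> points n \<Longrightarrow> a = strmap A n n (omat V V f (omor_id V) f') a'
      \<Longrightarrow> F (f', a') = c"
  shows "the_elem (F ` ev_class A V (f, a)) = c"
proof -
  have "F z = c" if "z \<in> ev_class A V (f, a)" for z
    using that assms(3) mem_ev_class[of "fst z" "snd z" f a] by (cases z) auto
  then have "F ` ev_class A V (f, a) = {c}" using ev_class_self[OF f a] by blast
  then show ?thesis by simp
qed

text \<open>The universal property applied to \<open>triv b\<close> gives the continuous inverse.
  Continuity of maps between evaluations can then be checked in one fixed frame.\<close>

lemma ev_frame_homeomorphic_map: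
  assumes b: "b \<in> frames V"
  shows "homeomorphic_maps (level A n) (ev_space A V) (\<lambda>a. ev_class A V (b, a)) (\<lambda>c. the_elem (triv b ` c))"
  unfolding homeomorphic_maps_def
proof (intro conjI ballI)
  have "continuous_map (level A n) (ev_pre A V) (\<lambda>a. (b, a))"
    using b unfolding ev_pre_def by (intro continuous_map_pairedI) auto
  from continuous_map_compose[OF this continuous_map_cgwh_class[OF ev_rel_subset]]
  show "continuous_map (level A n) (ev_space A V) (\<lambda>a. ev_class A V (b, a))"
    by (simp add: o_def ev_space_def ev_class_def)
  have t: "the_elem (triv b ` ev_class A V z) = triv b z" if "z \<in> topspace (ev_pre A V)" for z
    unfolding ev_class_def
    by (rule cgwh_quotient_lift[OF ev_rel_subset continuous_map_triv[OF b]
          CGWH_imp_weak_Hausdorff[OF level_CGWH] triv_rel[OF b] that])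
  show "continuous_map (ev_space A V) (level A n) (\<lambda>c. the_elem (triv b ` c))"
    unfolding ev_space_def
    by (rule continuous_map_from_cgwh_quotient[OF ev_rel_subset continuous_map_triv[OF b]])
      (use t in \<open>simp add: ev_class_def\<close>)
  show "the_elem (triv b ` ev_class A V (b, a)) = a" if "a \<in> points n" for a
    using t[of "(b, a)"] b that triv_self by simp
  show "ev_class A V (b, the_elem (triv b ` c)) = c" if "c \<in> topspace (ev_space A V)" for c
  proof -
    obtain f a where fa: "c = ev_class A V (f, a)" "f \<in> frames V" "a \<in> points n"
      using \<open>c \<in> topspace (ev_space A V)\<close> unfolding ev_space_def topspace_cgwh_quotient[OF ev_rel_subset]
      by (auto simp: ev_class_def)
    then show ?thesis using t[of "(f, a)"] ev_class_frame[OF b] by simp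
  qed
qed

lemma continuous_map_ev_class:
  "b \<in> frames V \<Longrightarrow> continuous_map Z (level A n) g \<Longrightarrow> continuous_map Z (ev_space A V) (\<lambda>z. ev_class A V (b, g z))"
  using continuous_map_compose[of Z "level A n" g "ev_space A V" "\<lambda>a. ev_class A V (b, a)"]
    ev_frame_homeomorphic_map[of b] by (simp add: homeomorphic_maps_def o_def)

lemma ev_class_in: "f \<in> frames V \<Longrightarrow> a \<in> points n \<Longrightarrow> ev_class A V (f, a) \<in> topspace (ev_space A V)"
  unfolding ev_space_def topspace_cgwh_quotient[OF ev_rel_subset] by (simp add: ev_class_def)

lemma ev_pointE:
  assumes "p \<in> topspace (ev_space A V)" "b \<in> frames V"
  obtains a where "a \<in> points n" "p = ev_class A V (b, a)"
  using ev_frame_homeomorphic_map[OF assms(2)] assms(1) that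
  unfolding homeomorphic_maps_def by (metis Pi_iff continuous_map_funspace)

lemma CGWH_ev_space: "CGWH_space (ev_space A V)"
proof -
  obtain b where b: "b \<in> frames V" using frames_nonempty[OF V] by blast
  have "homeomorphic_map (level A n) (ev_space A V) (\<lambda>a. ev_class A V (b, a))"
    using ev_frame_homeomorphic_map[OF b] homeomorphic_maps_map by blast
  then show ?thesis using CGWH_homeomorphic_map[OF level_CGWH] by blast
qed

lemma ev_base_eq:
  assumes f: "f \<in> frames V"
  shows "ev_base A V = ev_class A V (f, basept A n)"
proof -
  have "ev_class A V (f', basept A n) = ev_class A V (f, basept A n)" if "f' \<in> frames V" for f'
    using ev_class_frame[OF f that basept_in] that f
    by (simp add: triv_def strmap_basept omat_omors omor_id_omors V)
  then have "(\<lambda>f. ev_class A V (f, basept A n)) ` frames V = {ev_class A V (f, basept A n)}" using f by blast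
  then show ?thesis by (simp add: ev_base_def)
qed

lemma ev_base_in: "ev_base A V \<in> topspace (ev_space A V)"
  using frames_nonempty[OF V] ev_base_eq ev_class_in basept_in by (metis ex_in_conv)

end

text \<open>The value is independent of both choices: changing the target frame multiplies the
  matrix on the left by a matrix of the identity, changing the representative does so on the right,
  and multiplicativity of matrices absorbs both.\<close>

lemma ev_map_class:
  assumes V: "fd_subspace V" and W: "fd_subspace W" and \<phi>: "\<phi> \<in> omors V W"
    and f: "f \<in> frames V" and a: "a \<in> points (dim V)" and b: "b \<in> frames W"
  shows "ev_map A V W \<phi> (ev_class A V (f, a))
    = ev_class A W (b, strmap A (dim V) (dim W) (omat V W b \<phi> f) a)"
proof -
  let ?F = "\<lambda>(b, f, a). ev_class A W (b, strmap A (dim V) (dim W) (omat V W b \<phi> f) a)"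
  let ?c = "ev_class A W (b, strmap A (dim V) (dim W) (omat V W b \<phi> f) a)"
  have "?F (b', f', a') = ?c"
    if b': "b' \<in> frames W" and fa': "(f', a') \<in> ev_class A V (f, a)" for b' f' a'
  proof -
    note m = mem_ev_class[OF V fa']
    have "?F (b', f', a') = ev_class A W (b, triv W b (b', strmap A (dim V) (dim W) (omat V W b' \<phi> f') a'))"
      using ev_class_frame[OF W b b'] strmap_in omat_omors[OF V W b' m(3) \<phi>] m(4) by simp
    also have "triv W b (b', strmap A (dim V) (dim W) (omat V W b' \<phi> f') a')
        = strmap A (dim V) (dim W) (omat V W b \<phi> f') a'"
      using strmap_omat[OF V W W b b' m(3) omor_id_omors[OF W] \<phi> m(4)] ocomp_id_left[OF \<phi>]
      by (simp add: triv_def[OF W])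
    also have "\<dots> = strmap A (dim V) (dim W) (omat V W b \<phi> f) a"
      using strmap_omat[OF V V W b f m(3) \<phi> omor_id_omors[OF V] m(4)] m(5)
        ocomp_id_right[OF \<phi> fd_subspace_imp_subspace[OF V]] by simp
    finally show ?thesis .
  qed
  then have "?F z = ?c" if "z \<in> frames W \<times> ev_class A V (f, a)" for z
    using that by (cases z) blast
  moreover have "(b, f, a) \<in> frames W \<times> ev_class A V (f, a)" using ev_class_self[OF V f a] b by simp
  ultimately have "?F ` (frames W \<times> ev_class A V (f, a)) = {?c}" by blast
  then show ?thesis by (simp add: ev_map_def Let_def omat_def isom_inv_def)
qed

lemma continuous_map_ev_map:
  assumes V: "fd_subspace V" and W: "fd_subspace W" and \<phi>: "\<phi> \<in> omors V W"
  shows "continuous_map (ev_space A V) (ev_space A W) (ev_map A V W \<phi>)"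
proof -
  obtain f b where f: "f \<in> frames V" and b: "b \<in> frames W" using frames_nonempty[OF V] frames_nonempty[OF W] by auto
  let ?i = "\<lambda>c. the_elem (triv V f ` c)"
  note h = ev_frame_homeomorphic_map[OF V f, unfolded homeomorphic_maps_def]
  have "continuous_map (ev_space A V) (ev_space A W)
      (\<lambda>p. ev_class A W (b, strmap A (dim V) (dim W) (omat V W b \<phi> f) (?i p)))"
    using h by (intro continuous_map_ev_class[OF W b] continuous_map_strmap)
      (auto simp: omat_omors[OF V W b f \<phi>])
  then show ?thesis
    by (rule continuous_map_eq)
      (use h ev_map_class[OF V W \<phi> f _ b] in \<open>metis (no_types, lifting) Pi_iff continuous_map_funspace\<close>)
qed

lemma ev_map_in:
  "fd_subspace V \<Longrightarrow> fd_subspace W \<Longrightarrow> \<phi> \<in> omors V W \<Longrightarrow> p \<in> topspace (ev_space A V)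
    \<Longrightarrow> ev_map A V W \<phi> p \<in> topspace (ev_space A W)"
  using continuous_map_ev_map continuous_map_funspace by (metis Pi_iff)

lemma ev_map_comp:
  assumes V: "fd_subspace V" and W: "fd_subspace W" and U: "fd_subspace U"
    and \<theta>: "\<theta> \<in> omors W U" and \<phi>: "\<phi> \<in> omors V W" and p: "p \<in> topspace (ev_space A V)"
  shows "ev_map A W U \<theta> (ev_map A V W \<phi> p) = ev_map A V U (ocomp V \<theta> \<phi>) p"
proof -
  obtain f b c where f: "f \<in> frames V" and b: "b \<in> frames W" and c: "c \<in> frames U"
    using frames_nonempty[OF V] frames_nonempty[OF W] frames_nonempty[OF U] by auto
  obtain a where a: "a \<in> points (dim V)" "p = ev_class A V (f, a)" by (rule ev_pointE[OF V p f])
  have "ocomp V \<theta> \<phi> \<in> omors V U" using ocomp_omors[OF \<theta> \<phi>] V U by (simp add: fd_subspace_imp_subspace)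
  moreover have "strmap A (dim V) (dim W) (omat V W b \<phi> f) a \<in> points (dim W)"
    using strmap_in omat_omors[OF V W b f \<phi>] a by blast
  ultimately show ?thesis
    using ev_map_class[OF V W \<phi> f a(1) b] ev_map_class[OF W U \<theta> b _ c] ev_map_class[OF V U _ f a(1) c]
      strmap_omat[OF V W U c b f \<theta> \<phi> a(1)] by (simp add: a(2))
qed

lemma ev_map_base:
  assumes V: "fd_subspace V" and W: "fd_subspace W" and \<phi>: "\<phi> \<in> omors V W"
  shows "ev_map A V W \<phi> (ev_base A V) = ev_base A W"
proof -
  obtain f b where f: "f \<in> frames V" and b: "b \<in> frames W" using frames_nonempty[OF V] frames_nonempty[OF W] by auto
  show ?thesis
    using ev_map_class[OF V W \<phi> f basept_in b] omat_omors[OF V W b f \<phi>]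
    by (simp add: ev_base_eq[OF V f] ev_base_eq[OF W b] strmap_basept)
qed

lemma ev_map_None:
  assumes V: "fd_subspace V" and W: "fd_subspace W" and p: "p \<in> topspace (ev_space A V)"
  shows "ev_map A V W None p = ev_base A W"
proof -
  obtain f b where f: "f \<in> frames V" and b: "b \<in> frames W" using frames_nonempty[OF V] frames_nonempty[OF W] by auto
  obtain a where a: "a \<in> points (dim V)" "p = ev_class A V (f, a)" by (rule ev_pointE[OF V p f])
  then show ?thesis
    using ev_map_class[OF V W omors_iff(2) f a(1) b] by (simp add: ev_base_eq[OF W b] strmap_None)
qed

section \<open>Representations and the diagonal action on evaluations\<close>

lemma rep_fd: "orthogonal_rep G T V \<Longrightarrow> fd_subspace (fst V)"
  and rep_isom: "orthogonal_rep G T V \<Longrightarrow> g \<in> carrier G \<Longrightarrow> snd V g \<in> isoms (fst V) (fst V)"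
  and rep_one: "orthogonal_rep G T V \<Longrightarrow> v \<in> fst V \<Longrightarrow> snd V \<one>\<^bsub>G\<^esub> v = v"
  and rep_mult: "orthogonal_rep G T V \<Longrightarrow> g \<in> carrier G \<Longrightarrow> h \<in> carrier G \<Longrightarrow> v \<in> fst V
    \<Longrightarrow> snd V (g \<otimes>\<^bsub>G\<^esub> h) v = snd V g (snd V h v)"
  by (auto simp: orthogonal_rep_def case_prod_beta)

lemma rep_inv:
  assumes "orthogonal_rep G T V" "g \<in> carrier G" "v \<in> fst V"
  shows "snd V g (snd V (inv\<^bsub>G\<^esub> g) v) = v" "snd V (inv\<^bsub>G\<^esub> g) (snd V g v) = v"
  using rep_mult[OF assms(1) _ _ assms(3), of g "inv\<^bsub>G\<^esub> g"] rep_mult[OF assms(1) _ _ assms(3), of "inv\<^bsub>G\<^esub> g" g]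
    rep_one[OF assms(1,3)] assms(2) by simp_all

lemma continuous_map_rep:
  assumes V: "orthogonal_rep G T V"
  shows "continuous_map T (isom_space (fst V) (fst V)) (snd V)"
  unfolding continuous_map_isom_space
proof (intro conjI ballI)
  show "snd V g \<in> isoms (fst V) (fst V)" if "g \<in> topspace T" for g
    using rep_isom[OF V] that topspace_T by simp
  fix v assume v: "v \<in> fst V"
  have "continuous_map (prod_topology T (top_of_set (fst V))) (top_of_set (fst V)) (\<lambda>(g, v). snd V g v)"
    using V by (simp add: orthogonal_rep_def case_prod_beta)
  moreover have "continuous_map T (prod_topology T (top_of_set (fst V))) (\<lambda>g. (g, v))"
    using v by (intro continuous_map_pairedI) auto
  ultimately have "continuous_map T (top_of_set (fst V)) (\<lambda>g. snd V g v)"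
    using continuous_map_compose[of T _ "\<lambda>g. (g, v)" _ "\<lambda>(g, v). snd V g v"] by (simp add: o_def)
  then show "continuous_map T euclidean (\<lambda>g. snd V g v)"
    by (simp add: continuous_map_in_subtopology)
qed

lemma rep_omors: "orthogonal_rep G T V \<Longrightarrow> g \<in> carrier G \<Longrightarrow> isom_omor (snd V g) \<in> omors (fst V) (fst V)"
  by (simp add: isom_omor_omors rep_isom rep_fd fd_subspace_imp_subspace)

text \<open>In the frame b the diagonal action is the action on the level followed by the matrix of
  g. It does not depend on the representative because the action on levels commutes with structure
  maps.\<close>

lemma ev_act_class:
  assumes V: "orthogonal_rep G T V" and g: "g \<in> carrier G"
    and f: "f \<in> frames (fst V)" and a: "a \<in> points (dim (fst V))" and b: "b \<in> frames (fst V)"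
  shows "ev_act A V g (ev_class A (fst V) (f, a)) = ev_class A (fst V)
    (b, strmap A (dim (fst V)) (dim (fst V)) (omat (fst V) (fst V) b (isom_omor (snd V g)) f)
      (gact A g (dim (fst V)) a))"
  unfolding ev_act_def Let_def
proof (rule the_elem_ev_class[OF rep_fd[OF V] f a], unfold prod.case)
  let ?V = "fst V" let ?n = "dim ?V"
  note fd = rep_fd[OF V]
  fix f' a' assume f': "f' \<in> frames ?V" and a': "a' \<in> points ?n"
    and eq: "a = strmap A ?n ?n (omat ?V ?V f (omor_id ?V) f') a'"
  have gf': "compose (Rn ?n) (snd V g) f' \<in> frames ?V"
    by (rule isoms_compose[OF rep_isom[OF V g] f' subspace_Rn])
  have ga': "gact A g ?n a' \<in> points ?n" using gact_in g a' by blast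
  have id: "omor_id ?V \<in> omors ?V ?V" by (rule omor_id_omors[OF fd])
  have "ev_class A ?V (compose (Rn ?n) (snd V g) f', gact A g ?n a')
    = ev_class A ?V (b, strmap A ?n ?n (omat ?V ?V b (isom_omor (snd V g)) f') (gact A g ?n a'))"
    using ev_class_frame[OF fd b gf' ga'] omat_frame_change[OF fd b f' rep_isom[OF V g]]
    by (simp add: triv_def[OF fd])
  also have "strmap A ?n ?n (omat ?V ?V b (isom_omor (snd V g)) f') (gact A g ?n a')
    = strmap A ?n ?n (omat ?V ?V b (isom_omor (snd V g)) f) (gact A g ?n a)"
    using strmap_omat[OF fd fd fd b f f' rep_omors[OF V g] id ga']
      ocomp_id_right[OF rep_omors[OF V g] fd_subspace_imp_subspace[OF fd]]
      gact_strmap[OF omat_omors[OF fd fd f f' id] g a'] eq by simp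
  finally show "ev_class A ?V (compose (Rn ?n) (snd V g) f', gact A g ?n a')
    = ev_class A ?V (b, strmap A ?n ?n (omat ?V ?V b (isom_omor (snd V g)) f) (gact A g ?n a))" .
qed

lemma continuous_map_ev_act:
  assumes V: "orthogonal_rep G T V" and F: "continuous_map Z T F"
    and P: "continuous_map Z (ev_space A (fst V)) P"
  shows "continuous_map Z (ev_space A (fst V)) (\<lambda>z. ev_act A V (F z) (P z))"
proof -
  let ?V = "fst V" let ?n = "dim ?V"
  note fd = rep_fd[OF V]
  obtain b where b: "b \<in> frames ?V" using frames_nonempty[OF fd] by auto
  let ?i = "\<lambda>c. the_elem (triv ?V b ` c)"
  note h = ev_frame_homeomorphic_map[OF fd b, unfolded homeomorphic_maps_def]
  have i: "continuous_map Z (level A ?n) (\<lambda>z. ?i (P z))"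
    using continuous_map_compose[OF P, of "level A ?n" ?i] h by (simp add: o_def)
  have "continuous_map Z (isom_space ?V ?V) (\<lambda>z. snd V (F z))"
    using continuous_map_compose[OF F continuous_map_rep[OF V]] by (simp add: o_def)
  then have "continuous_map Z (ev_space A ?V) (\<lambda>z. ev_class A ?V
      (b, strmap A ?n ?n (omat ?V ?V b (isom_omor (snd V (F z))) b) (gact A (F z) ?n (?i (P z)))))"
    by (intro continuous_map_ev_class[OF fd b] continuous_map_strmap continuous_map_gact F i
        continuous_map_omat[OF fd fd b b] continuous_map_isom_omor fd_subspace_imp_subspace[OF fd])
  then show ?thesis
  proof (rule continuous_map_eq)
    fix z assume z: "z \<in> topspace Z"
    then have Fz: "F z \<in> carrier G" and Pz: "P z \<in> topspace (ev_space A ?V)"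
      using F P topspace_T continuous_map_funspace by fastforce+
    have iz: "?i (P z) \<in> points ?n" using i z continuous_map_funspace by fastforce
    have Pe: "ev_class A ?V (b, ?i (P z)) = P z" using h Pz by blast
    show "ev_class A ?V (b, strmap A ?n ?n (omat ?V ?V b (isom_omor (snd V (F z))) b)
        (gact A (F z) ?n (?i (P z)))) = ev_act A V (F z) (P z)"
      using ev_act_class[OF V Fz b iz b] Pe by simp
  qed
qed

lemma continuous_map_ev_act_fixed:
  assumes V: "orthogonal_rep G T V" and g: "g \<in> carrier G"
  shows "continuous_map (ev_space A (fst V)) (ev_space A (fst V)) (ev_act A V g)"
  using continuous_map_ev_act[OF V _ continuous_map_id, of "\<lambda>_. g"] g topspace_T by simp

lemma ev_act_in:
  assumes V: "orthogonal_rep G T V" and g: "g \<in> carrier G" and p: "p \<in> topspace (ev_space A (fst V))"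
  shows "ev_act A V g p \<in> topspace (ev_space A (fst V))"
  using continuous_map_funspace[OF continuous_map_ev_act_fixed[OF V g]] p by blast

lemma ev_act_one:
  assumes V: "orthogonal_rep G T V" and p: "p \<in> topspace (ev_space A (fst V))"
  shows "ev_act A V \<one>\<^bsub>G\<^esub> p = p"
proof -
  let ?V = "fst V"
  note fd = rep_fd[OF V]
  obtain f where f: "f \<in> frames ?V" using frames_nonempty[OF fd] by auto
  obtain a where a: "a \<in> points (dim ?V)" "p = ev_class A ?V (f, a)" by (rule ev_pointE[OF fd p f])
  have "snd V \<one>\<^bsub>G\<^esub> = (\<lambda>x\<in>?V. x)"
    by (rule isoms_ext[OF rep_isom[OF V one_closed] isoms_id[OF subset_refl fd_subspace_imp_subspace[OF fd]]])
      (simp add: rep_one[OF V])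
  then show ?thesis
    using ev_act_class[OF V one_closed f a(1) f] a
    by (simp add: omat_id[OF fd f] strmap_id gact_one)
qed

text \<open>\<open>gact_strmap\<close> moves the action of g past the matrix of h; then the matrices
  and the actions on the level multiply separately.\<close>

lemma ev_act_mult:
  assumes V: "orthogonal_rep G T V" and g: "g \<in> carrier G" and h: "h \<in> carrier G"
    and p: "p \<in> topspace (ev_space A (fst V))"
  shows "ev_act A V (g \<otimes>\<^bsub>G\<^esub> h) p = ev_act A V g (ev_act A V h p)"
proof -
  let ?V = "fst V" let ?n = "dim ?V"
  note fd = rep_fd[OF V]
  obtain f where f: "f \<in> frames ?V" using frames_nonempty[OF fd] by auto
  obtain a where a: "a \<in> points ?n" "p = ev_class A ?V (f, a)" by (rule ev_pointE[OF fd p f])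
  let ?g = "isom_omor (snd V g)" and ?h = "isom_omor (snd V h)"
  note go = rep_omors[OF V g] and ho = rep_omors[OF V h]
  have Mh: "omat ?V ?V f ?h f \<in> omors (Rn ?n) (Rn ?n)" by (rule omat_omors[OF fd fd f f ho])
  have gh: "isom_omor (snd V (g \<otimes>\<^bsub>G\<^esub> h)) = ocomp ?V ?g ?h"
  proof -
    have "snd V (g \<otimes>\<^bsub>G\<^esub> h) = compose ?V (snd V g) (snd V h)"
      by (rule isoms_ext[OF rep_isom[OF V] isoms_compose[OF rep_isom[OF V g] rep_isom[OF V h]]])
        (auto simp: g h fd_subspace_imp_subspace[OF fd] compose_eq rep_mult[OF V])
    then show ?thesis
      using ocomp_isom_omor[OF rep_isom[OF V g] fd_subspace_imp_subspace[OF fd]] by simp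
  qed
  have pts: "gact A h ?n a \<in> points ?n" "gact A g ?n (gact A h ?n a) \<in> points ?n"
    "strmap A ?n ?n (omat ?V ?V f ?h f) (gact A h ?n a) \<in> points ?n"
    using gact_in g h a strmap_in[OF Mh] by auto
  show ?thesis
    using ev_act_class[OF V m_closed[OF g h] f a(1) f] ev_act_class[OF V h f a(1) f]
      ev_act_class[OF V g f pts(3) f] gact_strmap[OF Mh g pts(1)]
      strmap_omat[OF fd fd fd f f f go ho pts(2)] gh gact_mult[OF g h a(1)] a(2) by simp
qed

lemma ev_act_base:
  assumes V: "orthogonal_rep G T V" and g: "g \<in> carrier G"
  shows "ev_act A V g (ev_base A (fst V)) = ev_base A (fst V)"
proof -
  note fd = rep_fd[OF V]
  obtain f where f: "f \<in> frames (fst V)" using frames_nonempty[OF fd] by auto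
  show ?thesis
    using ev_act_class[OF V g f basept_in f] omat_omors[OF fd fd f f rep_omors[OF V g]] g
    by (simp add: ev_base_eq[OF fd f] gact_basept strmap_basept)
qed

lemma omor_conj_eq:
  assumes V: "orthogonal_rep G T V" and W: "orthogonal_rep G T W" and g: "g \<in> carrier G"
    and \<phi>: "\<phi> \<in> omors (fst V) (fst W)"
  shows "omor_conj G V W g \<phi> = ocomp (fst V) (isom_omor (snd W g))
    (ocomp (fst V) \<phi> (isom_omor (snd V (inv\<^bsub>G\<^esub> g))))"
  using \<phi>
proof (cases rule: omorsE)
  case (2 f x)
  have "f 0 = 0" using isoms_zero[OF 2(2)] rep_fd[OF V] fd_subspace_imp_subspace by blast
  then show ?thesis using 2 by (simp add: omor_conj_def isom_omor_def compose_def fun_eq_iff)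
qed (simp add: omor_conj_def)

lemma omor_conj_omors:
  assumes V: "orthogonal_rep G T V" and W: "orthogonal_rep G T W" and g: "g \<in> carrier G"
    and \<phi>: "\<phi> \<in> omors (fst V) (fst W)"
  shows "omor_conj G V W g \<phi> \<in> omors (fst V) (fst W)"
  unfolding omor_conj_eq[OF assms]
  using rep_fd[OF V] rep_fd[OF W] g
  by (intro ocomp_omors[OF rep_omors[OF W g]] ocomp_omors[OF \<phi> rep_omors[OF V]])
    (auto simp: fd_subspace_imp_subspace)

text \<open>The conjugate of \<phi> followed after g on V equals g on W after \<phi>; the claim is
  this identity under functoriality. For conjugation invariant \<phi> it shows that fixed points go
  to fixed points.\<close>

lemma ev_act_ev_map:
  assumes V: "orthogonal_rep G T V" and W: "orthogonal_rep G T W" and g: "g \<in> carrier G"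
    and \<phi>: "\<phi> \<in> omors (fst V) (fst W)" and p: "p \<in> topspace (ev_space A (fst V))"
  shows "ev_act A W g (ev_map A (fst V) (fst W) \<phi> p)
    = ev_map A (fst V) (fst W) (omor_conj G V W g \<phi>) (ev_act A V g p)"
proof -
  let ?V = "fst V" and ?W = "fst W" let ?n = "dim ?V" and ?m = "dim ?W"
  note V' = rep_fd[OF V] and W' = rep_fd[OF W]
  note sV = fd_subspace_imp_subspace[OF V']
  obtain f b where f: "f \<in> frames ?V" and b: "b \<in> frames ?W" using frames_nonempty[OF V'] frames_nonempty[OF W'] by auto
  obtain a where a: "a \<in> points ?n" "p = ev_class A ?V (f, a)" by (rule ev_pointE[OF V' p f])
  let ?gW = "isom_omor (snd W g)" and ?gV = "isom_omor (snd V g)" and ?gi = "isom_omor (snd V (inv\<^bsub>G\<^esub> g))"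
  let ?c = "omor_conj G V W g \<phi>"
  note gW = rep_omors[OF W g] and gV = rep_omors[OF V g] and gi = rep_omors[OF V inv_closed[OF g]]
  note c = omor_conj_omors[OF V W g \<phi>]
  have "compose ?V (snd V (inv\<^bsub>G\<^esub> g)) (snd V g) = (\<lambda>x\<in>?V. x)"
    by (intro extensionalityI[of _ ?V]) (auto simp: compose_eq rep_inv[OF V g])
  then have inv: "ocomp ?V ?gi ?gV = omor_id ?V"
    using ocomp_isom_omor[OF rep_isom[OF V inv_closed[OF g]] sV] by simp
  have \<phi>gi: "ocomp ?V \<phi> ?gi \<in> omors ?V ?W" using ocomp_omors[OF \<phi> gi] sV W' fd_subspace_imp_subspace by blast
  have cg: "ocomp ?V ?c ?gV = ocomp ?V ?gW \<phi>"
    unfolding omor_conj_eq[OF V W g \<phi>]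
    using ocomp_assoc[OF gW \<phi>gi gV sV] ocomp_assoc[OF \<phi> gi gV sV] inv ocomp_id_right[OF \<phi> sV] by simp
  have M: "omat ?V ?W b \<phi> f \<in> omors (Rn ?n) (Rn ?m)" "omat ?V ?V f ?gV f \<in> omors (Rn ?n) (Rn ?n)"
    using omat_omors[OF V' W' b f \<phi>] omat_omors[OF V' V' f f gV] by auto
  have pts: "gact A g ?n a \<in> points ?n" "strmap A ?n ?m (omat ?V ?W b \<phi> f) a \<in> points ?m"
    "strmap A ?n ?n (omat ?V ?V f ?gV f) (gact A g ?n a) \<in> points ?n"
    using gact_in g a strmap_in M by auto
  show ?thesis
    using ev_map_class[OF V' W' \<phi> f a(1) b] ev_act_class[OF W g b pts(2) b]
      ev_act_class[OF V g f a(1) f] ev_map_class[OF V' W' c f pts(3) b]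
      gact_strmap[OF M(1) g a(1)] strmap_omat[OF V' W' W' b b f gW \<phi> pts(1)]
      strmap_omat[OF V' V' W' b f f c gV pts(1)] cg a(2) by simp
qed

end

section \<open>Evaluation of morphisms of spectra\<close>

lemma ev_hom_class:
  assumes "topological_group G T" and h: "spectrum_hom G T A B h" and V: "fd_subspace V"
    and f: "f \<in> frames V" and a: "a \<in> topspace (level A (dim V))"
  shows "ev_hom B h V (ev_class A V (f, a)) = ev_class B V (f, h (dim V) a)"
proof -
  interpret A: group_spectrum G T A using assms(1) h by unfold_locales (auto simp: spectrum_hom_def)
  interpret B: group_spectrum G T B using assms(1) h by unfold_locales (auto simp: spectrum_hom_def)
  let ?n = "dim V"
  have hB: "h ?n x \<in> B.points ?n" if "x \<in> A.points ?n" for x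
    using h that continuous_map_funspace unfolding spectrum_hom_def by blast
  show ?thesis
    unfolding ev_hom_def
  proof (rule A.the_elem_ev_class[OF V f a], unfold prod.case)
    fix f' a' assume f': "f' \<in> frames V" and a': "a' \<in> A.points ?n"
      and eq: "a = strmap A ?n ?n (omat V V f (omor_id V) f') a'"
    have "omat V V f (omor_id V) f' \<in> omors (Rn ?n) (Rn ?n)"
      by (rule omat_omors[OF V V f f' omor_id_omors[OF V]])
    then have "h ?n a = strmap B ?n ?n (omat V V f (omor_id V) f') (h ?n a')"
      using h a' eq unfolding spectrum_hom_def by simp
    then show "ev_class B V (f', h ?n a') = ev_class B V (f, h ?n a)"
      using B.ev_class_frame[OF V f f' hB[OF a']] by (simp add: B.triv_def[OF V])
  qed
qed

context
  fixes G :: "'g monoid" and T and A :: "('g, 'a) gspectrum" and B :: "('g, 'b) gspectrum" and h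
  assumes tg: "topological_group G T" and h: "spectrum_hom G T A B h"
begin

interpretation A: group_spectrum G T A using tg h by unfold_locales (auto simp: spectrum_hom_def)
interpretation B: group_spectrum G T B using tg h by unfold_locales (auto simp: spectrum_hom_def)

lemma spectrum_hom_in: "a \<in> topspace (level A m) \<Longrightarrow> h m a \<in> topspace (level B m)"
  and spectrum_hom_basept: "h m (basept A m) = basept B m"
  and spectrum_hom_strmap: "\<theta> \<in> omors (Rn m) (Rn n) \<Longrightarrow> a \<in> topspace (level A m)
    \<Longrightarrow> h n (strmap A m n \<theta> a) = strmap B m n \<theta> (h m a)"
  and spectrum_hom_gact: "g \<in> carrier G \<Longrightarrow> a \<in> topspace (level A m)
    \<Longrightarrow> h m (gact A g m a) = gact B g m (h m a)"
  using h unfolding spectrum_hom_def by (auto simp: continuous_map_def)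

lemma continuous_map_ev_hom:
  assumes V: "fd_subspace V"
  shows "continuous_map (ev_space A V) (ev_space B V) (ev_hom B h V)"
proof -
  obtain f where f: "f \<in> frames V" using frames_nonempty[OF V] by auto
  let ?i = "\<lambda>c. the_elem (A.triv V f ` c)"
  note H = A.ev_frame_homeomorphic_map[OF V f, unfolded homeomorphic_maps_def]
  have i: "continuous_map (ev_space A V) (level A (dim V)) ?i" using H by blast
  have "continuous_map (level A (dim V)) (level B (dim V)) (h (dim V))"
    using h by (simp add: spectrum_hom_def)
  from continuous_map_compose[OF i this]
  have "continuous_map (ev_space A V) (ev_space B V) (\<lambda>p. ev_class B V (f, h (dim V) (?i p)))"
    by (intro B.continuous_map_ev_class[OF V f]) (simp add: o_def)
  then show ?thesis
  proof (rule continuous_map_eq)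
    fix p assume p: "p \<in> topspace (ev_space A V)"
    then have "?i p \<in> A.points (dim V)" using continuous_map_funspace[OF i] by blast
    moreover have "ev_class A V (f, ?i p) = p" using H p by blast
    ultimately show "ev_class B V (f, h (dim V) (?i p)) = ev_hom B h V p"
      using ev_hom_class[OF tg h V f, of "?i p"] by simp
  qed
qed

lemma ev_hom_in:
  assumes "fd_subspace V" "p \<in> topspace (ev_space A V)"
  shows "ev_hom B h V p \<in> topspace (ev_space B V)"
  using continuous_map_funspace[OF continuous_map_ev_hom[OF assms(1)]] assms(2) by blast

lemma ev_hom_base:
  assumes V: "fd_subspace V"
  shows "ev_hom B h V (ev_base A V) = ev_base B V"
proof -
  obtain f where f: "f \<in> frames V" using frames_nonempty[OF V] by auto
  show ?thesis
    using ev_hom_class[OF tg h V f A.basept_in]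
    by (simp add: A.ev_base_eq[OF V f] B.ev_base_eq[OF V f] spectrum_hom_basept)
qed

lemma ev_hom_ev_map:
  assumes V: "fd_subspace V" and W: "fd_subspace W" and \<phi>: "\<phi> \<in> omors V W"
    and p: "p \<in> topspace (ev_space A V)"
  shows "ev_hom B h W (ev_map A V W \<phi> p) = ev_map B V W \<phi> (ev_hom B h V p)"
proof -
  obtain f b where f: "f \<in> frames V" and b: "b \<in> frames W" using frames_nonempty[OF V] frames_nonempty[OF W] by auto
  obtain a where a: "a \<in> A.points (dim V)" "p = ev_class A V (f, a)" by (rule A.ev_pointE[OF V p f])
  note M = omat_omors[OF V W b f \<phi>]
  show ?thesis
    using A.ev_map_class[OF V W \<phi> f a(1) b] ev_hom_class[OF tg h W b A.strmap_in[OF M a(1)]]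
      ev_hom_class[OF tg h V f a(1)] B.ev_map_class[OF V W \<phi> f spectrum_hom_in[OF a(1)] b]
      spectrum_hom_strmap[OF M a(1)] a(2) by simp
qed

lemma ev_hom_ev_act:
  assumes V: "orthogonal_rep G T V" and g: "g \<in> carrier G" and p: "p \<in> topspace (ev_space A (fst V))"
  shows "ev_hom B h (fst V) (ev_act A V g p) = ev_act B V g (ev_hom B h (fst V) p)"
proof -
  note fd = A.rep_fd[OF V]
  obtain f where f: "f \<in> frames (fst V)" using frames_nonempty[OF fd] by auto
  obtain a where a: "a \<in> A.points (dim (fst V))" "p = ev_class A (fst V) (f, a)"
    by (rule A.ev_pointE[OF fd p f])
  note M = omat_omors[OF fd fd f f A.rep_omors[OF V g]]
  note ga = A.gact_in[OF g a(1)]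
  show ?thesis
    using A.ev_act_class[OF V g f a(1) f] ev_hom_class[OF tg h fd f A.strmap_in[OF M ga]]
      ev_hom_class[OF tg h fd f a(1)] B.ev_act_class[OF V g f spectrum_hom_in[OF a(1)] f]
      spectrum_hom_strmap[OF M ga] spectrum_hom_gact[OF g a(1)] a(2) by simp
qed

end

section \<open>Geometric fixed points form a spectrum\<close>

lemma image_eq_singleton: "(\<And>x. x \<in> S \<Longrightarrow> F x = c) \<Longrightarrow> y \<in> S \<Longrightarrow> F ` S = {c}"
  by auto

locale geometric_fixed_points = group_spectrum G T A
  for G :: "'g monoid" and T :: "'g topology" and A :: "('g, 'a) gspectrum" +
  fixes N :: "'g set"
  assumes compact_T: "compact_space T" and Hausdorff_T: "Hausdorff_space T" and normal_N: "N \<lhd> G"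
begin

lemma subgroup_N: "subgroup N G"
  using normal_N by (rule normal_imp_subgroup)

lemma N_carrier: "n \<in> N \<Longrightarrow> n \<in> carrier G"
  using subgroup_N subgroup.mem_carrier by fast

text \<open>Normality enters in this form. Applied to N-fixed vectors, N-fixed points and N-linear
  maps it shows that all three are preserved by every element of G.\<close>

lemma normal_swap:
  assumes "n \<in> N" "g \<in> carrier G"
  obtains n' where "n' \<in> N" "n \<otimes>\<^bsub>G\<^esub> g = g \<otimes>\<^bsub>G\<^esub> n'"
proof -
  have "inv\<^bsub>G\<^esub> g \<otimes>\<^bsub>G\<^esub> n \<otimes>\<^bsub>G\<^esub> g \<in> N"
    using normal.inv_op_closed1[OF normal_N assms(2,1)] .
  moreover have "n \<otimes>\<^bsub>G\<^esub> g = g \<otimes>\<^bsub>G\<^esub> (inv\<^bsub>G\<^esub> g \<otimes>\<^bsub>G\<^esub> n \<otimes>\<^bsub>G\<^esub> g)"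
    using assms N_carrier by (simp add: m_assoc[symmetric])
  ultimately show ?thesis using that by blast
qed

abbreviation is_rep :: "'g rep \<Rightarrow> bool" where
  "is_rep W \<equiv> orthogonal_rep G T W"

abbreviation fx :: "'g rep \<Rightarrow> rseq set" where
  "fx W \<equiv> fixed_space N W"

lemma fixed_spaceD: "v \<in> fx W \<Longrightarrow> v \<in> fst W" "v \<in> fx W \<Longrightarrow> n \<in> N \<Longrightarrow> snd W n v = v"
  by (auto simp: fixed_space_def)

lemma fd_fixed_space:
  assumes W: "is_rep W"
  shows "fd_subspace (fx W)"
proof (rule fd_subspace_subset[OF _ _ rep_fd[OF W]])
  have s: "subspace (fst W)" using rep_fd[OF W] by (rule fd_subspace_imp_subspace)
  have i: "snd W n \<in> isoms (fst W) (fst W)" if "n \<in> N" for n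
    using rep_isom[OF W] that N_carrier by blast
  show "subspace (fx W)"
    by (rule subspaceI)
      (auto simp: fixed_space_def subspace_0 subspace_add subspace_scale s isoms_zero[OF i s]
        isomsD(2,3)[OF i])
qed (auto simp: fixed_space_def)

lemma subspace_fixed_space: "is_rep W \<Longrightarrow> subspace (fx W)"
  by (simp add: fd_fixed_space fd_subspace_imp_subspace)

lemma rep_fixed_space:
  assumes W: "is_rep W" and g: "g \<in> carrier G" and v: "v \<in> fx W"
  shows "snd W g v \<in> fx W"
  unfolding fixed_space_def
proof (intro CollectI conjI ballI)
  have v': "v \<in> fst W" using v by (rule fixed_spaceD)
  show "snd W g v \<in> fst W" using isomsD(1)[OF rep_isom[OF W g]] v' by blast
  fix n assume n: "n \<in> N"
  obtain n' where n': "n' \<in> N" "n \<otimes>\<^bsub>G\<^esub> g = g \<otimes>\<^bsub>G\<^esub> n'" by (rule normal_swap[OF n g])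
  have "snd W n (snd W g v) = snd W g (snd W n' v)"
    using rep_mult[OF W N_carrier[OF n] g v'] rep_mult[OF W g N_carrier[OF n'(1)] v'] n' by simp
  then show "snd W n (snd W g v) = snd W g v" using fixed_spaceD(2)[OF v n'(1)] by simp
qed

definition rep_fix :: "'g rep \<Rightarrow> 'g \<Rightarrow> omor" where
  "rep_fix W g = isom_omor (restrict (snd W g) (fx W))"

lemma rep_fix_isom:
  assumes W: "is_rep W" and g: "g \<in> carrier G"
  shows "restrict (snd W g) (fx W) \<in> isoms (fx W) (fx W)"
  by (rule isoms_restrict[OF rep_isom[OF W g] _ subspace_fixed_space[OF W]])
    (auto simp: rep_fixed_space[OF W g] fixed_spaceD)

lemma rep_fix_omors: "is_rep W \<Longrightarrow> g \<in> carrier G \<Longrightarrow> rep_fix W g \<in> omors (fx W) (fx W)"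
  unfolding rep_fix_def by (simp add: isom_omor_omors rep_fix_isom subspace_fixed_space)

lemma rep_fix_mult:
  assumes W: "is_rep W" and g: "g \<in> carrier G" and h: "h \<in> carrier G"
  shows "rep_fix W (g \<otimes>\<^bsub>G\<^esub> h) = ocomp (fx W) (rep_fix W g) (rep_fix W h)"
proof -
  have "restrict (snd W (g \<otimes>\<^bsub>G\<^esub> h)) (fx W)
      = compose (fx W) (restrict (snd W g) (fx W)) (restrict (snd W h) (fx W))"
    by (intro extensionalityI[of _ "fx W"])
      (auto simp: compose_eq rep_mult[OF W g h] rep_fixed_space[OF W h] fixed_spaceD)
  then show ?thesis
    unfolding rep_fix_def using ocomp_isom_omor[OF rep_fix_isom[OF W g] subspace_fixed_space[OF W]] by simp
qed

lemma rep_fix_N: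
  assumes W: "is_rep W" and n: "n \<in> N"
  shows "rep_fix W n = omor_id (fx W)"
  unfolding rep_fix_def by (rule arg_cong[of _ _ isom_omor]) (auto simp: fixed_spaceD n)

lemma continuous_map_rep_fix:
  assumes W: "is_rep W" and F: "continuous_map Z T F"
  shows "continuous_map Z (omor_space (fx W) (fx W)) (\<lambda>z. rep_fix W (F z))"
  unfolding rep_fix_def
proof (rule continuous_map_isom_omor[OF _ subspace_fixed_space[OF W]])
  have FG: "F z \<in> carrier G" if "z \<in> topspace Z" for z
    using continuous_map_funspace[OF F] that topspace_T by auto
  have "continuous_map Z (isom_space (fst W) (fst W)) (\<lambda>z. snd W (F z))"
    using continuous_map_compose[OF F continuous_map_rep[OF W]] by (simp add: o_def)
  then show "continuous_map Z (isom_space (fx W) (fx W)) (\<lambda>z. restrict (snd W (F z)) (fx W))"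
    unfolding continuous_map_isom_space using rep_fix_isom[OF W] FG fixed_spaceD(1) by auto
qed

text \<open>Invariance under conjugation becomes N-linearity of f together with N-invariance of x.
  This description sees a representation only through its restriction to N, which is why the
  morphism sets for G and for H can be compared.\<close>

lemma fixed_omors_iff:
  assumes V: "is_rep V" and W: "is_rep W"
  shows "Some (f, x) \<in> fixed_omors G N V W \<longleftrightarrow> Some (f, x) \<in> omors (fst V) (fst W)
    \<and> (\<forall>n\<in>N. \<forall>v\<in>fst V. f (snd V n v) = snd W n (f v)) \<and> x \<in> fx W"
    (is "?l \<longleftrightarrow> ?r")
proof -
  have "omor_conj G V W n (Some (f, x)) = Some (f, x) \<longleftrightarrow>
      (\<forall>v\<in>fst V. f (snd V n v) = snd W n (f v)) \<and> snd W n x = x"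
    if n: "n \<in> N" and fx: "Some (f, x) \<in> omors (fst V) (fst W)" for n
  proof -
    have g: "n \<in> carrier G" using n by (rule N_carrier)
    have f: "f \<in> isoms (fst V) (fst W)" using fx by (simp add: omors_iff)
    have Vv: "snd V n v \<in> fst V" "snd V (inv\<^bsub>G\<^esub> n) v \<in> fst V" if "v \<in> fst V" for v
      using isomsD(1)[OF rep_isom[OF V]] g that by auto
    have "(\<lambda>v\<in>fst V. snd W n (f (snd V (inv\<^bsub>G\<^esub> n) v))) = f \<longleftrightarrow>
        (\<forall>v\<in>fst V. f (snd V n v) = snd W n (f v))"
    proof
      assume eq: "(\<lambda>v\<in>fst V. snd W n (f (snd V (inv\<^bsub>G\<^esub> n) v))) = f"
      show "\<forall>v\<in>fst V. f (snd V n v) = snd W n (f v)"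
      proof
        fix v assume v: "v \<in> fst V"
        show "f (snd V n v) = snd W n (f v)"
          using fun_cong[OF eq, of "snd V n v"] Vv(1)[OF v] rep_inv(2)[OF V g v] by simp
      qed
    next
      assume R: "\<forall>v\<in>fst V. f (snd V n v) = snd W n (f v)"
      show "(\<lambda>v\<in>fst V. snd W n (f (snd V (inv\<^bsub>G\<^esub> n) v))) = f"
        using R Vv(2) rep_inv(1)[OF V g] isomsD(5)[OF f]
        by (intro extensionalityI[of _ "fst V"]) (simp_all, metis)
    qed
    then show ?thesis by (simp add: omor_conj_def)
  qed
  then show ?thesis
    unfolding fixed_omors_def fixed_space_def by (auto simp: omors_iff)
qed

lemma fixed_omors_omors: "\<phi> \<in> fixed_omors G N V W \<Longrightarrow> \<phi> \<in> omors (fst V) (fst W)"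
  by (simp add: fixed_omors_def)

lemma omor_fix_omors:
  assumes V: "is_rep V" and W: "is_rep W" and \<phi>: "\<phi> \<in> fixed_omors G N V W"
  shows "omor_fix N V \<phi> \<in> omors (fx V) (fx W)"
proof (cases \<phi>)
  case (Some q)
  obtain f x where q: "q = (f, x)" by fastforce
  have f: "f \<in> isoms (fst V) (fst W)" "x \<in> fx W" "\<forall>v\<in>fst V. inner (f v) x = 0"
    "\<forall>n\<in>N. \<forall>v\<in>fst V. f (snd V n v) = snd W n (f v)"
    using \<phi> Some q fixed_omors_iff[OF V W, of f x] by (auto simp: omors_iff)
  have im: "f v \<in> fx W" if v: "v \<in> fx V" for v
    unfolding fixed_space_def
  proof (intro CollectI conjI ballI)
    have v': "v \<in> fst V" using v by (rule fixed_spaceD)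
    show "f v \<in> fst W" using isomsD(1)[OF f(1) v'] .
    fix n assume n: "n \<in> N"
    show "snd W n (f v) = f v" using f(4) n v' fixed_spaceD(2)[OF v n] by metis
  qed
  have "restrict f (fx V) \<in> isoms (fx V) (fx W)"
    by (rule isoms_restrict[OF f(1) _ subspace_fixed_space[OF V]]) (auto simp: im fixed_spaceD)
  then show ?thesis using Some q f(2,3) by (auto simp: omor_fix_def omors_iff fixed_spaceD)
qed (simp add: omor_fix_def omors_iff)

text \<open>From n g = g n' follows g^-1 n = n' g^-1, so linearity of the conjugate with respect to
  n reduces to linearity of f with respect to n'.\<close>

lemma omor_conj_fixed_omors:
  assumes V: "is_rep V" and W: "is_rep W" and g: "g \<in> carrier G" and \<phi>: "\<phi> \<in> fixed_omors G N V W"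
  shows "omor_conj G V W g \<phi> \<in> fixed_omors G N V W"
proof (cases \<phi>)
  case None
  then show ?thesis using \<phi> by (simp add: omor_conj_def)
next
  case (Some q)
  obtain f x where q: "q = (f, x)" by fastforce
  have \<phi>': "\<phi> \<in> omors (fst V) (fst W)" using \<phi> by (rule fixed_omors_omors)
  have f: "f \<in> isoms (fst V) (fst W)" "x \<in> fx W"
    "\<forall>n\<in>N. \<forall>v\<in>fst V. f (snd V n v) = snd W n (f v)"
    using \<phi> Some q fixed_omors_iff[OF V W, of f x] by (auto simp: omors_iff)
  let ?f = "\<lambda>v\<in>fst V. snd W g (f (snd V (inv\<^bsub>G\<^esub> g) v))"
  have eq: "omor_conj G V W g \<phi> = Some (?f, snd W g x)" by (simp add: Some q omor_conj_def)
  have gi: "inv\<^bsub>G\<^esub> g \<in> carrier G" using g by simp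
  have "?f (snd V n v) = snd W n (?f v)" if n: "n \<in> N" and v: "v \<in> fst V" for n v
  proof -
    have nG: "n \<in> carrier G" using n by (rule N_carrier)
    obtain n' where n': "n' \<in> N" "n \<otimes>\<^bsub>G\<^esub> g = g \<otimes>\<^bsub>G\<^esub> n'" by (rule normal_swap[OF n g])
    have n'G: "n' \<in> carrier G" using n'(1) by (rule N_carrier)
    have "inv\<^bsub>G\<^esub> g \<otimes>\<^bsub>G\<^esub> n = n' \<otimes>\<^bsub>G\<^esub> inv\<^bsub>G\<^esub> g"
    proof -
      have "n' \<otimes>\<^bsub>G\<^esub> inv\<^bsub>G\<^esub> g = inv\<^bsub>G\<^esub> g \<otimes>\<^bsub>G\<^esub> (g \<otimes>\<^bsub>G\<^esub> n') \<otimes>\<^bsub>G\<^esub> inv\<^bsub>G\<^esub> g"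
        using g n'G by (simp add: m_assoc[symmetric])
      also have "\<dots> = inv\<^bsub>G\<^esub> g \<otimes>\<^bsub>G\<^esub> n" using g nG by (simp add: n'(2)[symmetric] m_assoc)
      finally show ?thesis by simp
    qed
    then have s: "snd V (inv\<^bsub>G\<^esub> g) (snd V n v) = snd V n' (snd V (inv\<^bsub>G\<^esub> g) v)"
      using rep_mult[OF V gi nG v] rep_mult[OF V n'G gi v] by simp
    let ?u = "snd V (inv\<^bsub>G\<^esub> g) v"
    have u: "?u \<in> fst V" and nv: "snd V n v \<in> fst V"
      using isomsD(1)[OF rep_isom[OF V gi] v] isomsD(1)[OF rep_isom[OF V nG] v] by auto
    have fu: "f ?u \<in> fst W" using isomsD(1)[OF f(1) u] .
    have "?f (snd V n v) = snd W g (snd W n' (f ?u))" using nv s f(3) n'(1) u by simp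
    also have "\<dots> = snd W n (snd W g (f ?u))"
      using rep_mult[OF W g n'G fu] rep_mult[OF W nG g fu] n'(2) by simp
    finally show ?thesis using v by simp
  qed
  moreover have "snd W g x \<in> fx W" by (rule rep_fixed_space[OF W g f(2)])
  ultimately show ?thesis
    using omor_conj_omors[OF V W g \<phi>'] unfolding eq fixed_omors_iff[OF V W] by blast
qed

text \<open>On fixed spaces g^-1 cancels the outer factor of the conjugate g \<phi> g^-1. This is
  the part of the compatibility of action and coend relation that concerns the coordinate
  \<psi>.\<close>

lemma omor_fix_conj:
  assumes V: "is_rep V" and W: "is_rep W" and g: "g \<in> carrier G" and \<phi>: "\<phi> \<in> fixed_omors G N V W"
  shows "ocomp (fx V) (rep_fix W (inv\<^bsub>G\<^esub> g)) (omor_fix N V (omor_conj G V W g \<phi>))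
    = ocomp (fx V) (omor_fix N V \<phi>) (rep_fix V (inv\<^bsub>G\<^esub> g))"
proof (cases \<phi>)
  case None
  then show ?thesis by (simp add: omor_conj_def omor_fix_def)
next
  case (Some q)
  obtain f x where q: "q = (f, x)" by fastforce
  have f: "f \<in> isoms (fst V) (fst W)" "x \<in> fx W"
    using \<phi> Some q fixed_omors_iff[OF V W, of f x] by (auto simp: omors_iff)
  have \<phi>': "omor_fix N V \<phi> \<in> omors (fx V) (fx W)" by (rule omor_fix_omors[OF V W \<phi>])
  have fW: "f v \<in> fx W" if "v \<in> fx V" for v
    using \<phi>' that isomsD(1)[of "restrict f (fx V)" "fx V" "fx W" v]
    by (auto simp: Some q omor_fix_def omors_iff)
  have gi: "inv\<^bsub>G\<^esub> g \<in> carrier G" using g by simp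
  have "f 0 = 0" using isoms_zero[OF f(1) fd_subspace_imp_subspace[OF rep_fd[OF V]]] .
  moreover have "snd W (inv\<^bsub>G\<^esub> g) (snd W g w) = w" if "w \<in> fst W" for w
    using rep_inv(2)[OF W g that] .
  ultimately show ?thesis
    using f(2) fW rep_fixed_space[OF W g] rep_fixed_space[OF V gi]
      subspace_0[OF subspace_fixed_space[OF V]]
    by (auto simp: Some q omor_conj_def omor_fix_def rep_fix_def isom_omor_def compose_def fun_eq_iff
        fixed_spaceD)
qed

lemma ev_fixedD: "p \<in> ev_fixed A N W \<Longrightarrow> p \<in> topspace (ev_space A (fst W))"
  "p \<in> ev_fixed A N W \<Longrightarrow> n \<in> N \<Longrightarrow> ev_act A W n p = p"
  by (auto simp: ev_fixed_def)

text \<open>An intersection of equalizers. Closedness is what keeps the fixed points, with the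
  subspace topology, compactly generated.\<close>

lemma closedin_ev_fixed:
  assumes W: "is_rep W"
  shows "closedin (ev_space A (fst W)) (ev_fixed A N W)"
  unfolding ev_fixed_def
proof (rule closedin_Collect_Ball)
  fix n assume "n \<in> N"
  note c = CGWH_ev_space[OF rep_fd[OF W]]
  show "closedin (ev_space A (fst W)) {p \<in> topspace (ev_space A (fst W)). ev_act A W n p = p}"
    by (rule closedin_equalizer[OF c CGWH_imp_weak_Hausdorff[OF c]
          continuous_map_ev_act_fixed[OF W N_carrier[OF \<open>n \<in> N\<close>]]]) simp
qed

lemma ev_base_fixed: "is_rep W \<Longrightarrow> ev_base A (fst W) \<in> ev_fixed A N W"
  by (simp add: ev_fixed_def ev_base_in rep_fd ev_act_base N_carrier)

lemma ev_map_fixed: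
  assumes V: "is_rep V" and W: "is_rep W" and \<phi>: "\<phi> \<in> fixed_omors G N V W" and p: "p \<in> ev_fixed A N V"
  shows "ev_map A (fst V) (fst W) \<phi> p \<in> ev_fixed A N W"
  unfolding ev_fixed_def
proof (intro CollectI conjI ballI)
  have \<phi>': "\<phi> \<in> omors (fst V) (fst W)" using \<phi> by (rule fixed_omors_omors)
  have p': "p \<in> topspace (ev_space A (fst V))" using p by (rule ev_fixedD)
  show "ev_map A (fst V) (fst W) \<phi> p \<in> topspace (ev_space A (fst W))"
    by (rule ev_map_in[OF rep_fd[OF V] rep_fd[OF W] \<phi>' p'])
  fix n assume n: "n \<in> N"
  have "omor_conj G V W n \<phi> = \<phi>" using \<phi> n by (simp add: fixed_omors_def)
  then show "ev_act A W n (ev_map A (fst V) (fst W) \<phi> p) = ev_map A (fst V) (fst W) \<phi> p"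
    using ev_act_ev_map[OF V W N_carrier[OF n] \<phi>' p'] ev_fixedD(2)[OF p n] by simp
qed

lemma ev_act_fixed:
  assumes W: "is_rep W" and g: "g \<in> carrier G" and p: "p \<in> ev_fixed A N W"
  shows "ev_act A W g p \<in> ev_fixed A N W"
  unfolding ev_fixed_def
proof (intro CollectI conjI ballI)
  have p': "p \<in> topspace (ev_space A (fst W))" using p by (rule ev_fixedD)
  show "ev_act A W g p \<in> topspace (ev_space A (fst W))" by (rule ev_act_in[OF W g p'])
  fix n assume n: "n \<in> N"
  obtain n' where n': "n' \<in> N" "n \<otimes>\<^bsub>G\<^esub> g = g \<otimes>\<^bsub>G\<^esub> n'" by (rule normal_swap[OF n g])
  have "ev_act A W n (ev_act A W g p) = ev_act A W g (ev_act A W n' p)"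
    using ev_act_mult[OF W N_carrier[OF n] g p'] ev_act_mult[OF W g N_carrier[OF n'(1)] p'] n'(2) by simp
  then show "ev_act A W n (ev_act A W g p) = ev_act A W g p" using ev_fixedD(2)[OF p n'(1)] by simp
qed

section \<open>The coend and maps out of it\<close>

abbreviation pre :: "nat \<Rightarrow> ('g, 'a) geo_pre topology" where
  "pre m \<equiv> geo_pre G T N A m"

abbreviation cls :: "nat \<Rightarrow> ('g, 'a) geo_pre \<Rightarrow> ('g, 'a) geo_pre set" where
  "cls m \<equiv> geo_class G T N A m"

abbreviation coend :: "nat \<Rightarrow> ('g, 'a) geo_pre set topology" where
  "coend m \<equiv> cgwh_quotient (pre m) (geo_rel G T N A m)"

lemma mem_pre [simp]:
  "(W, \<psi>, p) \<in> topspace (pre m) \<longleftrightarrow> is_rep W \<and> \<psi> \<in> omors (fx W) (Rn m) \<and> p \<in> ev_fixed A N W"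
  by (auto simp: geo_pre_def ev_fixed_def)

lemma CGWH_pre: "CGWH_space (pre m)"
  unfolding geo_pre_def
proof (rule CGWH_sum, rule CGWH_prod_compact)
  fix W assume "W \<in> {W. is_rep W}"
  then show "CGWH_space (subtopology (ev_space A (fst W)) (ev_fixed A N W))"
    by (intro CGWH_closed_subspace) (auto simp: CGWH_ev_space rep_fd closedin_ev_fixed)
qed (simp_all add: compact_omor_space Hausdorff_omor_space fd_subspace_Rn)

lemma geo_basepts_subset: "geo_basepts G T N A m \<subseteq> topspace (pre m)"
  by (auto simp: geo_basepts_def)

lemma geo_rel_subset: "geo_rel G T N A m \<subseteq> topspace (pre m) \<times> topspace (pre m)"
proof -
  have "(V, ocomp (fx V) \<psi> (omor_fix N V \<phi>), p) \<in> topspace (pre m)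
    \<and> (W, \<psi>, ev_map A (fst V) (fst W) \<phi> p) \<in> topspace (pre m)"
    if "is_rep V" "is_rep W" "\<phi> \<in> fixed_omors G N V W" "\<psi> \<in> omors (fx W) (Rn m)"
      "p \<in> ev_fixed A N V" for V W \<phi> \<psi> p
    using that by (auto intro!: ocomp_omors[OF _ omor_fix_omors] ev_map_fixed subspace_fixed_space subspace_Rn)
  note claim = this
  show ?thesis
  proof
    fix z assume "z \<in> geo_rel G T N A m"
    then consider "z \<in> geo_basepts G T N A m \<times> geo_basepts G T N A m"
      | V W \<phi> \<psi> p where "is_rep V" "is_rep W" "\<phi> \<in> fixed_omors G N V W" "\<psi> \<in> omors (fx W) (Rn m)"
        "p \<in> ev_fixed A N V"
        "z = ((V, ocomp (fx V) \<psi> (omor_fix N V \<phi>), p), (W, \<psi>, ev_map A (fst V) (fst W) \<phi> p))"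
      unfolding geo_rel_def by blast
    then show "z \<in> topspace (pre m) \<times> topspace (pre m)"
    proof cases
      case 1
      then show ?thesis using geo_basepts_subset by blast
    next
      case 2
      then show ?thesis using claim[OF 2(1-5)] by (simp only: mem_Sigma_iff)
    qed
  qed
qed

lemma geo_class_rel:
  assumes "is_rep V" "is_rep W" "\<phi> \<in> fixed_omors G N V W" "\<psi> \<in> omors (fx W) (Rn m)" "p \<in> ev_fixed A N V"
  shows "cls m (V, ocomp (fx V) \<psi> (omor_fix N V \<phi>), p) = cls m (W, \<psi>, ev_map A (fst V) (fst W) \<phi> p)"
  unfolding geo_class_def
proof (rule cgwh_class_rel[OF geo_rel_subset])
  show "((V, ocomp (fx V) \<psi> (omor_fix N V \<phi>), p), (W, \<psi>, ev_map A (fst V) (fst W) \<phi> p)) \<in> geo_rel G T N A m"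
    unfolding geo_rel_def using assms by blast
qed

lemma geo_class_base:
  assumes "x \<in> geo_basepts G T N A m" "y \<in> geo_basepts G T N A m"
  shows "cls m x = cls m y"
  unfolding geo_class_def
  by (rule cgwh_class_rel[OF geo_rel_subset]) (use assms in \<open>auto simp: geo_rel_def\<close>)

lemma mem_geo_basepts [simp]:
  "(W, \<psi>, p) \<in> geo_basepts G T N A m \<longleftrightarrow> is_rep W \<and> \<psi> \<in> omors (fx W) (Rn m) \<and> p \<in> ev_fixed A N W
    \<and> (\<psi> = None \<or> p = ev_base A (fst W))"
  by (auto simp: geo_basepts_def)

lemma geo_relE:
  assumes "(x, y) \<in> geo_rel G T N A m"
    and "\<And>V W \<phi> \<psi> p. is_rep V \<Longrightarrow> is_rep W \<Longrightarrow> \<phi> \<in> fixed_omors G N V W \<Longrightarrow> \<psi> \<in> omors (fx W) (Rn m)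
      \<Longrightarrow> p \<in> ev_fixed A N V
      \<Longrightarrow> F (V, ocomp (fx V) \<psi> (omor_fix N V \<phi>), p) = F (W, \<psi>, ev_map A (fst V) (fst W) \<phi> p)"
    and "\<And>x y. x \<in> geo_basepts G T N A m \<Longrightarrow> y \<in> geo_basepts G T N A m \<Longrightarrow> F x = F y"
  shows "F x = F y"
  using assms(1) unfolding geo_rel_def
proof (elim UnE)
  assume "(x, y) \<in> geo_basepts G T N A m \<times> geo_basepts G T N A m"
  then show ?thesis by (intro assms(3)) simp_all
next
  assume "(x, y) \<in> {((V, ocomp (fx V) \<psi> (omor_fix N V \<phi>), p), (W, \<psi>, ev_map A (fst V) (fst W) \<phi> p)) |
    V W \<phi> \<psi> p. is_rep V \<and> is_rep W \<and> \<phi> \<in> fixed_omors G N V W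
        \<and> \<psi> \<in> omors (fx W) (Rn m) \<and> p \<in> ev_fixed A N V}"
  then obtain V W \<phi> \<psi> p where "x = (V, ocomp (fx V) \<psi> (omor_fix N V \<phi>), p)"
    "y = (W, \<psi>, ev_map A (fst V) (fst W) \<phi> p)" and
    *: "is_rep V" "is_rep W" "\<phi> \<in> fixed_omors G N V W" "\<psi> \<in> omors (fx W) (Rn m)" "p \<in> ev_fixed A N V"
    by blast
  then show ?thesis using assms(2)[OF *] by simp
qed

lemma weak_Hausdorff_coend: "weak_Hausdorff_space (coend m)"
  by (rule weak_Hausdorff_cgwh_quotient[OF geo_rel_subset])

lemma topspace_coend: "topspace (coend m) = cls m ` topspace (pre m)"
  unfolding geo_class_def by (rule topspace_cgwh_quotient[OF geo_rel_subset])

lemma coendE: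
  assumes "c \<in> topspace (coend m)"
  obtains W \<psi> p where "is_rep W" "\<psi> \<in> omors (fx W) (Rn m)" "p \<in> ev_fixed A N W" "c = cls m (W, \<psi>, p)"
proof -
  obtain z where z: "z \<in> topspace (pre m)" "c = cls m z" using assms unfolding topspace_coend by blast
  obtain W \<psi> p where "z = (W, \<psi>, p)" by (cases z)
  with z show ?thesis using that mem_pre by blast
qed

lemma cls_in: "z \<in> topspace (pre m) \<Longrightarrow> cls m z \<in> topspace (coend m)"
  unfolding topspace_coend by (rule imageI)

lemma continuous_map_cls:
  assumes W: "is_rep W" and \<Psi>: "continuous_map Z (omor_space (fx W) (Rn m)) \<Psi>"
    and P: "continuous_map Z (ev_space A (fst W)) P" and Pf: "\<And>z. z \<in> topspace Z \<Longrightarrow> P z \<in> ev_fixed A N W"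
  shows "continuous_map Z (coend m) (\<lambda>z. cls m (W, \<Psi> z, P z))"
proof -
  let ?X = "\<lambda>W. prod_topology (omor_space (fx W) (Rn m)) (subtopology (ev_space A (fst W)) (ev_fixed A N W))"
  have "continuous_map Z (?X W) (\<lambda>z. (\<Psi> z, P z))"
    using P Pf by (intro continuous_map_pairedI[OF \<Psi>]) (auto simp: continuous_map_in_subtopology)
  moreover have "continuous_map (?X W) (pre m) (Pair W)"
    unfolding geo_pre_def using continuous_map_component_injection[of W "{W. is_rep W}" ?X] W by simp
  ultimately have "continuous_map Z (pre m) (\<lambda>z. (W, \<Psi> z, P z))"
    using continuous_map_compose[of Z "?X W" "\<lambda>z. (\<Psi> z, P z)" "pre m" "Pair W"] by (simp add: o_def)
  from continuous_map_compose[OF this continuous_map_cgwh_class[OF geo_rel_subset]]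
  show ?thesis by (simp add: o_def geo_class_def)
qed

lemma continuous_map_from_pre:
  assumes "\<And>W. is_rep W \<Longrightarrow> continuous_map (prod_topology (omor_space (fx W) (Rn m))
      (subtopology (ev_space A (fst W)) (ev_fixed A N W))) Z (\<lambda>(\<psi>, p). F (W, \<psi>, p))"
  shows "continuous_map (pre m) Z F"
  unfolding geo_pre_def by (rule continuous_map_from_sum) (use assms in \<open>simp add: case_prod_beta'\<close>)

lemma continuous_map_from_prod_pre:
  assumes "\<And>W. is_rep W \<Longrightarrow> continuous_map (prod_topology K (prod_topology (omor_space (fx W) (Rn m))
      (subtopology (ev_space A (fst W)) (ev_fixed A N W)))) Z (\<lambda>(k, \<psi>, p). F k (W, \<psi>, p))"
  shows "continuous_map (prod_topology K (pre m)) Z (\<lambda>(k, z). F k z)"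
  unfolding geo_pre_def by (rule continuous_map_from_prod_sum) (use assms in \<open>simp add: case_prod_beta'\<close>)

text \<open>The rule by which every map out of a coend is built: a continuous function on
  representatives with weak Hausdorff target is checked on the two kinds of generators, morphisms
  and base points.\<close>

lemma the_elem_cls:
  assumes "continuous_map (pre m) Z F" "weak_Hausdorff_space Z"
    and "\<And>V W \<phi> \<psi> p. is_rep V \<Longrightarrow> is_rep W \<Longrightarrow> \<phi> \<in> fixed_omors G N V W \<Longrightarrow> \<psi> \<in> omors (fx W) (Rn m)
      \<Longrightarrow> p \<in> ev_fixed A N V
      \<Longrightarrow> F (V, ocomp (fx V) \<psi> (omor_fix N V \<phi>), p) = F (W, \<psi>, ev_map A (fst V) (fst W) \<phi> p)"
    and "\<And>x y. x \<in> geo_basepts G T N A m \<Longrightarrow> y \<in> geo_basepts G T N A m \<Longrightarrow> F x = F y"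
  shows "z \<in> topspace (pre m) \<Longrightarrow> the_elem (F ` cls m z) = F z"
    "y \<in> cls m z \<Longrightarrow> F y = F z"
  unfolding geo_class_def
  using cgwh_quotient_lift[OF geo_rel_subset assms(1,2)] cgwh_quotient_lift_unique[OF geo_rel_subset assms(1,2)]
    geo_relE[OF _ assms(3,4)] by blast+

section \<open>Base points and structure maps of the coends\<close>

lemma trivial_rep: "is_rep ({0}, \<lambda>g\<in>carrier G. \<lambda>x\<in>{0}. x)"
proof -
  have s: "subspace {0::rseq}" by simp
  have "fd_subspace {0}" using fd_subspace_span[of "{}::rseq set"] by simp
  moreover have "continuous_map (prod_topology T (top_of_set {0::rseq})) (top_of_set {0})
      (\<lambda>(g, v). (\<lambda>g\<in>carrier G. \<lambda>x\<in>{0}. x) g v)"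
    by (rule continuous_map_eq[of _ _ "\<lambda>_. 0"]) (auto simp: topspace_T)
  ultimately show ?thesis
    using isoms_id[OF subset_refl s] unfolding orthogonal_rep_def by (auto simp: restrict_def)
qed

lemma basepoint_eq:
  assumes "x \<in> geo_basepts G T N A m"
  shows "basept (geo_fix G T N A) m = cls m x"
proof -
  have "cls m ` geo_basepts G T N A m = {cls m x}" using assms geo_class_base by blast
  then show ?thesis by (simp add: geo_fix_def)
qed

text \<open>A representative is needed for \<open>the_elem\<close> to pick out the base point; the
  zero representation supplies one.\<close>

lemma geo_basepts_nonempty: "\<exists>x. x \<in> geo_basepts G T N A m"
proof -
  have "(({0}, \<lambda>g\<in>carrier G. \<lambda>x\<in>{0}. x), None, ev_base A {0}) \<in> geo_basepts G T N A m"
    using ev_base_fixed[OF trivial_rep] trivial_rep by (simp add: omors_iff)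
  then show ?thesis by blast
qed

text \<open>The joint form serves twice: for fixed \<theta> it gives the continuity on which
  well-definedness rests, and with varying \<theta> it gives continuity of the functor.\<close>

lemma strmap_cls_continuous:
  "continuous_map (prod_topology (omor_space (Rn m) (Rn n)) (pre m)) (coend n)
    (\<lambda>(\<theta>, z). (\<lambda>(W, \<psi>, p). cls n (W, ocomp (fx W) \<theta> \<psi>, p)) z)"
proof (rule continuous_map_from_prod_pre)
  fix W assume W: "is_rep W"
  let ?E = "subtopology (ev_space A (fst W)) (ev_fixed A N W)"
  let ?Z = "prod_topology (omor_space (Rn m) (Rn n)) (prod_topology (omor_space (fx W) (Rn m)) ?E)"
  have c: "continuous_map ?Z (omor_space (Rn m) (Rn n)) fst"
    "continuous_map ?Z (omor_space (fx W) (Rn m)) (\<lambda>z. fst (snd z))" "continuous_map ?Z ?E (\<lambda>z. snd (snd z))"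
    using continuous_map_compose[OF continuous_map_snd continuous_map_fst]
      continuous_map_compose[OF continuous_map_snd continuous_map_snd]
    by (simp_all add: continuous_map_fst o_def)
  have "continuous_map ?Z (coend n) (\<lambda>z. cls n (W, ocomp (fx W) (fst z) (fst (snd z)), snd (snd z)))"
    using c(3) by (intro continuous_map_cls[OF W] continuous_map_ocomp[OF c(1,2) subspace_fixed_space[OF W]]
        fd_subspace_Rn) (auto simp: continuous_map_in_subtopology)
  then show "continuous_map ?Z (coend n)
      (\<lambda>(k, \<psi>, p). (\<lambda>(W, \<psi>, p). cls n (W, ocomp (fx W) k \<psi>, p)) (W, \<psi>, p))"
    by (simp add: case_prod_beta')
qed

lemma strmap_cls:
  assumes \<theta>: "\<theta> \<in> omors (Rn m) (Rn n)" and z: "(W, \<psi>, p) \<in> topspace (pre m)"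
  shows "strmap (geo_fix G T N A) m n \<theta> (cls m (W, \<psi>, p)) = cls n (W, ocomp (fx W) \<theta> \<psi>, p)"
proof -
  let ?F = "\<lambda>(W, \<psi>, p). cls n (W, ocomp (fx W) \<theta> \<psi>, p)"
  have "continuous_map (pre m) (prod_topology (omor_space (Rn m) (Rn n)) (pre m)) (\<lambda>z. (\<theta>, z))"
    using \<theta> by (intro continuous_map_pairedI) auto
  from continuous_map_compose[OF this strmap_cls_continuous]
  have F: "continuous_map (pre m) (coend n) ?F" by (simp add: o_def)
  have "the_elem (?F ` cls m (W, \<psi>, p)) = ?F (W, \<psi>, p)"
  proof (rule the_elem_cls(1)[OF F weak_Hausdorff_coend _ _ z])
    fix V W \<phi> \<psi> p
    assume *: "is_rep V" "is_rep W" "\<phi> \<in> fixed_omors G N V W" "\<psi> \<in> omors (fx W) (Rn m)" "p \<in> ev_fixed A N V"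
    have "ocomp (fx V) \<theta> (ocomp (fx V) \<psi> (omor_fix N V \<phi>)) = ocomp (fx V) (ocomp (fx W) \<theta> \<psi>) (omor_fix N V \<phi>)"
      using ocomp_assoc[OF \<theta> *(4) omor_fix_omors[OF *(1-3)] subspace_fixed_space[OF *(1)]] by simp
    then show "?F (V, ocomp (fx V) \<psi> (omor_fix N V \<phi>), p) = ?F (W, \<psi>, ev_map A (fst V) (fst W) \<phi> p)"
      using geo_class_rel[OF *(1-3) ocomp_omors[OF \<theta> *(4)] *(5)]
      by (simp add: subspace_fixed_space * subspace_Rn)
  next
    fix x y assume xy: "x \<in> geo_basepts G T N A m" "y \<in> geo_basepts G T N A m"
    have b: "(\<lambda>(W, \<psi>, p). (W, ocomp (fx W) \<theta> \<psi>, p)) x \<in> geo_basepts G T N A n"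
      if "x \<in> geo_basepts G T N A m" for x
      using that by (cases x) (auto intro!: ocomp_omors[OF \<theta>] simp: subspace_fixed_space subspace_Rn)
    show "?F x = ?F y" using geo_class_base[OF b[OF xy(1)] b[OF xy(2)]] by (simp add: case_prod_beta')
  qed
  then show ?thesis by (simp add: geo_fix_def)
qed

section \<open>The action of the quotient group\<close>

definition pre_act :: "'g \<Rightarrow> ('g, 'a) geo_pre \<Rightarrow> ('g, 'a) geo_pre" where
  "pre_act g = (\<lambda>(W, \<psi>, p). (W, ocomp (fx W) \<psi> (rep_fix W (inv\<^bsub>G\<^esub> g)), ev_act A W g p))"

lemma pre_act_in:
  assumes "g \<in> carrier G" "z \<in> topspace (pre m)"
  shows "pre_act g z \<in> topspace (pre m)"
  using assms by (cases z) (auto simp: pre_act_def subspace_fixed_space subspace_Rn ev_act_fixed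
      intro!: ocomp_omors[OF _ rep_fix_omors])

lemma pre_act_basept:
  assumes "g \<in> carrier G" "z \<in> geo_basepts G T N A m"
  shows "pre_act g z \<in> geo_basepts G T N A m"
proof -
  obtain W \<psi> p where z: "z = (W, \<psi>, p)" by (cases z)
  then have W: "is_rep W" and "\<psi> = None \<or> p = ev_base A (fst W)" using assms by auto
  then have "ocomp (fx W) \<psi> (rep_fix W (inv\<^bsub>G\<^esub> g)) = None \<or> ev_act A W g p = ev_base A (fst W)"
    using ev_act_base[OF W assms(1)] by (elim disjE) simp_all
  moreover have "pre_act g z \<in> topspace (pre m)"
    using pre_act_in[OF assms(1)] assms(2) geo_basepts_subset by blast
  ultimately show ?thesis by (simp add: z pre_act_def)
qed

lemma pre_act_one:
  assumes "z \<in> topspace (pre m)"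
  shows "pre_act \<one>\<^bsub>G\<^esub> z = z"
proof -
  obtain W \<psi> p where z: "z = (W, \<psi>, p)" by (cases z)
  then have W: "is_rep W" and \<psi>: "\<psi> \<in> omors (fx W) (Rn m)" and p: "p \<in> ev_fixed A N W" using assms by auto
  show ?thesis
    using rep_fix_N[OF W subgroup.one_closed[OF subgroup_N]] ocomp_id_right[OF \<psi> subspace_fixed_space[OF W]]
      ev_act_one[OF W ev_fixedD(1)[OF p]] by (simp add: z pre_act_def)
qed

lemma pre_act_mult:
  assumes g: "g \<in> carrier G" and h: "h \<in> carrier G" and "z \<in> topspace (pre m)"
  shows "pre_act (g \<otimes>\<^bsub>G\<^esub> h) z = pre_act g (pre_act h z)"
proof -
  obtain W \<psi> p where z: "z = (W, \<psi>, p)" by (cases z)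
  then have W: "is_rep W" and \<psi>: "\<psi> \<in> omors (fx W) (Rn m)" and p: "p \<in> ev_fixed A N W" using assms by auto
  show ?thesis
    using rep_fix_mult[OF W inv_closed[OF h] inv_closed[OF g]]
      ocomp_assoc[OF \<psi> rep_fix_omors[OF W inv_closed[OF h]] rep_fix_omors[OF W inv_closed[OF g]]
        subspace_fixed_space[OF W]]
      ev_act_mult[OF W g h ev_fixedD(1)[OF p]] by (simp add: z pre_act_def inv_mult_group g h)
qed

text \<open>Both coordinates are N-fixed, so N acts trivially already on representatives and not
  merely on classes. Hence the action depends only on the coset.\<close>

lemma pre_act_N:
  assumes n: "n \<in> N" and "z \<in> topspace (pre m)"
  shows "pre_act n z = z"
proof -
  obtain W \<psi> p where z: "z = (W, \<psi>, p)" by (cases z)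
  then have W: "is_rep W" and \<psi>: "\<psi> \<in> omors (fx W) (Rn m)" and p: "p \<in> ev_fixed A N W" using assms by auto
  show ?thesis
    using rep_fix_N[OF W subgroup.m_inv_closed[OF subgroup_N n]] ocomp_id_right[OF \<psi> subspace_fixed_space[OF W]]
      ev_fixedD(2)[OF p n] by (simp add: z pre_act_def)
qed

lemma pre_act_coset:
  assumes g: "g \<in> carrier G" and z: "z \<in> topspace (pre m)" and g': "g' \<in> N #>\<^bsub>G\<^esub> g"
  shows "pre_act g' z = pre_act g z"
proof -
  obtain n where n: "n \<in> N" "g' = n \<otimes>\<^bsub>G\<^esub> g" using g' by (auto simp: r_coset_def)
  then show ?thesis
    using pre_act_mult[OF N_carrier[OF n(1)] g z] pre_act_N[OF n(1) pre_act_in[OF g z]] by simp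
qed

lemma pre_act_continuous:
  "continuous_map (prod_topology T (pre m)) (coend m) (\<lambda>(g, z). cls m (pre_act g z))"
proof (rule continuous_map_from_prod_pre)
  fix W assume W: "is_rep W"
  let ?E = "subtopology (ev_space A (fst W)) (ev_fixed A N W)"
  let ?Z = "prod_topology T (prod_topology (omor_space (fx W) (Rn m)) ?E)"
  have c: "continuous_map ?Z T fst"
    "continuous_map ?Z (omor_space (fx W) (Rn m)) (\<lambda>z. fst (snd z))" "continuous_map ?Z ?E (\<lambda>z. snd (snd z))"
    using continuous_map_compose[OF continuous_map_snd continuous_map_fst]
      continuous_map_compose[OF continuous_map_snd continuous_map_snd]
    by (simp_all add: continuous_map_fst o_def)
  have "continuous_map T T (\<lambda>x. inv\<^bsub>G\<^esub> x)" using topological_group by (simp add: topological_group_def)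
  from continuous_map_compose[OF c(1) this] have ci: "continuous_map ?Z T (\<lambda>z. inv\<^bsub>G\<^esub> (fst z))"
    by (simp add: o_def)
  have "continuous_map ?Z (coend m) (\<lambda>z. cls m (W, ocomp (fx W) (fst (snd z)) (rep_fix W (inv\<^bsub>G\<^esub> (fst z))),
      ev_act A W (fst z) (snd (snd z))))"
  proof (rule continuous_map_cls[OF W])
    show "continuous_map ?Z (omor_space (fx W) (Rn m))
        (\<lambda>z. ocomp (fx W) (fst (snd z)) (rep_fix W (inv\<^bsub>G\<^esub> (fst z))))"
      by (rule continuous_map_ocomp[OF c(2) continuous_map_rep_fix[OF W ci] subspace_fixed_space[OF W]
            fd_fixed_space[OF W] fd_subspace_Rn])
    show "continuous_map ?Z (ev_space A (fst W)) (\<lambda>z. ev_act A W (fst z) (snd (snd z)))"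
      using c(3) by (intro continuous_map_ev_act[OF W c(1)]) (simp add: continuous_map_in_subtopology)
    show "ev_act A W (fst z) (snd (snd z)) \<in> ev_fixed A N W" if "z \<in> topspace ?Z" for z
      using that by (auto simp: topspace_T intro!: ev_act_fixed[OF W])
  qed
  then show "continuous_map ?Z (coend m) (\<lambda>(k, \<psi>, p). cls m (pre_act k (W, \<psi>, p)))"
    by (simp add: case_prod_beta' pre_act_def)
qed

lemma pre_act_lift:
  assumes g: "g \<in> carrier G"
  shows "y \<in> cls m z \<Longrightarrow> cls m (pre_act g y) = cls m (pre_act g z)"
proof -
  have "continuous_map (pre m) (prod_topology T (pre m)) (\<lambda>z. (g, z))"
    using g topspace_T by (intro continuous_map_pairedI) auto
  from continuous_map_compose[OF this pre_act_continuous]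
  have F: "continuous_map (pre m) (coend m) (\<lambda>z. cls m (pre_act g z))" by (simp add: o_def)
  show "cls m (pre_act g y) = cls m (pre_act g z)" if "y \<in> cls m z"
  proof (rule the_elem_cls(2)[OF F weak_Hausdorff_coend _ _ that])
    fix V W \<phi> \<psi> p
    assume *: "is_rep V" "is_rep W" "\<phi> \<in> fixed_omors G N V W" "\<psi> \<in> omors (fx W) (Rn m)" "p \<in> ev_fixed A N V"
    let ?gi = "inv\<^bsub>G\<^esub> g"
    have gi: "?gi \<in> carrier G" using g by simp
    let ?\<psi> = "ocomp (fx W) \<psi> (rep_fix W ?gi)" and ?c = "omor_conj G V W g \<phi>"
    note sV = subspace_fixed_space[OF *(1)] and sW = subspace_fixed_space[OF *(2)]
    have \<psi>': "?\<psi> \<in> omors (fx W) (Rn m)" by (rule ocomp_omors[OF *(4) rep_fix_omors[OF *(2) gi] sW subspace_Rn])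
    \<comment> \<open>Acting by g turns the generator given by \<phi> into the one given by its
      conjugate, which is again a morphism because N is normal.\<close>
    have c: "?c \<in> fixed_omors G N V W" by (rule omor_conj_fixed_omors[OF *(1,2) g *(3)])
    have "ocomp (fx V) (ocomp (fx V) \<psi> (omor_fix N V \<phi>)) (rep_fix V ?gi)
        = ocomp (fx V) \<psi> (ocomp (fx V) (omor_fix N V \<phi>) (rep_fix V ?gi))"
      by (rule ocomp_assoc[OF *(4) omor_fix_omors[OF *(1-3)] rep_fix_omors[OF *(1) gi] sV])
    also have "\<dots> = ocomp (fx V) \<psi> (ocomp (fx V) (rep_fix W ?gi) (omor_fix N V ?c))"
      by (simp add: omor_fix_conj[OF *(1,2) g *(3)])
    also have "\<dots> = ocomp (fx V) ?\<psi> (omor_fix N V ?c)"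
      using ocomp_assoc[OF *(4) rep_fix_omors[OF *(2) gi] omor_fix_omors[OF *(1,2) c] sV] by simp
    finally show "cls m (pre_act g (V, ocomp (fx V) \<psi> (omor_fix N V \<phi>), p))
        = cls m (pre_act g (W, \<psi>, ev_map A (fst V) (fst W) \<phi> p))"
      using geo_class_rel[OF *(1,2) c \<psi>' ev_act_fixed[OF *(1) g *(5)]]
        ev_act_ev_map[OF *(1,2) g fixed_omors_omors[OF *(3)] ev_fixedD(1)[OF *(5)]]
      by (simp add: pre_act_def)
  qed (rule geo_class_base; rule pre_act_basept[OF g])
qed

lemma gact_cls:
  assumes g: "g \<in> carrier G" and z: "z \<in> topspace (pre m)"
  shows "gact (geo_fix G T N A) (N #>\<^bsub>G\<^esub> g) m (cls m z) = cls m (pre_act g z)"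
proof -
  let ?F = "\<lambda>(g, W, \<psi>, p). cls m (W, ocomp (fx W) \<psi> (isom_omor (restrict (snd W (inv\<^bsub>G\<^esub> g)) (fx W))),
      ev_act A W g p)"
  have F: "?F (g', y) = cls m (pre_act g' y)" for g' y
    by (cases y) (simp add: pre_act_def rep_fix_def)
  have const: "?F x = cls m (pre_act g z)" if "x \<in> (N #>\<^bsub>G\<^esub> g) \<times> cls m z" for x
  proof -
    define g' y where "g' = fst x" and "y = snd x"
    then have x: "x = (g', y)" "g' \<in> N #>\<^bsub>G\<^esub> g" "y \<in> cls m z"
      using that by (simp_all add: mem_Times_iff)
    have "g' \<in> carrier G" using x(2) r_coset_subset_G[of N g] g N_carrier by auto
    then have "cls m (pre_act g' y) = cls m (pre_act g' z)" using pre_act_lift x(3) by blast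
    also have "\<dots> = cls m (pre_act g z)" using pre_act_coset[OF g z x(2)] by simp
    finally show ?thesis unfolding x F .
  qed
  have "(g, z) \<in> (N #>\<^bsub>G\<^esub> g) \<times> cls m z"
    using rcos_self[OF g subgroup_N] cgwh_class_self[OF geo_rel_subset z] by (simp add: geo_class_def)
  then have "?F ` ((N #>\<^bsub>G\<^esub> g) \<times> cls m z) = {cls m (pre_act g z)}"
    by (intro image_eq_singleton[where F = ?F] const)
  then show ?thesis by (simp add: geo_fix_def)
qed

section \<open>The quotient topology on cosets\<close>

lemma coset_eq_iff: "g \<in> carrier G \<Longrightarrow> h \<in> carrier G \<Longrightarrow> N #>\<^bsub>G\<^esub> g = N #>\<^bsub>G\<^esub> h \<longleftrightarrow> (\<exists>n\<in>N. h = n \<otimes>\<^bsub>G\<^esub> g)"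
proof
  assume g: "g \<in> carrier G" and h: "h \<in> carrier G" and eq: "N #>\<^bsub>G\<^esub> g = N #>\<^bsub>G\<^esub> h"
  have "h \<in> N #>\<^bsub>G\<^esub> g" unfolding eq by (rule rcos_self[OF h subgroup_N])
  then show "\<exists>n\<in>N. h = n \<otimes>\<^bsub>G\<^esub> g" by (auto simp: r_coset_def)
next
  assume g: "g \<in> carrier G" and h: "h \<in> carrier G" and "\<exists>n\<in>N. h = n \<otimes>\<^bsub>G\<^esub> g"
  then have "h \<in> N #>\<^bsub>G\<^esub> g" by (auto simp: r_coset_def)
  then show "N #>\<^bsub>G\<^esub> g = N #>\<^bsub>G\<^esub> h" by (rule repr_independence[OF _ g subgroup_N])
qed

text \<open>The saturation of U is the union, over n in N, of the preimages of U under left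
  translation by n.\<close>

lemma open_map_coset: "open_map T (quot_topology G T N) (\<lambda>g. N #>\<^bsub>G\<^esub> g)"
  unfolding open_map_def quot_topology_def openin_final_topology
proof (intro allI impI conjI)
  fix U assume U: "openin T U"
  then have UG: "U \<subseteq> carrier G" using openin_subset topspace_T by blast
  then show "(\<lambda>g. N #>\<^bsub>G\<^esub> g) ` U \<subseteq> (\<lambda>g. N #>\<^bsub>G\<^esub> g) ` topspace T" by (auto simp: topspace_T)
  have "openin T (\<Union>n\<in>N. {x \<in> topspace T. n \<otimes>\<^bsub>G\<^esub> x \<in> U})"
  proof (intro openin_Union ballI, elim imageE, hypsubst)
    fix n assume "n \<in> N"
    then have "continuous_map T (prod_topology T T) (\<lambda>x. (n, x))"
      using N_carrier topspace_T by (intro continuous_map_pairedI) auto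
    moreover have "continuous_map (prod_topology T T) T (\<lambda>(x, y). x \<otimes>\<^bsub>G\<^esub> y)"
      using topological_group by (simp add: topological_group_def)
    ultimately have "continuous_map T T (\<lambda>x. n \<otimes>\<^bsub>G\<^esub> x)"
      using continuous_map_compose[of T _ "\<lambda>x. (n, x)" T "\<lambda>(x, y). x \<otimes>\<^bsub>G\<^esub> y"] by (simp add: o_def)
    then show "openin T {x \<in> topspace T. n \<otimes>\<^bsub>G\<^esub> x \<in> U}" using U by (rule openin_continuous_map_preimage)
  qed
  moreover have "(\<Union>n\<in>N. {x \<in> topspace T. n \<otimes>\<^bsub>G\<^esub> x \<in> U})
      = {x \<in> topspace T. N #>\<^bsub>G\<^esub> x \<in> (\<lambda>g. N #>\<^bsub>G\<^esub> g) ` U}"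
  proof -
    have "N #>\<^bsub>G\<^esub> x \<in> (\<lambda>g. N #>\<^bsub>G\<^esub> g) ` U \<longleftrightarrow> (\<exists>n\<in>N. n \<otimes>\<^bsub>G\<^esub> x \<in> U)" if "x \<in> carrier G" for x
    proof
      assume "N #>\<^bsub>G\<^esub> x \<in> (\<lambda>g. N #>\<^bsub>G\<^esub> g) ` U"
      then obtain u where u: "u \<in> U" "N #>\<^bsub>G\<^esub> x = N #>\<^bsub>G\<^esub> u" by blast
      then show "\<exists>n\<in>N. n \<otimes>\<^bsub>G\<^esub> x \<in> U" using coset_eq_iff[OF that, of u] UG by blast
    next
      assume "\<exists>n\<in>N. n \<otimes>\<^bsub>G\<^esub> x \<in> U"
      then obtain n where n: "n \<in> N" "n \<otimes>\<^bsub>G\<^esub> x \<in> U" by blast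
      then have "N #>\<^bsub>G\<^esub> x = N #>\<^bsub>G\<^esub> (n \<otimes>\<^bsub>G\<^esub> x)" using coset_eq_iff[OF that, of "n \<otimes>\<^bsub>G\<^esub> x"] UG by blast
      then show "N #>\<^bsub>G\<^esub> x \<in> (\<lambda>g. N #>\<^bsub>G\<^esub> g) ` U" using n(2) by blast
    qed
    note claim = this
    show ?thesis
    proof (rule Set.set_eqI)
      fix x show "x \<in> (\<Union>n\<in>N. {x \<in> topspace T. n \<otimes>\<^bsub>G\<^esub> x \<in> U})
          \<longleftrightarrow> x \<in> {x \<in> topspace T. N #>\<^bsub>G\<^esub> x \<in> (\<lambda>g. N #>\<^bsub>G\<^esub> g) ` U}"
        using claim[of x] unfolding topspace_T by blast
    qed
  qed
  ultimately show "openin T {x \<in> topspace T. N #>\<^bsub>G\<^esub> x \<in> (\<lambda>g. N #>\<^bsub>G\<^esub> g) ` U}" by simp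
qed

lemma topspace_quot: "topspace (quot_topology G T N) = carrier (G Mod N)"
  by (auto simp: quot_topology_def topspace_T FactGroup_def RCOSETS_def)

lemma carrier_ModE:
  assumes "C \<in> carrier (G Mod N)"
  obtains g where "g \<in> carrier G" "C = N #>\<^bsub>G\<^esub> g"
  using assms by (auto simp: FactGroup_def RCOSETS_def)

text \<open>Multiplying a quotient map with an identity need not give a quotient map. The coset
  projection is an open surjection, and these are stable under such products.\<close>

lemma quotient_map_coset_prod:
  "quotient_map (prod_topology T X) (prod_topology (quot_topology G T N) X) (\<lambda>(g, x). (N #>\<^bsub>G\<^esub> g, x))"
proof (rule continuous_open_imp_quotient_map)
  let ?q = "\<lambda>(g, x). (N #>\<^bsub>G\<^esub> g, x)"
  have "continuous_map T (quot_topology G T N) (\<lambda>g. N #>\<^bsub>G\<^esub> g)"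
    unfolding quot_topology_def by (rule quotient_imp_continuous_map[OF quotient_map_final_topology])
  from continuous_map_compose[OF continuous_map_fst this]
  show "continuous_map (prod_topology T X) (prod_topology (quot_topology G T N) X) ?q"
    unfolding case_prod_beta' by (intro continuous_map_pairedI continuous_map_snd) (simp add: o_def)
  show "open_map (prod_topology T X) (prod_topology (quot_topology G T N) X) ?q"
    unfolding open_map_def
  proof (intro allI impI)
    fix U assume U: "openin (prod_topology T X) U"
    show "openin (prod_topology (quot_topology G T N) X) (?q ` U)"
      unfolding openin_prod_topology_alt
    proof (intro allI impI)
      fix C x assume "(C, x) \<in> ?q ` U"
      then obtain g where g: "(g, x) \<in> U" "C = N #>\<^bsub>G\<^esub> g" by auto
      then obtain S B where SB: "openin T S" "openin X B" "g \<in> S" "x \<in> B" "S \<times> B \<subseteq> U"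
        using U unfolding openin_prod_topology_alt by meson
      have "openin (quot_topology G T N) ((\<lambda>g. N #>\<^bsub>G\<^esub> g) ` S)"
        using open_map_coset SB(1) by (simp add: open_map_def)
      moreover have "C \<in> (\<lambda>g. N #>\<^bsub>G\<^esub> g) ` S" using g(2) SB(3) by blast
      moreover have "(\<lambda>g. N #>\<^bsub>G\<^esub> g) ` S \<times> B \<subseteq> ?q ` U"
      proof
        fix y assume "y \<in> (\<lambda>g. N #>\<^bsub>G\<^esub> g) ` S \<times> B"
        then obtain s b where "s \<in> S" "b \<in> B" "y = ?q (s, b)" by auto
        then show "y \<in> ?q ` U" using SB(5) by blast
      qed
      ultimately show "\<exists>S B. openin (quot_topology G T N) S \<and> openin X B \<and> C \<in> S \<and> x \<in> B \<and> S \<times> B \<subseteq> ?q ` U"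
        using SB(2,4) by blast
    qed
  qed
  show "?q ` topspace (prod_topology T X) = topspace (prod_topology (quot_topology G T N) X)"
    by (auto simp: quot_topology_def)
qed

theorem orthogonal_spectrum_geo_fix:
  "orthogonal_spectrum (G Mod N) (quot_topology G T N) (geo_fix G T N A)" (is "orthogonal_spectrum ?J ?TJ ?B")
  unfolding orthogonal_spectrum_def
proof (intro conjI allI ballI)
  have lev: "level ?B m = coend m" for m by (simp add: geo_fix_def)
  obtain x0 where x0: "x0 m \<in> geo_basepts G T N A m" for m using geo_basepts_nonempty by metis
  have b: "basept ?B m = cls m (x0 m)" for m by (rule basepoint_eq[OF x0])
  have x0t: "x0 m \<in> topspace (pre m)" for m using x0[of m] geo_basepts_subset by blast
  show "CGWH_space (level ?B m)" for m
    unfolding lev by (rule CGWH_cgwh_quotient[OF geo_rel_subset CGWH_pre])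
  show "basept ?B m \<in> topspace (level ?B m)" for m unfolding lev b by (rule cls_in[OF x0t])
  fix m
  show "strmap ?B m n None a = basept ?B n" if "a \<in> topspace (level ?B m)" for n a
  proof -
    from that[unfolded lev] obtain W \<psi> p where a: "is_rep W" "\<psi> \<in> omors (fx W) (Rn m)" "p \<in> ev_fixed A N W"
      "a = cls m (W, \<psi>, p)" by (rule coendE)
    then show ?thesis
      using strmap_cls[OF omors_iff(2), where W = W and \<psi> = \<psi> and p = p]
      by (simp add: omors_iff basepoint_eq[of "(W, None, p)"])
  qed
  show "strmap ?B m n \<theta> (basept ?B m) = basept ?B n" if \<theta>: "\<theta> \<in> omors (Rn m) (Rn n)" for n \<theta>
  proof -
    obtain W \<psi> p where x: "x0 m = (W, \<psi>, p)" by (cases "x0 m")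
    have xm: "(W, \<psi>, p) \<in> geo_basepts G T N A m" using x0[of m] x by simp
    then have "(W, ocomp (fx W) \<theta> \<psi>, p) \<in> geo_basepts G T N A n"
      by (auto intro!: ocomp_omors[OF \<theta>] simp: subspace_fixed_space subspace_Rn)
    then have "basept ?B n = cls n (W, ocomp (fx W) \<theta> \<psi>, p)" by (rule basepoint_eq)
    moreover have "(W, \<psi>, p) \<in> topspace (pre m)" using xm geo_basepts_subset by blast
    ultimately show ?thesis using strmap_cls[OF \<theta>] unfolding b[of m] x by simp
  qed
  show "strmap ?B m m (omor_id (Rn m)) a = a" if "a \<in> topspace (level ?B m)" for a
  proof -
    from that[unfolded lev] obtain W \<psi> p where a: "is_rep W" "\<psi> \<in> omors (fx W) (Rn m)" "p \<in> ev_fixed A N W"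
      "a = cls m (W, \<psi>, p)" by (rule coendE)
    then show ?thesis
      using strmap_cls[OF omor_id_omors[OF fd_subspace_Rn], where m = m and W = W and \<psi> = \<psi> and p = p] ocomp_id_left[OF a(2)] by simp
  qed
  show "strmap ?B l n (ocomp (Rn l) \<theta> \<phi>) a = strmap ?B m n \<theta> (strmap ?B l m \<phi> a)"
    if \<theta>: "\<theta> \<in> omors (Rn m) (Rn n)" and \<phi>: "\<phi> \<in> omors (Rn l) (Rn m)" and "a \<in> topspace (level ?B l)"
    for l n \<theta> \<phi> a
  proof -
    from that(3)[unfolded lev] obtain W \<psi> p where a: "is_rep W" "\<psi> \<in> omors (fx W) (Rn l)" "p \<in> ev_fixed A N W"
      "a = cls l (W, \<psi>, p)" by (rule coendE)
    note s = subspace_fixed_space[OF a(1)]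
    show ?thesis
      using a strmap_cls[OF \<phi>, of W \<psi> p] strmap_cls[OF \<theta>, of W "ocomp (fx W) \<phi> \<psi>" p]
        strmap_cls[OF ocomp_omors[OF \<theta> \<phi> subspace_Rn subspace_Rn], of W \<psi> p]
        ocomp_assoc[OF \<theta> \<phi> a(2) s] ocomp_omors[OF \<phi> a(2) s subspace_Rn] by simp
  qed
  show "continuous_map (prod_topology (omor_space (Rn m) (Rn n)) (level ?B m)) (level ?B n)
      (\<lambda>(\<theta>, a). strmap ?B m n \<theta> a)" for n
    unfolding lev
    by (rule continuous_map_from_prod_cgwh_quotient[OF geo_rel_subset compact_omor_space
          Hausdorff_omor_space[OF fd_subspace_Rn] strmap_cls_continuous])
      (use strmap_cls in \<open>auto simp: geo_class_def\<close>)
  show "continuous_map (prod_topology ?TJ (level ?B m)) (level ?B m) (\<lambda>(g, a). gact ?B g m a)"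
  proof -
    \<comment> \<open>Continuity is proved on T times the coend, where compactness of T lets the
      coend be lifted to representatives, and only then descends along the coset projection.\<close>
    have "continuous_map (prod_topology T (coend m)) (coend m) (\<lambda>(g, c). gact ?B (N #>\<^bsub>G\<^esub> g) m c)"
      by (rule continuous_map_from_prod_cgwh_quotient[OF geo_rel_subset compact_T Hausdorff_T pre_act_continuous])
        (use gact_cls in \<open>auto simp: geo_class_def topspace_T\<close>)
    then have "continuous_map (prod_topology T (coend m)) (coend m)
        ((\<lambda>(g, a). gact ?B g m a) \<circ> (\<lambda>(g, x). (N #>\<^bsub>G\<^esub> g, x)))"
      by (simp add: o_def case_prod_beta')
    then show ?thesis unfolding lev using continuous_compose_quotient_map[OF quotient_map_coset_prod] by blast
  qed
  have clsE: "\<exists>z\<in>topspace (pre m). a = cls m z" if "a \<in> topspace (level ?B m)" for a m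
    using that unfolding lev topspace_coend by blast
  show "gact ?B \<one>\<^bsub>?J\<^esub> m a = a" if "a \<in> topspace (level ?B m)" for a
  proof -
    from clsE[OF that] obtain z where z: "z \<in> topspace (pre m)" "a = cls m z" by blast
    have "\<one>\<^bsub>?J\<^esub> = N #>\<^bsub>G\<^esub> \<one>\<^bsub>G\<^esub>"
      using coset_mult_one[OF subgroup.subset[OF subgroup_N]] by (simp add: FactGroup_def)
    then show ?thesis using gact_cls[OF one_closed z(1)] pre_act_one[OF z(1)] z(2) by simp
  qed
  show "gact ?B (C \<otimes>\<^bsub>?J\<^esub> D) m a = gact ?B C m (gact ?B D m a)"
    if "C \<in> carrier ?J" "D \<in> carrier ?J" "a \<in> topspace (level ?B m)" for C D a
  proof -
    from clsE[OF that(3)] obtain z where z: "z \<in> topspace (pre m)" "a = cls m z" by blast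
    from that obtain g h where gh: "g \<in> carrier G" "C = N #>\<^bsub>G\<^esub> g" "h \<in> carrier G" "D = N #>\<^bsub>G\<^esub> h"
      using carrier_ModE by metis
    have "C \<otimes>\<^bsub>?J\<^esub> D = N #>\<^bsub>G\<^esub> (g \<otimes>\<^bsub>G\<^esub> h)"
      using normal.rcos_sum[OF normal_N gh(1,3)] by (simp add: gh FactGroup_def)
    then show ?thesis
      using gact_cls[OF m_closed[OF gh(1,3)] z(1)] gact_cls[OF gh(3) z(1)]
        gact_cls[OF gh(1) pre_act_in[OF gh(3) z(1)]] pre_act_mult[OF gh(1,3) z(1)] z(2) gh by simp
  qed
  show "gact ?B C m (basept ?B m) = basept ?B m" if "C \<in> carrier ?J" for C
  proof -
    from that obtain g where g: "g \<in> carrier G" "C = N #>\<^bsub>G\<^esub> g" using carrier_ModE by metis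
    then show ?thesis
      using gact_cls[OF g(1) x0t] geo_class_base[OF pre_act_basept[OF g(1) x0] x0] b by simp
  qed
  show "gact ?B C n (strmap ?B m n \<theta> a) = strmap ?B m n \<theta> (gact ?B C m a)"
    if \<theta>: "\<theta> \<in> omors (Rn m) (Rn n)" and "C \<in> carrier ?J" "a \<in> topspace (level ?B m)" for n \<theta> C a
  proof -
    from that obtain g where g: "g \<in> carrier G" "C = N #>\<^bsub>G\<^esub> g" using carrier_ModE by metis
    from that(3)[unfolded lev] obtain W \<psi> p where a: "is_rep W" "\<psi> \<in> omors (fx W) (Rn m)" "p \<in> ev_fixed A N W"
      "a = cls m (W, \<psi>, p)" by (rule coendE)
    note s = subspace_fixed_space[OF a(1)]
    have z: "(W, \<psi>, p) \<in> topspace (pre m)" "(W, ocomp (fx W) \<theta> \<psi>, p) \<in> topspace (pre n)"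
      using a ocomp_omors[OF \<theta> a(2) s subspace_Rn] by auto
    show ?thesis
      using strmap_cls[OF \<theta> z(1)] gact_cls[OF g(1) z(1)] gact_cls[OF g(1) z(2)]
        strmap_cls[OF \<theta> pre_act_in[OF g(1) z(1), unfolded pre_act_def prod.case]]
        ocomp_assoc[OF \<theta> a(2) rep_fix_omors[OF a(1) inv_closed[OF g(1)]] s] a(4) g(2)
      by (simp add: pre_act_def)
  qed
qed

end

text \<open>The abstract group K with its topology S covers two cases, H in G and H/N in G/N. In the
  second, H/N carries its own quotient topology, so continuity of the inclusion is what is
  asked.\<close>

lemma orthogonal_spectrum_res:
  assumes A: "orthogonal_spectrum G T A" and "topspace S = carrier K" "carrier K \<subseteq> carrier G"
    and "\<And>g h. g \<in> carrier K \<Longrightarrow> h \<in> carrier K \<Longrightarrow> g \<otimes>\<^bsub>K\<^esub> h = g \<otimes>\<^bsub>G\<^esub> h \<and> g \<otimes>\<^bsub>K\<^esub> h \<in> carrier K"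
    and "\<one>\<^bsub>K\<^esub> = \<one>\<^bsub>G\<^esub>" "\<one>\<^bsub>K\<^esub> \<in> carrier K" and c: "continuous_map S T id"
  shows "orthogonal_spectrum K S (res_spectrum (carrier K) A)"
proof -
  have "continuous_map (prod_topology S (level A m)) (level A m) (\<lambda>(g, a). restrict (gact A) (carrier K) g m a)" for m
  proof -
    have "continuous_map (prod_topology S (level A m)) T fst"
      using continuous_map_compose[OF continuous_map_fst c] by (simp add: o_def)
    then have "continuous_map (prod_topology S (level A m)) (prod_topology T (level A m)) (\<lambda>z. (fst z, snd z))"
      by (intro continuous_map_pairedI continuous_map_snd)
    moreover have "continuous_map (prod_topology T (level A m)) (level A m) (\<lambda>(g, a). gact A g m a)"
      using A by (simp add: orthogonal_spectrum_def)
    ultimately have "continuous_map (prod_topology S (level A m)) (level A m)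
        ((\<lambda>(g, a). gact A g m a) \<circ> (\<lambda>z. (fst z, snd z)))" by (rule continuous_map_compose)
    then show ?thesis by (rule continuous_map_eq) (auto simp: assms(2))
  qed
  moreover have "g \<otimes>\<^bsub>G\<^esub> h \<in> carrier K" "g \<otimes>\<^bsub>K\<^esub> h = g \<otimes>\<^bsub>G\<^esub> h"
    if "g \<in> carrier K" "h \<in> carrier K" for g h using assms(4)[OF that] by auto
  ultimately show ?thesis
    using A assms(3,5,6) unfolding orthogonal_spectrum_def res_spectrum_def by (simp add: subset_iff)
qed

section \<open>Functoriality of geometric fixed points in the spectrum\<close>

context
  fixes G :: "'g monoid" and T and A :: "('g, 'a) gspectrum" and B :: "('g, 'b) gspectrum" and h N
  assumes tg: "topological_group G T" and ch: "compact_space T" "Hausdorff_space T" and N: "N \<lhd> G"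
    and h: "spectrum_hom G T A B h"
begin

interpretation A: geometric_fixed_points G T A N
  using tg h ch N
  by (intro geometric_fixed_points.intro group_spectrum.intro geometric_fixed_points_axioms.intro)
    (simp_all add: spectrum_hom_def)
interpretation B: geometric_fixed_points G T B N
  using tg h ch N
  by (intro geometric_fixed_points.intro group_spectrum.intro geometric_fixed_points_axioms.intro)
    (simp_all add: spectrum_hom_def)

lemma ev_hom_fixed:
  assumes W: "orthogonal_rep G T W" and p: "p \<in> ev_fixed A N W"
  shows "ev_hom B h (fst W) p \<in> ev_fixed B N W"
  unfolding ev_fixed_def
proof (intro CollectI conjI ballI)
  show "ev_hom B h (fst W) p \<in> topspace (ev_space B (fst W))"
    by (rule ev_hom_in[OF tg h A.rep_fd[OF W] A.ev_fixedD(1)[OF p]])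
  fix n assume n: "n \<in> N"
  show "ev_act B W n (ev_hom B h (fst W) p) = ev_hom B h (fst W) p"
    using ev_hom_ev_act[OF tg h W A.N_carrier[OF n] A.ev_fixedD(1)[OF p]] A.ev_fixedD(2)[OF p n] by simp
qed

lemma geo_fix_hom_class:
  assumes z: "(W, \<psi>, p) \<in> topspace (geo_pre G T N A m)"
  shows "geo_fix_hom G T N B h m (geo_class G T N A m (W, \<psi>, p))
    = geo_class G T N B m (W, \<psi>, ev_hom B h (fst W) p)"
proof -
  let ?F = "\<lambda>(W, \<psi>, p). geo_class G T N B m (W, \<psi>, ev_hom B h (fst W) p)"
  have F: "continuous_map (A.pre m) (B.coend m) ?F"
  proof (rule A.continuous_map_from_pre)
    fix W assume W: "orthogonal_rep G T W"
    let ?E = "subtopology (ev_space A (fst W)) (ev_fixed A N W)"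
    let ?Z = "prod_topology (omor_space (fixed_space N W) (Rn m)) ?E"
    have snd: "continuous_map ?Z ?E snd" by (rule continuous_map_snd)
    then have "continuous_map ?Z (ev_space A (fst W)) snd" by (simp add: continuous_map_in_subtopology)
    from continuous_map_compose[OF this continuous_map_ev_hom[OF tg h A.rep_fd[OF W]]]
    have "continuous_map ?Z (ev_space B (fst W)) (\<lambda>z. ev_hom B h (fst W) (snd z))" by (simp add: o_def)
    then have "continuous_map ?Z (B.coend m) (\<lambda>z. geo_class G T N B m (W, fst z, ev_hom B h (fst W) (snd z)))"
      by (rule B.continuous_map_cls[OF W continuous_map_fst]) (auto intro: ev_hom_fixed[OF W])
    then show "continuous_map ?Z (B.coend m) (\<lambda>(\<psi>, p). ?F (W, \<psi>, p))" by (simp add: case_prod_beta')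
  qed
  have "the_elem (?F ` geo_class G T N A m (W, \<psi>, p)) = ?F (W, \<psi>, p)"
  proof (rule A.the_elem_cls(1)[OF F B.weak_Hausdorff_coend _ _ z])
    fix V W \<phi> \<psi> p
    assume *: "orthogonal_rep G T V" "orthogonal_rep G T W" "\<phi> \<in> fixed_omors G N V W"
      "\<psi> \<in> omors (fixed_space N W) (Rn m)" "p \<in> ev_fixed A N V"
    show "?F (V, ocomp (fixed_space N V) \<psi> (omor_fix N V \<phi>), p) = ?F (W, \<psi>, ev_map A (fst V) (fst W) \<phi> p)"
      using B.geo_class_rel[OF *(1-4) ev_hom_fixed[OF *(1,5)]]
        ev_hom_ev_map[OF tg h A.rep_fd[OF *(1)] A.rep_fd[OF *(2)] A.fixed_omors_omors[OF *(3)]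
          A.ev_fixedD(1)[OF *(5)]] by simp
  next
    fix x y assume xy: "x \<in> geo_basepts G T N A m" "y \<in> geo_basepts G T N A m"
    have b: "(\<lambda>(W, \<psi>, p). (W, \<psi>, ev_hom B h (fst W) p)) x \<in> geo_basepts G T N B m"
      if "x \<in> geo_basepts G T N A m" for x
    proof -
      obtain W \<psi> p where x: "x = (W, \<psi>, p)" by (cases x)
      then have W: "orthogonal_rep G T W" and "p = ev_base A (fst W) \<Longrightarrow> ev_hom B h (fst W) p = ev_base B (fst W)"
        using that ev_hom_base[OF tg h A.rep_fd] by auto
      then show ?thesis using that ev_hom_fixed[OF W] by (auto simp: x)
    qed
    show "?F x = ?F y" using B.geo_class_base[OF b[OF xy(1)] b[OF xy(2)]] by (simp add: case_prod_beta')
  qed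
  then show ?thesis by (simp add: geo_fix_hom_def)
qed

end

section \<open>Amalgamated sums of representations\<close>

definition even_of :: "rseq \<Rightarrow> rseq" where
  "even_of x = Abs_rseq (\<lambda>i. coord x (2 * i))"

definition odd_of :: "rseq \<Rightarrow> rseq" where
  "odd_of x = Abs_rseq (\<lambda>i. coord x (2 * i + 1))"

lemma coord_even_odd_of: "coord (even_of x) i = coord x (2 * i)" "coord (odd_of x) i = coord x (2 * i + 1)"
proof -
  have "finite ((\<lambda>i. 2 * i) -` {i. coord x i \<noteq> 0})" "finite ((\<lambda>i. 2 * i + 1) -` {i. coord x i \<noteq> 0})"
    by (intro finite_vimageI finite_coord injI; simp)+
  then have "finite {i. coord x (2 * i) \<noteq> 0}" "finite {i. coord x (2 * i + 1) \<noteq> 0}"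
    by (simp_all add: vimage_def)
  then show "coord (even_of x) i = coord x (2 * i)" "coord (odd_of x) i = coord x (2 * i + 1)"
    by (simp_all add: even_of_def odd_of_def coord_Abs)
qed

lemma even_odd_of_part [simp]:
  "even_of (even_part x + odd_part y) = x" "odd_of (even_part x + odd_part y) = y"
  "even_part (even_of z) + odd_part (odd_of z) = z"
  by (auto simp: coord_inject_ext coord_even_odd_of coord_even_odd coord_plus elim!: evenE oddE)

lemma even_odd_of_linear:
  "even_of (x + y) = even_of x + even_of y" "odd_of (x + y) = odd_of x + odd_of y"
  "even_of (c *\<^sub>R x) = c *\<^sub>R even_of x" "odd_of (c *\<^sub>R x) = c *\<^sub>R odd_of x"
  by (auto simp: coord_inject_ext coord_even_odd_of coord_plus coord_scaleR)

lemma inner_even_odd_sum: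
  "inner (even_part x + odd_part y) (even_part x' + odd_part y') = inner x x' + inner y y'"
  by (simp add: inner_add_left inner_add_right inner_even_odd)

lemma inner_even_odd_of: "inner x y = inner (even_of x) (even_of y) + inner (odd_of x) (odd_of y)"
  using inner_even_odd_sum[of "even_of x" "odd_of x" "even_of y" "odd_of y"] by simp

lemma even_odd_part_linear:
  "even_part (x + y) = even_part x + even_part y" "odd_part (x + y) = odd_part x + odd_part y"
  "even_part (c *\<^sub>R x) = c *\<^sub>R even_part x" "odd_part (c *\<^sub>R x) = c *\<^sub>R odd_part x"
  using linear_even_odd by (simp_all add: linear_add linear_cmul)

lemma even_odd_zero [simp]: "even_part 0 = 0" "odd_part 0 = 0"
  using linear_even_odd by (simp_all add: linear_0)

lemma even_odd_of_even_part: "even_of (even_part x) = x" "odd_of (even_part x) = 0"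
  using even_odd_of_part(1,2)[of x 0] by simp_all

text \<open>The ambient space is infinite dimensional, so linearity alone gives no continuity; none
  of the four maps increases norms.\<close>

lemma continuous_even_odd:
  "continuous_on UNIV even_part" "continuous_on UNIV odd_part" "continuous_on UNIV even_of" "continuous_on UNIV odd_of"
proof -
  have n: "norm (even_part x) = norm x" "norm (odd_part x) = norm x" for x
    by (simp_all add: norm_eq_sqrt_inner inner_even_odd)
  have m: "norm (even_of x) \<le> norm x" "norm (odd_of x) \<le> norm x" for x
    using inner_even_odd_of[of x x] by (simp_all add: norm_eq_sqrt_inner)
  have "bounded_linear even_part" "bounded_linear odd_part" "bounded_linear even_of" "bounded_linear odd_of"
    using n m by (auto intro!: bounded_linear_intro[where K = 1] simp: even_odd_part_linear even_odd_of_linear)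
  then show "continuous_on UNIV even_part" "continuous_on UNIV odd_part" "continuous_on UNIV even_of"
    "continuous_on UNIV odd_of"
    by (simp_all add: linear_continuous_on)
qed

lemma continuous_map_compose_on:
  assumes "continuous_map Z euclidean g" "continuous_on UNIV f"
  shows "continuous_map Z euclidean (\<lambda>z. f (g z))"
  using continuous_map_compose[OF assms(1), of euclidean f] assms(2) by (simp add: o_def)

lemma projection_linear:
  "projection C (x + y) = projection C x + projection C y"
  "projection C (c *\<^sub>R x) = c *\<^sub>R projection C x"
  by (simp_all add: projection_def inner_add_left scaleR_add_left sum.distrib scaleR_sum_right)

text \<open>The projection is characterized without reference to the basis, so that it can be
  compared with its translates under the group.\<close>

lemma projection_unique:
  assumes C: "finite C" "orthonormal C" and u: "u \<in> span C" "\<And>w. w \<in> span C \<Longrightarrow> inner w (v - u) = 0"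
  shows "projection C v = u"
proof -
  let ?d = "projection C v - u"
  have d: "?d \<in> span C" using projection_in_span u(1) by (rule span_diff)
  have "inner ?d ?d = inner ?d (v - u) - inner ?d (v - projection C v)" by (simp add: inner_diff_right)
  also have "\<dots> = 0" using u(2)[OF d] projection_orthogonal[OF C d] by simp
  finally show ?thesis by simp
qed

lemma isoms_inverse:
  assumes g: "g \<in> isoms U W" and U: "subspace U" and s: "g ` U = W"
  obtains g' where "g' \<in> isoms W U" "\<And>u. u \<in> U \<Longrightarrow> g' (g u) = u" "\<And>w. w \<in> W \<Longrightarrow> g (g' w) = w"
proof
  show "restrict (inv_into U g) W \<in> isoms W U" by (rule isoms_inv[OF g s U])
  show "restrict (inv_into U g) W (g u) = u" if "u \<in> U" for u
    using that s inv_into_f_f[OF isoms_inj[OF g U] that] by auto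
  show "g (restrict (inv_into U g) W w) = w" if "w \<in> W" for w
    using that s f_inv_into_f[of w g U] by simp
qed

context geometric_fixed_points
begin

text \<open>
  The sum of \<open>V1\<close> and \<open>V2\<close> amalgamated along the \<open>N\<close>-space \<open>S\<close> is realized as the sum of \<open>V2\<close> and
  the orthogonal complement of \<open>S\<close> in \<open>V1\<close>. As \<open>S\<close> contains the fixed points of \<open>V1\<close>, the
  amalgamated sum has the same fixed points as \<open>V2\<close>.
\<close>

lemma amalgamated_sum:
  assumes V1: "is_rep V1" and V2: "is_rep V2" and S: "subspace S"
    and e: "e \<in> isoms S (fst V1)" and f: "f \<in> isoms S (fst V2)"
    and \<sigma>: "\<And>n s. n \<in> N \<Longrightarrow> s \<in> S \<Longrightarrow> \<sigma> n s \<in> S \<and> e (\<sigma> n s) = snd V1 n (e s) \<and> f (\<sigma> n s) = snd V2 n (f s)"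
    and fix1: "fx V1 \<subseteq> e ` S"
  obtains P a b where "orthogonal_rep (subgrp G N) (subtopology T N) P"
    "a \<in> isoms (fst V1) (fst P)" "b \<in> isoms (fst V2) (fst P)"
    "\<And>s. s \<in> S \<Longrightarrow> a (e s) = b (f s)"
    "\<And>v x. v \<in> fst V1 \<Longrightarrow> x \<in> fst V2 \<Longrightarrow> (\<And>s. s \<in> S \<Longrightarrow> inner (f s) x = 0) \<Longrightarrow> inner (a v) (b x) = 0"
    "\<And>n v. n \<in> N \<Longrightarrow> v \<in> fst V1 \<Longrightarrow> a (snd V1 n v) = snd P n (a v)"
    "\<And>n v. n \<in> N \<Longrightarrow> v \<in> fst V2 \<Longrightarrow> b (snd V2 n v) = snd P n (b v)"
    "b ` fx V2 = fx P"
proof -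
  let ?V1 = "fst V1" and ?V2 = "fst V2" let ?\<rho>1 = "snd V1" and ?\<rho>2 = "snd V2"
  note fd1 = rep_fd[OF V1] and fd2 = rep_fd[OF V2]
  note s1 = fd_subspace_imp_subspace[OF fd1] and s2 = fd_subspace_imp_subspace[OF fd2]
  have r1: "?\<rho>1 n \<in> isoms ?V1 ?V1" and r2: "?\<rho>2 n \<in> isoms ?V2 ?V2" if "n \<in> N" for n
    using rep_isom V1 V2 N_carrier that by blast+
  have inv: "inv\<^bsub>G\<^esub> n \<in> N" if "n \<in> N" for n using subgroup.m_inv_closed[OF subgroup_N that] .
  define E where "E = e ` S"
  have sE: "subspace E" unfolding E_def by (rule subspace_isoms_image[OF e S])
  have E1: "E \<subseteq> ?V1" using isomsD(1)[OF e] by (auto simp: E_def)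
  obtain C where C: "finite C" "orthonormal C" "E = span C"
    using fd_subspace_orthonormal[OF fd_subspace_subset[OF sE E1 fd1]] by blast
  define pr where "pr = projection C"
  have prE: "pr v \<in> E" for v unfolding pr_def C(3) by (rule projection_in_span)
  have pr1: "pr v \<in> ?V1" for v using prE E1 by blast
  have orth: "inner u (v - pr v) = 0" if "u \<in> E" for u v
    using projection_orthogonal[OF C(1,2)] that by (simp add: pr_def C(3))
  have pr_id: "pr v = v" if "v \<in> E" for v
    using projection_ident[OF C(1,2)] that by (simp add: pr_def C(3))
  have pr_un: "pr v = u" if "u \<in> E" "\<And>w. w \<in> E \<Longrightarrow> inner w (v - u) = 0" for u v
    using projection_unique[OF C(1,2)] that by (simp add: pr_def C(3))
  have pr_add: "pr (x + y) = pr x + pr y" and pr_sc: "pr (c *\<^sub>R x) = c *\<^sub>R pr x" for x y c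
    by (simp_all add: pr_def projection_linear)
  have \<rho>E: "?\<rho>1 n u \<in> E" if n: "n \<in> N" and "u \<in> E" for n u
    using that \<sigma>[OF n] by (force simp: E_def)
  \<comment> \<open>\<open>pr\<close> is N-linear: \<open>E\<close> is N-invariant, so orthogonality
    to \<open>E\<close> can be tested after applying the inverse of n.\<close>
  have pr_eq: "pr (?\<rho>1 n v) = ?\<rho>1 n (pr v)" if n: "n \<in> N" and v: "v \<in> ?V1" for n v
  proof (rule pr_un[OF \<rho>E[OF n prE]])
    fix w assume w: "w \<in> E"
    have d: "v - pr v \<in> ?V1" using v pr1 s1 by (simp add: subspace_diff)
    have w1: "w \<in> ?V1" using w E1 by blast
    have iw: "?\<rho>1 (inv\<^bsub>G\<^esub> n) w \<in> E" by (rule \<rho>E[OF inv[OF n] w])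
    have "inner w (?\<rho>1 n v - ?\<rho>1 n (pr v)) = inner (?\<rho>1 n (?\<rho>1 (inv\<^bsub>G\<^esub> n) w)) (?\<rho>1 n (v - pr v))"
      using isoms_diff[OF r1[OF n] s1 v pr1] rep_inv(1)[OF V1 N_carrier[OF n] w1] by simp
    also have "\<dots> = inner (?\<rho>1 (inv\<^bsub>G\<^esub> n) w) (v - pr v)"
      using isomsD(4)[OF r1[OF n] _ d] iw E1 by blast
    also have "\<dots> = 0" by (rule orth[OF iw])
    finally show "inner w (?\<rho>1 n v - ?\<rho>1 n (pr v)) = 0" .
  qed
  \<comment> \<open>The orthogonal complement of \<open>E\<close> in \<open>V1\<close>. As the
    kernel of \<open>pr\<close> it inherits linearity and N-invariance.\<close>
  define D where "D = {v \<in> ?V1. pr v = 0}"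
  have sD: "subspace D"
    using s1 pr_add pr_sc pr_sc[of 0 0] by (auto simp: D_def subspace_def)
  have D1: "D \<subseteq> ?V1" by (auto simp: D_def)
  have fdD: "fd_subspace D" by (rule fd_subspace_subset[OF sD D1 fd1])
  have rem: "v - pr v \<in> D" if "v \<in> ?V1" for v
    using that pr1 s1 pr_add[of "v - pr v" "pr v"] pr_id[OF prE] by (simp add: D_def subspace_diff)
  have \<rho>D: "?\<rho>1 n u \<in> D" if "n \<in> N" "u \<in> D" for n u
    using that pr_eq isomsD(1)[OF r1] isoms_zero[OF r1 s1] by (auto simp: D_def)
  have eE: "e \<in> isoms S E"
    using isomsD[OF e] by (intro isomsI) (auto simp: E_def)
  obtain ei where ei: "ei \<in> isoms E S" "\<And>u. u \<in> S \<Longrightarrow> ei (e u) = u" "\<And>w. w \<in> E \<Longrightarrow> e (ei w) = w"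
    using isoms_inverse[OF eE S E_def[symmetric]] by blast
  have eiS: "ei (pr v) \<in> S" for v using isomsD(1)[OF ei(1) prE] .

  \<comment> \<open>\<open>V2\<close> occupies the even positions and the complement
    \<open>D\<close> the odd ones, which makes the sum orthogonal.\<close>
  define P where "P = {even_part v + odd_part u |v u. v \<in> ?V2 \<and> u \<in> D}"
  have fdP: "fd_subspace P" unfolding P_def by (rule fd_subspace_orthogonal_sum[OF fd2 fdD])
  have P_iff: "x \<in> P \<longleftrightarrow> even_of x \<in> ?V2 \<and> odd_of x \<in> D" for x
  proof
    assume "even_of x \<in> ?V2 \<and> odd_of x \<in> D"
    then have "even_part (even_of x) + odd_part (odd_of x) \<in> P" unfolding P_def by blast
    then show "x \<in> P" by simp
  qed (auto simp: P_def)
  define t where "t n = (\<lambda>x\<in>P. even_part (?\<rho>2 n (even_of x)) + odd_part (?\<rho>1 n (odd_of x)))" for n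
  define \<tau> where "\<tau> = restrict t N"
  have t_sum: "t n (even_part v + odd_part u) = even_part (?\<rho>2 n v) + odd_part (?\<rho>1 n u)"
    if "v \<in> ?V2" "u \<in> D" for n v u using that by (simp add: t_def P_iff)
  have t_isom: "t n \<in> isoms P P" if n: "n \<in> N" for n
  proof (rule isomsI)
    fix x y c assume x: "x \<in> P" and y: "y \<in> P"
    have ex: "even_of x \<in> ?V2" "even_of y \<in> ?V2" "odd_of x \<in> D" "odd_of y \<in> D"
      using x y by (auto simp: P_iff)
    have ox: "odd_of x \<in> ?V1" "odd_of y \<in> ?V1" using ex D1 by auto
    show "t n x \<in> P" using x ex isomsD(1)[OF r2[OF n]] \<rho>D[OF n] by (simp add: t_def P_iff)
    have "x + y \<in> P" "c *\<^sub>R x \<in> P"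
      using x y fd_subspace_imp_subspace[OF fdP] by (auto simp: subspace_add subspace_scale)
    then show "t n (x + y) = t n x + t n y" "t n (c *\<^sub>R x) = c *\<^sub>R t n x"
      using x y ex ox by (simp_all add: t_def even_odd_of_linear isomsD(2,3)[OF r2[OF n]]
          isomsD(2,3)[OF r1[OF n]] even_odd_part_linear algebra_simps)
    show "inner (t n x) (t n y) = inner x y"
      using x y ex ox inner_even_odd_of[of x y]
      by (simp add: t_def inner_even_odd_sum isomsD(4)[OF r2[OF n]] isomsD(4)[OF r1[OF n]])
  qed (simp add: t_def)
  have t_one: "t \<one>\<^bsub>G\<^esub> x = x" if "x \<in> P" for x
    using that D1 rep_one[OF V1] rep_one[OF V2] by (auto simp: t_def P_iff subset_iff)
  have t_mult: "t (n \<otimes>\<^bsub>G\<^esub> k) x = t n (t k x)" if n: "n \<in> N" and k: "k \<in> N" and x: "x \<in> P" for n k x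
  proof -
    have "even_of x \<in> ?V2" "odd_of x \<in> D" using x by (auto simp: P_iff)
    moreover from this have "?\<rho>2 k (even_of x) \<in> ?V2" "?\<rho>1 k (odd_of x) \<in> D"
      using isomsD(1)[OF r2[OF k]] \<rho>D[OF k] by auto
    ultimately show ?thesis
      using x t_sum D1 rep_mult[OF V1 N_carrier[OF n] N_carrier[OF k], of "odd_of x"]
        rep_mult[OF V2 N_carrier[OF n] N_carrier[OF k], of "even_of x"]
      by (auto simp: t_def[of "n \<otimes>\<^bsub>G\<^esub> k"] t_def[of k])
  qed
  have t_cont: "continuous_map (prod_topology (subtopology T N) (top_of_set P)) (top_of_set P) (\<lambda>(n, x). \<tau> n x)"
  proof -
    let ?Z = "prod_topology (subtopology T N) (top_of_set P)"
    have c: "continuous_map ?Z T fst" "continuous_map ?Z euclidean snd"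
      using continuous_map_fst[of "subtopology T N" "top_of_set P"] continuous_map_snd[of "subtopology T N" "top_of_set P"]
      by (simp_all add: continuous_map_in_subtopology)
    have ce: "continuous_map ?Z euclidean (\<lambda>z. even_of (snd z))" "continuous_map ?Z euclidean (\<lambda>z. odd_of (snd z))"
      by (intro continuous_map_compose_on[OF c(2)] continuous_even_odd)+
    have cr: "continuous_map ?Z (isom_space ?V1 ?V1) (\<lambda>z. ?\<rho>1 (fst z))"
      "continuous_map ?Z (isom_space ?V2 ?V2) (\<lambda>z. ?\<rho>2 (fst z))"
      using continuous_map_compose[OF c(1) continuous_map_rep[OF V1]]
        continuous_map_compose[OF c(1) continuous_map_rep[OF V2]] by (simp_all add: o_def)
    have m: "even_of (snd z) \<in> ?V2" "odd_of (snd z) \<in> ?V1" if "z \<in> topspace ?Z" for z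
      using that D1 by (auto simp: P_iff)
    have "continuous_map ?Z euclidean
        (\<lambda>z. even_part (?\<rho>2 (fst z) (even_of (snd z))) + odd_part (?\<rho>1 (fst z) (odd_of (snd z))))"
      using m by (intro continuous_map_add continuous_map_compose_on[OF _ continuous_even_odd(1)]
          continuous_map_compose_on[OF _ continuous_even_odd(2)] continuous_map_isom_eval[OF cr(1) ce(2) _ s1]
          continuous_map_isom_eval[OF cr(2) ce(1) _ s2])
    then have "continuous_map ?Z euclidean (\<lambda>(n, x). \<tau> n x)"
      by (rule continuous_map_eq) (auto simp: \<tau>_def t_def)
    moreover have "(\<lambda>(n, x). \<tau> n x) \<in> topspace ?Z \<rightarrow> P"
      using isomsD(1)[OF t_isom] by (auto simp: \<tau>_def)
    ultimately show ?thesis by (auto simp: continuous_map_in_subtopology)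
  qed
  have \<tau>: "\<tau> \<in> N \<rightarrow>\<^sub>E isoms P P" "\<And>n. n \<in> N \<Longrightarrow> \<tau> n = t n" using t_isom by (auto simp: \<tau>_def)
  have repP: "orthogonal_rep (subgrp G N) (subtopology T N) (P, \<tau>)"
    unfolding orthogonal_rep_def prod.case
    using fdP \<tau> t_one t_mult t_cont subgroup.one_closed[OF subgroup_N] subgroup.m_closed[OF subgroup_N]
    by simp
  \<comment> \<open>A vector of \<open>V1\<close> is split along \<open>E\<close> and
    \<open>D\<close>. The part in \<open>E\<close> comes from \<open>S\<close> and is placed in
    \<open>V2\<close> by \<open>f\<close>, so that \<open>a\<close> and \<open>b\<close> agree on
    \<open>S\<close>; the part in \<open>D\<close> is left as it is.\<close>
  define a where "a = (\<lambda>v\<in>?V1. even_part (f (ei (pr v))) + odd_part (v - pr v))"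
  define b where "b = (\<lambda>v\<in>?V2. even_part v)"
  have f_ei: "f (ei (pr v)) \<in> ?V2" for v using isomsD(1)[OF f eiS] .
  have inn: "inner (f (ei (pr v))) (f (ei (pr w))) = inner (pr v) (pr w)" for v w
    using isomsD(4)[OF f eiS eiS] isomsD(4)[OF ei(1) prE prE] by simp
  have split: "inner v w = inner (pr v) (pr w) + inner (v - pr v) (w - pr w)" for v w
  proof -
    have "inner (pr v) (w - pr w) = 0" "inner (v - pr v) (pr w) = 0"
      using orth[OF prE] by (simp_all add: inner_commute)
    then have "inner (pr v + (v - pr v)) (pr w + (w - pr w)) = inner (pr v) (pr w) + inner (v - pr v) (w - pr w)"
      unfolding inner_add_left inner_add_right by simp
    then show ?thesis by simp
  qed
  have aP: "a \<in> isoms ?V1 P"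
  proof (rule isomsI)
    fix v w c assume v: "v \<in> ?V1" and w: "w \<in> ?V1"
    show "a v \<in> P" using v f_ei rem by (simp add: a_def P_iff)
    have "f (ei (pr (v + w))) = f (ei (pr v)) + f (ei (pr w))"
      using isomsD(2)[OF ei(1) prE prE] isomsD(2)[OF f eiS eiS] by (simp add: pr_add)
    then show "a (v + w) = a v + a w"
      using v w s1 even_odd_part_linear(2)[of "v - pr v" "w - pr w"]
      by (simp add: a_def subspace_add pr_add even_odd_part_linear(1) algebra_simps)
    have "f (ei (pr (c *\<^sub>R v))) = c *\<^sub>R f (ei (pr v))"
      using isomsD(3)[OF ei(1) prE] isomsD(3)[OF f eiS] by (simp add: pr_sc)
    then show "a (c *\<^sub>R v) = c *\<^sub>R a v"
      using v s1 even_odd_part_linear(4)[of c "v - pr v"]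
      by (simp add: a_def subspace_scale pr_sc even_odd_part_linear(3) algebra_simps)
    show "inner (a v) (a w) = inner v w"
      using v w split[of v w] by (simp add: a_def inner_even_odd_sum inn)
  qed (simp add: a_def)
  have bP: "b \<in> isoms ?V2 P"
    by (rule isomsI) (auto simp: b_def P_iff even_odd_of_even_part subspace_0[OF sD] subspace_add[OF s2]
        subspace_scale[OF s2] even_odd_part_linear inner_even_odd)
  show ?thesis
  proof (rule that[OF repP, of a b])
    show "a \<in> isoms ?V1 (fst (P, \<tau>))" "b \<in> isoms ?V2 (fst (P, \<tau>))" using aP bP by simp_all
    show "a (e s) = b (f s)" if s: "s \<in> S" for s
    proof -
      have "e s \<in> E" using s by (simp add: E_def)
      then show ?thesis
        using pr_id ei(2)[OF s] isomsD(1)[OF e s] isomsD(1)[OF f s] by (simp add: a_def b_def)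
    qed
    show "inner (a v) (b x) = 0" if "v \<in> ?V1" "x \<in> ?V2" "\<And>s. s \<in> S \<Longrightarrow> inner (f s) x = 0" for v x
      using that eiS by (simp add: a_def b_def inner_add_left inner_even_odd)
    show "b (?\<rho>2 n v) = snd (P, \<tau>) n (b v)" if n: "n \<in> N" and v: "v \<in> ?V2" for n v
      using t_sum[OF v subspace_0[OF sD], of n] v n isomsD(1)[OF r2[OF n] v] isoms_zero[OF r1[OF n] s1]
      by (simp add: b_def \<tau>_def)
    show "a (?\<rho>1 n v) = snd (P, \<tau>) n (a v)" if n: "n \<in> N" and v: "v \<in> ?V1" for n v
    proof -
      have "?\<rho>1 n (pr v) = e (\<sigma> n (ei (pr v)))" using \<sigma>[OF n eiS] ei(3)[OF prE] by simp
      then have "ei (?\<rho>1 n (pr v)) = \<sigma> n (ei (pr v))"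
        by (simp only: ei(2)[OF \<sigma>[OF n eiS, THEN conjunct1]])
      then have "f (ei (?\<rho>1 n (pr v))) = ?\<rho>2 n (f (ei (pr v)))" using \<sigma>[OF n eiS] by simp
      then show ?thesis
        using t_sum[OF f_ei rem[OF v], of n] isoms_diff[OF r1[OF n] s1 v pr1] pr_eq[OF n v]
          isomsD(1)[OF r1[OF n] v] n v by (simp add: a_def \<tau>_def)
    qed
    show "b ` fx V2 = fx (P, \<tau>)"
    proof
      show "b ` fx V2 \<subseteq> fx (P, \<tau>)"
      proof
        fix y assume "y \<in> b ` fx V2"
        then obtain v where v: "v \<in> fx V2" "y = b v" by blast
        have v2: "v \<in> ?V2" using v(1) by (rule fixed_spaceD)
        have "y \<in> P" using isomsD(1)[OF bP v2] v(2) by simp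
        moreover have "\<tau> n y = y" if n: "n \<in> N" for n
          using t_sum[OF v2 subspace_0[OF sD], of n] v2 n v(2) fixed_spaceD(2)[OF v(1) n]
            isoms_zero[OF r1[OF n] s1] by (simp add: b_def \<tau>_def)
        ultimately show "y \<in> fx (P, \<tau>)" by (simp add: fixed_space_def)
      qed
      show "fx (P, \<tau>) \<subseteq> b ` fx V2"
      proof
        fix y assume y: "y \<in> fx (P, \<tau>)"
        then have yP: "y \<in> P" and ty: "t n y = y" if "n \<in> N" for n using that by (auto simp: fixed_space_def \<tau>_def)
        have yP: "y \<in> P" using y by (simp add: fixed_space_def)
        then have ey: "even_of y \<in> ?V2" and oy: "odd_of y \<in> D" by (auto simp: P_iff)
        have "?\<rho>2 n (even_of y) = even_of y \<and> ?\<rho>1 n (odd_of y) = odd_of y" if n: "n \<in> N" for n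
        proof -
          have "even_part (?\<rho>2 n (even_of y)) + odd_part (?\<rho>1 n (odd_of y)) = y"
            using t_sum[OF ey oy, of n] ty[OF n] by simp
          then show ?thesis
            using even_odd_of_part(1,2)[of "?\<rho>2 n (even_of y)" "?\<rho>1 n (odd_of y)"] by (simp only:)
        qed
        then have "even_of y \<in> fx V2" and o1: "odd_of y \<in> fx V1"
          using ey oy D1 by (auto simp: fixed_space_def)
        \<comment> \<open>A fixed vector of the complement lies in \<open>E\<close> by
          \<open>fix1\<close>, hence is zero: the odd summand contributes no fixed vectors.\<close>
        moreover have "odd_of y \<in> E" using o1 fix1 by (auto simp: E_def)
        then have "odd_of y = 0" using pr_id[of "odd_of y"] oy by (simp add: D_def)
        then have "y = b (even_of y)" using ey even_odd_of_part(3)[of y] by (simp add: b_def)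
        ultimately show "y \<in> b ` fx V2" by blast
      qed
    qed
  qed
qed

end

section \<open>Restriction to subgroups\<close>

lemma res_spectrum_simps [simp]:
  "level (res_spectrum H A) = level A" "basept (res_spectrum H A) = basept A"
  "strmap (res_spectrum H A) = strmap A" "g \<in> H \<Longrightarrow> gact (res_spectrum H A) g = gact A g"
  by (simp_all add: res_spectrum_def)

lemma ev_res [simp]:
  "ev_class (res_spectrum H A) = ev_class A" "ev_space (res_spectrum H A) = ev_space A"
  "ev_base (res_spectrum H A) = ev_base A" "ev_map (res_spectrum H A) = ev_map A"
  "ev_hom (res_spectrum H A) h = ev_hom A h"
proof -
  have pre: "ev_pre (res_spectrum H A) = ev_pre A" "ev_rel (res_spectrum H A) = ev_rel A"
    by (simp_all add: fun_eq_iff ev_pre_def ev_rel_def)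
  then show cl: "ev_class (res_spectrum H A) = ev_class A" "ev_space (res_spectrum H A) = ev_space A"
    by (simp_all add: fun_eq_iff ev_class_def ev_space_def)
  then show "ev_base (res_spectrum H A) = ev_base A" "ev_map (res_spectrum H A) = ev_map A"
    "ev_hom (res_spectrum H A) h = ev_hom A h"
    by (simp_all add: fun_eq_iff ev_base_def ev_map_def ev_hom_def)
qed

lemma fst_res_rep [simp]: "fst (res_rep H V) = fst V"
  and snd_res_rep [simp]: "g \<in> H \<Longrightarrow> snd (res_rep H V) g = snd V g"
  by (simp_all add: res_rep_def)

lemma ev_act_res [simp]: "g \<in> H \<Longrightarrow> ev_act (res_spectrum H A) (res_rep H V) g p = ev_act A V g p"
  by (simp add: ev_act_def)

lemma fixed_space_res:
  assumes "N \<subseteq> H"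
  shows "fixed_space N (res_rep H V) = fixed_space N V"
  unfolding fixed_space_def fst_res_rep
  by (intro Collect_cong conj_cong ball_cong refl) (use assms in \<open>simp add: subset_iff\<close>)

lemma ev_fixed_res:
  assumes "N \<subseteq> H"
  shows "ev_fixed (res_spectrum H A) N (res_rep H V) = ev_fixed A N V"
  unfolding ev_fixed_def fst_res_rep ev_res
  by (intro Collect_cong conj_cong ball_cong refl) (use assms in \<open>simp add: subset_iff\<close>)

lemma omor_fix_res: "N \<subseteq> H \<Longrightarrow> omor_fix N (res_rep H V) = omor_fix N V"
  by (simp add: fun_eq_iff omor_fix_def fixed_space_res)

lemma orthogonal_rep_res:
  assumes V: "orthogonal_rep G T V" and H: "subgroup H G"
  shows "orthogonal_rep (subgrp G H) (subtopology T H) (res_rep H V)"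
proof -
  have HG: "h \<in> carrier G" if "h \<in> H" for h using subgroup.mem_carrier[OF H that] .
  have "continuous_map (prod_topology T (top_of_set (fst V))) (top_of_set (fst V)) (\<lambda>(g, v). snd V g v)"
    using V by (simp add: orthogonal_rep_def case_prod_beta)
  then have "continuous_map (prod_topology (subtopology T H) (top_of_set (fst V))) (top_of_set (fst V)) (\<lambda>(g, v). snd V g v)"
    unfolding prod_topology_subtopology(1) by (rule continuous_map_from_subtopology)
  then have "continuous_map (prod_topology (subtopology T H) (top_of_set (fst V))) (top_of_set (fst V))
      (\<lambda>(g, v). restrict (snd V) H g v)"
    by (rule continuous_map_eq) auto
  then show ?thesis
    using V HG subgroup.one_closed[OF H] subgroup.m_closed[OF H]
    unfolding orthogonal_rep_def case_prod_beta' res_rep_def fst_conv snd_conv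
    by (simp add: PiE_iff)
qed

text \<open>The inverse of a bijection that respects structure maps and action respects them too. A
  continuous levelwise inverse is therefore enough, even if its formula involves choices.\<close>

lemma spectrum_isoI:
  assumes h: "spectrum_hom G T A B h"
    and k: "\<And>m. continuous_map (level B m) (level A m) (k m)"
    and kh: "\<And>m a. a \<in> topspace (level A m) \<Longrightarrow> k m (h m a) = a"
    and hk: "\<And>m b. b \<in> topspace (level B m) \<Longrightarrow> h m (k m b) = b"
    and T: "topspace T = carrier G"
  shows "spectrum_iso G T A B h"
proof -
  have A: "orthogonal_spectrum G T A" and B: "orthogonal_spectrum G T B"
    using h by (auto simp: spectrum_hom_def)
  have kin: "k m b \<in> topspace (level A m)" if "b \<in> topspace (level B m)" for m b
    using continuous_map_funspace[OF k] that by blast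
  have base: "basept A m \<in> topspace (level A m)" "h m (basept A m) = basept B m" for m
    using A h by (auto simp: orthogonal_spectrum_def spectrum_hom_def)
  have strA: "strmap A m n \<theta> a \<in> topspace (level A n)"
    if "\<theta> \<in> omors (Rn m) (Rn n)" "a \<in> topspace (level A m)" for m n \<theta> a
  proof -
    have "continuous_map (prod_topology (omor_space (Rn m) (Rn n)) (level A m)) (level A n)
        (\<lambda>(\<theta>, a). strmap A m n \<theta> a)" using A by (simp add: orthogonal_spectrum_def)
    from funcset_mem[OF continuous_map_funspace[OF this], of "(\<theta>, a)"] show ?thesis using that by simp
  qed
  have actA: "gact A g m a \<in> topspace (level A m)" if "g \<in> carrier G" "a \<in> topspace (level A m)" for g m a
  proof -
    have "continuous_map (prod_topology T (level A m)) (level A m) (\<lambda>(g, a). gact A g m a)"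
      using A by (simp add: orthogonal_spectrum_def)
    from funcset_mem[OF continuous_map_funspace[OF this], of "(g, a)"] show ?thesis using that T by simp
  qed
  have "k n (strmap B m n \<theta> b) = strmap A m n \<theta> (k m b)"
    if "\<theta> \<in> omors (Rn m) (Rn n)" "b \<in> topspace (level B m)" for m n \<theta> b
  proof -
    have "h n (strmap A m n \<theta> (k m b)) = strmap B m n \<theta> b"
      using h that kin hk by (simp add: spectrum_hom_def)
    then show ?thesis using kh[OF strA[OF that(1) kin[OF that(2)]]] by simp
  qed
  moreover have "k m (gact B g m b) = gact A g m (k m b)"
    if "g \<in> carrier G" "b \<in> topspace (level B m)" for g m b
  proof -
    have "h m (gact A g m (k m b)) = gact B g m b"
      using h that kin hk by (simp add: spectrum_hom_def)
    then show ?thesis using kh[OF actA[OF that(1) kin[OF that(2)]]] by simp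
  qed
  moreover have "k m (basept B m) = basept A m" for m using kh[OF base(1)] base(2) by simp
  ultimately have "spectrum_hom G T B A k"
    using A B k by (simp add: spectrum_hom_def)
  then show ?thesis using h kh hk unfolding spectrum_iso_def by blast
qed

locale comparison =
  fixes G :: "'g monoid" and T :: "'g topology" and N H :: "'g set" and Y :: "('g, 'a) gspectrum"
  assumes top_group: "topological_group G T" and compact: "compact_space T" and Hausdorff: "Hausdorff_space T"
    and H: "subgroup H G" and closed_H: "closedin T H" and N: "N \<lhd> G" and NH: "N \<subseteq> H"
    and final: "orthogonally_final G T N" and Y: "orthogonal_spectrum G T Y"
begin

abbreviation "K \<equiv> subgrp G H"
abbreviation "TH \<equiv> subtopology T H"
abbreviation "X \<equiv> res_spectrum H Y"

lemma group_G: "group G" and topspace_G: "topspace T = carrier G"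
  using top_group by (auto simp: topological_group_def)

lemma H_carrier: "H \<subseteq> carrier G" by (rule subgroup.subset[OF H])

lemma topspace_TH: "topspace TH = H"
  using H_carrier topspace_G by auto

lemma top_group_K: "topological_group K TH"
  unfolding topological_group_def
proof (intro conjI)
  show "group K" by (rule subgroup.subgroup_is_group[OF H group_G])
  show "topspace TH = carrier K" using topspace_TH by simp
  have m: "continuous_map (prod_topology T T) T (\<lambda>(x, y). x \<otimes>\<^bsub>G\<^esub> y)" and i: "continuous_map T T (\<lambda>x. inv\<^bsub>G\<^esub> x)"
    using top_group by (auto simp: topological_group_def)
  show "continuous_map (prod_topology TH TH) TH (\<lambda>(x, y). x \<otimes>\<^bsub>K\<^esub> y)"
    unfolding subtopology_Times[symmetric] continuous_map_in_subtopology
    using continuous_map_from_subtopology[OF m] subgroup.m_closed[OF H] by auto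
  have "continuous_map TH TH (\<lambda>x. inv\<^bsub>G\<^esub> x)"
    unfolding continuous_map_in_subtopology
    using continuous_map_from_subtopology[OF i] subgroup.m_inv_closed[OF H] by auto
  then show "continuous_map TH TH (\<lambda>x. inv\<^bsub>K\<^esub> x)"
    by (rule continuous_map_eq) (use group.m_inv_consistent[OF group_G H] topspace_TH in auto)
qed

lemma compact_TH: "compact_space TH" and Hausdorff_TH: "Hausdorff_space TH"
  using compact Hausdorff closed_H
  by (simp_all add: closedin_compact_space compact_space_subtopology Hausdorff_space_subtopology)

lemma normal_K: "N \<lhd> K"
  by (rule group.normal_restrict_supergroup[OF group_G H N NH])

lemma spectrum_res:
  fixes A :: "('g, 'x) gspectrum"
  assumes "orthogonal_spectrum G T A"
  shows "orthogonal_spectrum K TH (res_spectrum H A)"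
  using orthogonal_spectrum_res[OF assms, of TH K] topspace_TH H_carrier subgroup.m_closed[OF H]
    subgroup.one_closed[OF H] by (simp add: continuous_map_from_subtopology)

lemma spectrum_hom_res:
  assumes "spectrum_hom G T A B h"
  shows "spectrum_hom K TH (res_spectrum H A) (res_spectrum H B) h"
  using assms H_carrier spectrum_res[of A] spectrum_res[of B] by (auto simp: spectrum_hom_def)

interpretation Y: geometric_fixed_points G T Y N
  using top_group compact Hausdorff N Y
  by (intro geometric_fixed_points.intro group_spectrum.intro geometric_fixed_points_axioms.intro)

interpretation X: geometric_fixed_points K TH X N
  using top_group_K compact_TH Hausdorff_TH normal_K spectrum_res[OF Y]
  by (intro geometric_fixed_points.intro group_spectrum.intro geometric_fixed_points_axioms.intro)

lemma rep_res: "Y.is_rep V \<Longrightarrow> X.is_rep (res_rep H V)"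
  by (rule orthogonal_rep_res[OF _ H])

lemmas res_N = fixed_space_res[OF NH] ev_fixed_res[OF NH] omor_fix_res[OF NH]

lemma N_in_H: "n \<in> N \<Longrightarrow> n \<in> H" using NH by blast

lemma fixed_omors_res:
  assumes V: "Y.is_rep V" and W: "Y.is_rep W" and \<phi>: "\<phi> \<in> fixed_omors G N V W"
  shows "\<phi> \<in> fixed_omors K N (res_rep H V) (res_rep H W)"
proof (cases \<phi>)
  case None
  then show ?thesis by (simp add: fixed_omors_def omors_iff omor_conj_def)
next
  case (Some q)
  obtain f x where q: "q = (f, x)" by fastforce
  show ?thesis
    using \<phi> unfolding Some q Y.fixed_omors_iff[OF V W] X.fixed_omors_iff[OF rep_res[OF V] rep_res[OF W]]
    by (simp add: res_N N_in_H)
qed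

subsection \<open>The comparison map\<close>

text \<open>As j^* is the identity on morphisms, the generator given by \<phi> over G goes to the
  generator given by the same \<phi> over H.\<close>

lemma compare_rel:
  assumes "Y.is_rep V" "Y.is_rep W" "\<phi> \<in> fixed_omors G N V W" "\<psi> \<in> omors (fixed_space N W) (Rn m)"
    "p \<in> ev_fixed Y N V"
  shows "X.cls m (res_rep H V, ocomp (fixed_space N V) \<psi> (omor_fix N V \<phi>), p)
    = X.cls m (res_rep H W, \<psi>, ev_map Y (fst V) (fst W) \<phi> p)"
  using X.geo_class_rel[OF rep_res[OF assms(1)] rep_res[OF assms(2)] fixed_omors_res[OF assms(1-3)], of \<psi> m p]
    assms(4,5) by (simp add: res_N)

lemma compare_basept:
  "x \<in> geo_basepts G T N Y m \<Longrightarrow> (\<lambda>(V, \<psi>, p). (res_rep H V, \<psi>, p)) x \<in> geo_basepts K TH N X m"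
  by (cases x) (simp add: rep_res res_N)

lemma compare_continuous:
  "continuous_map (Y.pre m) (X.coend m) (\<lambda>(V, \<psi>, p). X.cls m (res_rep H V, \<psi>, p))"
proof (rule Y.continuous_map_from_pre)
  fix W assume W: "Y.is_rep W"
  let ?E = "subtopology (ev_space Y (fst W)) (ev_fixed Y N W)"
  let ?Z = "prod_topology (omor_space (fixed_space N W) (Rn m)) ?E"
  have snd: "continuous_map ?Z ?E snd" by (rule continuous_map_snd)
  have "continuous_map ?Z (X.coend m) (\<lambda>z. X.cls m (res_rep H W, fst z, snd z))"
    using snd continuous_map_fst[of "omor_space (fixed_space N W) (Rn m)" ?E]
    by (intro X.continuous_map_cls[OF rep_res[OF W]]) (auto simp: res_N continuous_map_in_subtopology)
  then show "continuous_map ?Z (X.coend m) (\<lambda>(\<psi>, p). (\<lambda>(V, \<psi>, p). X.cls m (res_rep H V, \<psi>, p)) (W, \<psi>, p))"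
    by (simp add: case_prod_beta')
qed

lemma compare_cls:
  assumes z: "(V, \<psi>, p) \<in> topspace (Y.pre m)"
  shows "geo_compare G T N H Y m (Y.cls m (V, \<psi>, p)) = X.cls m (res_rep H V, \<psi>, p)"
proof -
  let ?F = "\<lambda>(V, \<psi>, p). X.cls m (res_rep H V, \<psi>, p)"
  have "the_elem (?F ` Y.cls m (V, \<psi>, p)) = ?F (V, \<psi>, p)"
  proof (rule Y.the_elem_cls(1)[OF compare_continuous X.weak_Hausdorff_coend _ _ z])
    fix x y assume xy: "x \<in> geo_basepts G T N Y m" "y \<in> geo_basepts G T N Y m"
    show "?F x = ?F y"
      using X.geo_class_base[OF compare_basept[OF xy(1)] compare_basept[OF xy(2)]] by (simp add: case_prod_beta')
  qed (simp add: compare_rel)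
  then show ?thesis by (simp add: geo_compare_def)
qed

lemma level_geo_fix: "level (geo_fix G T N Y) m = Y.coend m" "level (geo_fix K TH N X) m = X.coend m"
  by (simp_all add: geo_fix_def)

lemma continuous_map_compare: "continuous_map (Y.coend m) (X.coend m) (geo_compare G T N H Y m)"
  by (rule continuous_map_from_cgwh_quotient[OF Y.geo_rel_subset compare_continuous])
    (use compare_cls in \<open>auto simp: geo_class_def\<close>)

lemma coset_subgrp: "N #>\<^bsub>K\<^esub> h = N #>\<^bsub>G\<^esub> h"
  by (simp add: r_coset_def)

lemma compare_hom:
  "spectrum_hom (K Mod N) (quot_topology K TH N)
     (res_spectrum (carrier (K Mod N)) (geo_fix G T N Y)) (geo_fix K TH N X) (geo_compare G T N H Y)"
  (is "spectrum_hom ?J ?TJ ?A ?B ?h")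
  unfolding spectrum_hom_def
proof (intro conjI allI ballI)
  show "orthogonal_spectrum ?J ?TJ ?A"
  proof (rule orthogonal_spectrum_res[OF Y.orthogonal_spectrum_geo_fix])
    show "topspace ?TJ = carrier ?J" by (rule X.topspace_quot)
    show "carrier ?J \<subseteq> carrier (G Mod N)"
      using H_carrier by (auto simp: FactGroup_def RCOSETS_def coset_subgrp)
    show "C \<otimes>\<^bsub>?J\<^esub> D = C \<otimes>\<^bsub>G Mod N\<^esub> D \<and> C \<otimes>\<^bsub>?J\<^esub> D \<in> carrier ?J"
      if "C \<in> carrier ?J" "D \<in> carrier ?J" for C D
      using monoid.m_closed[OF group.is_monoid[OF normal.factorgroup_is_group[OF normal_K]] that]
      by (simp add: FactGroup_def set_mult_def)
    show "\<one>\<^bsub>?J\<^esub> = \<one>\<^bsub>G Mod N\<^esub>" by (simp add: FactGroup_def)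
    show "\<one>\<^bsub>?J\<^esub> \<in> carrier ?J"
      by (rule monoid.one_closed[OF group.is_monoid[OF normal.factorgroup_is_group[OF normal_K]]])
    \<comment> \<open>A map out of the quotient topology of H/N is continuous once its composite
      with the projection from H is.\<close>
    have "continuous_map TH (quot_topology G T N) (\<lambda>g. N #>\<^bsub>G\<^esub> g)"
      unfolding quot_topology_def
      by (intro continuous_map_from_subtopology quotient_imp_continuous_map quotient_map_final_topology)
    then have "continuous_map TH (quot_topology G T N) (id \<circ> (\<lambda>g. N #>\<^bsub>K\<^esub> g))"
      by (simp add: o_def coset_subgrp)
    then show "continuous_map ?TJ (quot_topology G T N) id"
      unfolding quot_topology_def[of K] using continuous_compose_quotient_map quotient_map_final_topology by blast
  qed
  show "orthogonal_spectrum ?J ?TJ ?B" by (rule X.orthogonal_spectrum_geo_fix)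
  fix m
  show "continuous_map (level ?A m) (level ?B m) (?h m)"
    using continuous_map_compare by (simp add: level_geo_fix)
  obtain V \<psi> p where x: "(V, \<psi>, p) \<in> geo_basepts G T N Y m" using Y.geo_basepts_nonempty[of m] prod_cases3 by metis
  have xp: "(V, \<psi>, p) \<in> topspace (Y.pre m)" using x Y.geo_basepts_subset by blast
  show "?h m (basept ?A m) = basept ?B m"
    using compare_cls[OF xp] Y.basepoint_eq[OF x] X.basepoint_eq[OF compare_basept[OF x]] by simp
  show "?h n (strmap ?A m n \<theta> a) = strmap ?B m n \<theta> (?h m a)"
    if \<theta>: "\<theta> \<in> omors (Rn m) (Rn n)" and "a \<in> topspace (level ?A m)" for n \<theta> a
  proof -
    from that(2) have "a \<in> topspace (Y.coend m)" by (simp add: level_geo_fix)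
    then obtain W \<psi> p where a: "Y.is_rep W" "\<psi> \<in> omors (fixed_space N W) (Rn m)" "p \<in> ev_fixed Y N W"
      "a = Y.cls m (W, \<psi>, p)" by (rule Y.coendE)
    have "ocomp (fixed_space N W) \<theta> \<psi> \<in> omors (fixed_space N W) (Rn n)"
      by (rule ocomp_omors[OF \<theta> a(2) Y.subspace_fixed_space[OF a(1)] subspace_Rn])
    then show ?thesis
      using a Y.strmap_cls[OF \<theta>, of W \<psi> p] X.strmap_cls[OF \<theta>, of "res_rep H W" \<psi> p] compare_cls[of W \<psi> p m]
        compare_cls[of W "ocomp (fixed_space N W) \<theta> \<psi>" p n] by (simp add: res_N rep_res)
  qed
  show "?h m (gact ?A C m a) = gact ?B C m (?h m a)"
    if C: "C \<in> carrier ?J" and "a \<in> topspace (level ?A m)" for C a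
  proof -
    from that(2) have "a \<in> topspace (Y.coend m)" by (simp add: level_geo_fix)
    then obtain W \<psi> p where a: "Y.is_rep W" "\<psi> \<in> omors (fixed_space N W) (Rn m)" "p \<in> ev_fixed Y N W"
      "a = Y.cls m (W, \<psi>, p)" by (rule Y.coendE)
    from C obtain g where g: "g \<in> carrier K" "C = N #>\<^bsub>K\<^esub> g" using X.carrier_ModE by blast
    have gH: "g \<in> H" and gG: "g \<in> carrier G" using g H_carrier by auto
    have giH: "inv\<^bsub>G\<^esub> g \<in> H" "inv\<^bsub>K\<^esub> g = inv\<^bsub>G\<^esub> g"
      using subgroup.m_inv_closed[OF H gH] group.m_inv_consistent[OF group_G H gH] by auto
    have z: "(W, \<psi>, p) \<in> topspace (Y.pre m)" "(res_rep H W, \<psi>, p) \<in> topspace (X.pre m)"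
      using a by (simp_all add: res_N rep_res)
    \<comment> \<open>For elements of H the restricted representation and spectrum have the same
      operators, and inverses formed in H and in G agree.\<close>
    have act: "X.pre_act g (res_rep H W, \<psi>, p) = (\<lambda>(V, \<psi>, p). (res_rep H V, \<psi>, p)) (Y.pre_act g (W, \<psi>, p))"
      using gH giH by (simp add: X.pre_act_def Y.pre_act_def X.rep_fix_def Y.rep_fix_def res_N)
    have "?h m (Y.cls m (Y.pre_act g (W, \<psi>, p))) = X.cls m (X.pre_act g (res_rep H W, \<psi>, p))"
      using compare_cls Y.pre_act_in[OF gG z(1)] unfolding act by (simp add: Y.pre_act_def)
    moreover have "gact ?A C m a = Y.cls m (Y.pre_act g (W, \<psi>, p))"
      using C Y.gact_cls[OF gG z(1)] a(4) g(2) by (simp add: coset_subgrp)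
    moreover have "gact ?B C m (?h m a) = X.cls m (X.pre_act g (res_rep H W, \<psi>, p))"
      using X.gact_cls[OF g(1) z(2)] compare_cls[OF z(1)] a(4) g(2) by simp
    ultimately show ?thesis by simp
  qed
qed

subsection \<open>The inverse\<close>

definition embeds :: "'g rep \<Rightarrow> 'g rep \<Rightarrow> (rseq \<Rightarrow> rseq) \<Rightarrow> bool" where
  "embeds W V e \<longleftrightarrow> orthogonal_rep G T V \<and> e \<in> isoms (fst W) (fst V)
     \<and> (\<forall>n\<in>N. \<forall>w\<in>fst W. e (snd W n w) = snd V n (e w)) \<and> e ` fixed_space N W = fixed_space N V"

text \<open>Finality speaks of N-representations, so W is first restricted from H to N. The
  resulting N-linear embedding is already a morphism of the indexing category.\<close>

lemma embeds_exists:
  assumes W: "X.is_rep W"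
  shows "\<exists>V e. embeds W V e"
proof -
  have "orthogonal_rep (subgrp K N) (subtopology TH N) (res_rep N W)"
    by (rule orthogonal_rep_res[OF W X.subgroup_N])
  moreover have "subtopology TH N = subtopology T N" using NH by (simp add: subtopology_subtopology Int_absorb1)
  ultimately have "orthogonal_rep (subgrp G N) (subtopology T N) (res_rep N W)" by simp
  with final obtain V e where "orthogonal_rep G T V" "e \<in> isoms (fst W) (fst V)"
    "\<forall>n\<in>N. \<forall>w\<in>fst (res_rep N W). e (snd (res_rep N W) n w) = snd V n (e w)"
    "e ` fixed_space N (res_rep N W) = fixed_space N V"
    unfolding orthogonally_final_def by fastforce
  then have "embeds W V e" by (simp add: embeds_def fixed_space_res[OF subset_refl])
  then show ?thesis by blast
qed

text \<open>The inverse of e on fixed points. It exists because e maps W^N onto V^N, and it is what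
  transports \<psi>, a morphism out of W^N, to one out of V^N.\<close>

definition fixed_inv :: "'g rep \<Rightarrow> 'g rep \<Rightarrow> (rseq \<Rightarrow> rseq) \<Rightarrow> rseq \<Rightarrow> rseq" where
  "fixed_inv W V e = restrict (inv_into (fixed_space N W) e) (fixed_space N V)"

context
  fixes W V e
  assumes W: "X.is_rep W" and e: "embeds W V e"
begin

lemma embedsD: "Y.is_rep V" "e \<in> isoms (fst W) (fst V)"
  "n \<in> N \<Longrightarrow> w \<in> fst W \<Longrightarrow> e (snd W n w) = snd V n (e w)" "e ` fixed_space N W = fixed_space N V"
  using e by (auto simp: embeds_def)

lemma fixed_inv:
  "fixed_inv W V e \<in> isoms (fixed_space N V) (fixed_space N W)"
  "w \<in> fixed_space N W \<Longrightarrow> fixed_inv W V e (e w) = w" "v \<in> fixed_space N V \<Longrightarrow> e (fixed_inv W V e v) = v"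
  "w \<in> fixed_space N W \<Longrightarrow> e w \<in> fixed_space N V"
proof -
  let ?e = "restrict e (fixed_space N W)"
  have sub: "fixed_space N W \<subseteq> fst W" by (auto simp: fixed_space_def)
  note s = X.subspace_fixed_space[OF W]
  have e': "?e \<in> isoms (fixed_space N W) (fixed_space N V)"
    by (rule isoms_restrict[OF embedsD(2) sub s]) (simp add: embedsD(4))
  have im: "?e ` fixed_space N W = fixed_space N V" by (simp add: embedsD(4))
  have inj: "inj_on e (fixed_space N W)"
    using isoms_inj[OF embedsD(2) fd_subspace_imp_subspace[OF X.rep_fd[OF W]]] sub inj_on_subset by blast
  have eq: "fixed_inv W V e = restrict (inv_into (fixed_space N W) ?e) (fixed_space N V)"
    unfolding fixed_inv_def
  proof (rule restrict_ext)
    fix v assume "v \<in> fixed_space N V"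
    then obtain w where w: "w \<in> fixed_space N W" "v = e w" using embedsD(4) by blast
    then show "inv_into (fixed_space N W) e v = inv_into (fixed_space N W) ?e v"
      using inv_into_f_f[OF inj w(1)] inv_into_f_f[OF isoms_inj[OF e' s] w(1)] by simp
  qed
  show "fixed_inv W V e \<in> isoms (fixed_space N V) (fixed_space N W)"
    unfolding eq by (rule isoms_inv[OF e' im s])
  show ew: "e w \<in> fixed_space N V" if "w \<in> fixed_space N W" for w using that embedsD(4) by blast
  show "fixed_inv W V e (e w) = w" if "w \<in> fixed_space N W" for w
    using ew[OF that] inv_into_f_f[OF inj that] by (simp add: fixed_inv_def)
  show "e (fixed_inv W V e v) = v" if "v \<in> fixed_space N V" for v
    using that f_inv_into_f[of v e "fixed_space N W"] embedsD(4) by (simp add: fixed_inv_def)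
qed

lemma fixed_inv_omors: "isom_omor (fixed_inv W V e) \<in> omors (fixed_space N V) (fixed_space N W)"
  by (rule isom_omor_omors[OF fixed_inv(1) X.subspace_fixed_space[OF W]])

lemma embeds_fixed_omors: "isom_omor e \<in> fixed_omors K N W (res_rep H V)"
  unfolding isom_omor_def X.fixed_omors_iff[OF W rep_res[OF embedsD(1)]]
  using isom_omor_omors[OF embedsD(2) fd_subspace_imp_subspace[OF Y.rep_fd[OF embedsD(1)]]] embedsD(3)
    subspace_0[OF X.subspace_fixed_space[OF rep_res[OF embedsD(1)]]]
  by (simp add: isom_omor_def N_in_H)

lemma embeds_omors: "isom_omor e \<in> omors (fst W) (fst V)"
  using X.fixed_omors_omors[OF embeds_fixed_omors] by simp

lemma ev_map_embeds: "p \<in> ev_fixed X N W \<Longrightarrow> ev_map Y (fst W) (fst V) (isom_omor e) p \<in> ev_fixed Y N V"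
  using X.ev_map_fixed[OF W rep_res[OF embedsD(1)] embeds_fixed_omors] by (simp add: res_N)

end

section \<open>Transport of representatives along embeddings\<close>

definition transfer :: "'g rep \<Rightarrow> 'g rep \<Rightarrow> (rseq \<Rightarrow> rseq) \<Rightarrow> omor \<Rightarrow> 'a evpt \<Rightarrow> ('g, 'a) geo_pre" where
  "transfer W V e \<psi> p =
     (V, ocomp (fixed_space N V) \<psi> (isom_omor (fixed_inv W V e)), ev_map Y (fst W) (fst V) (isom_omor e) p)"

lemma transfer_in:
  assumes W: "X.is_rep W" and e: "embeds W V e" and \<psi>: "\<psi> \<in> omors (fixed_space N W) (Rn m)"
    and p: "p \<in> ev_fixed X N W"
  shows "transfer W V e \<psi> p \<in> topspace (Y.pre m)"
  using embedsD(1)[OF W e] ocomp_omors[OF \<psi> fixed_inv_omors[OF W e] Y.subspace_fixed_space subspace_Rn]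
    ev_map_embeds[OF W e p] by (simp add: transfer_def)

lemma transfer_basept:
  assumes W: "X.is_rep W" and e: "embeds W V e" and "(W, \<psi>, p) \<in> geo_basepts K TH N X m"
  shows "transfer W V e \<psi> p \<in> geo_basepts G T N Y m"
proof -
  have *: "\<psi> \<in> omors (fixed_space N W) (Rn m)" "p \<in> ev_fixed X N W" "\<psi> = None \<or> p = ev_base Y (fst W)"
    using assms(3) by auto
  have "ev_map Y (fst W) (fst V) (isom_omor e) (ev_base Y (fst W)) = ev_base Y (fst V)"
    by (rule Y.ev_map_base[OF X.rep_fd[OF W] Y.rep_fd[OF embedsD(1)[OF W e]] embeds_omors[OF W e]])
  then show ?thesis
    using transfer_in[OF W e *(1,2)] *(3) by - (elim disjE; simp add: transfer_def)
qed

text \<open>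
  For \<open>\<phi> = (f, x)\<close> the targets \<open>V1\<close> and \<open>V2\<close> are mapped to a common \<open>G\<close>-representation \<open>V3\<close>,
  obtained from finality applied to the sum of \<open>V1\<close> and \<open>V2\<close> amalgamated along \<open>e1\<close> and \<open>e2 f\<close>.
\<close>

lemma transfer_rel:
  assumes W1: "X.is_rep W1" and W2: "X.is_rep W2" and e1: "embeds W1 V1 e1" and e2: "embeds W2 V2 e2"
    and \<phi>: "\<phi> \<in> fixed_omors K N W1 W2" and \<psi>: "\<psi> \<in> omors (fixed_space N W2) (Rn m)"
    and p: "p \<in> ev_fixed X N W1"
  shows "Y.cls m (transfer W1 V1 e1 (ocomp (fixed_space N W1) \<psi> (omor_fix N W1 \<phi>)) p)
    = Y.cls m (transfer W2 V2 e2 \<psi> (ev_map Y (fst W1) (fst W2) \<phi> p))"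
proof (cases \<phi>)
  case None
  \<comment> \<open>If \<phi> is the base point, both representatives are base points: the first
    through its coordinate \<psi>, the second through p.\<close>
  have "ev_map Y (fst W1) (fst W2) \<phi> p = ev_base Y (fst W2)"
    using X.ev_map_None[OF X.rep_fd[OF W1] X.rep_fd[OF W2] X.ev_fixedD(1)[OF p]] None by simp
  then have b2: "(W2, \<psi>, ev_map Y (fst W1) (fst W2) \<phi> p) \<in> geo_basepts K TH N X m"
    using W2 \<psi> X.ev_base_fixed[OF W2] by simp
  have b1: "(W1, ocomp (fixed_space N W1) \<psi> (omor_fix N W1 \<phi>), p) \<in> geo_basepts K TH N X m"
    using W1 p by (simp add: None omor_fix_def omors_iff)
  show ?thesis by (rule Y.geo_class_base[OF transfer_basept[OF W1 e1 b1] transfer_basept[OF W2 e2 b2]])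
next
  case (Some q)
  obtain f x where q: "q = (f, x)" by fastforce
  note \<phi>' = Some[unfolded q]
  have f: "f \<in> isoms (fst W1) (fst W2)" "\<And>v. v \<in> fst W1 \<Longrightarrow> inner (f v) x = 0" "x \<in> fixed_space N W2"
    "\<And>n v. n \<in> N \<Longrightarrow> v \<in> fst W1 \<Longrightarrow> f (snd W1 n v) = snd W2 n (f v)"
    using \<phi> unfolding \<phi>' X.fixed_omors_iff[OF W1 W2] by (auto simp: omors_iff)
  let ?W1 = "fst W1" and ?W2 = "fst W2" and ?V1 = "fst V1" and ?V2 = "fst V2"
  note D1 = embedsD[OF W1 e1] and D2 = embedsD[OF W2 e2]
  note V1 = D1(1) and V2 = D2(1)
  have fdW: "fd_subspace ?W1" "fd_subspace ?W2" using X.rep_fd W1 W2 by blast+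
  have fdV: "fd_subspace ?V1" "fd_subspace ?V2" using Y.rep_fd V1 V2 by blast+
  note sW = fdW[THEN fd_subspace_imp_subspace] and sV = fdV[THEN fd_subspace_imp_subspace]
  have x: "x \<in> ?W2" using f(3) by (auto simp: fixed_space_def)
  \<comment> \<open>\<open>W1\<close> sits in \<open>V1\<close> by \<open>e1\<close> and in
    \<open>V2\<close> by way of \<open>W2\<close>; these are the two inclusions along which the sum
    is amalgamated.\<close>
  define f2 where "f2 = compose ?W1 e2 f"
  have f2: "f2 \<in> isoms ?W1 ?V2" unfolding f2_def by (rule isoms_compose[OF D2(2) f(1) sW(1)])
  have f2v: "f2 w = e2 (f w)" if "w \<in> ?W1" for w using that by (simp add: f2_def compose_eq)
  have act1: "snd W1 n w \<in> ?W1" if "n \<in> N" "w \<in> ?W1" for n w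
    using isomsD(1)[OF X.rep_isom[OF W1 X.N_carrier[OF that(1)]] that(2)] .
  have \<sigma>: "snd W1 n w \<in> ?W1 \<and> e1 (snd W1 n w) = snd V1 n (e1 w) \<and> f2 (snd W1 n w) = snd V2 n (f2 w)"
    if n: "n \<in> N" and w: "w \<in> ?W1" for n w
    using act1[OF n w] D1(3)[OF n w] f(4)[OF n w] D2(3)[OF n isomsD(1)[OF f(1) w]] w by (simp add: f2v)
  have fix1: "fixed_space N V1 \<subseteq> e1 ` ?W1" using D1(4) by (auto simp: fixed_space_def)
  obtain P a b where P: "orthogonal_rep (subgrp G N) (subtopology T N) P"
    and a: "a \<in> isoms ?V1 (fst P)" and b: "b \<in> isoms ?V2 (fst P)"
    and ab: "\<And>s. s \<in> ?W1 \<Longrightarrow> a (e1 s) = b (f2 s)"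
    and perp: "\<And>v x. v \<in> ?V1 \<Longrightarrow> x \<in> ?V2 \<Longrightarrow> (\<And>s. s \<in> ?W1 \<Longrightarrow> inner (f2 s) x = 0) \<Longrightarrow> inner (a v) (b x) = 0"
    and aN: "\<And>n v. n \<in> N \<Longrightarrow> v \<in> ?V1 \<Longrightarrow> a (snd V1 n v) = snd P n (a v)"
    and bN: "\<And>n v. n \<in> N \<Longrightarrow> v \<in> ?V2 \<Longrightarrow> b (snd V2 n v) = snd P n (b v)"
    and bfix: "b ` fixed_space N V2 = fixed_space N P"
    using Y.amalgamated_sum[OF V1 V2 sW(1) D1(2) f2 \<sigma> fix1] by blast
  \<comment> \<open>The amalgamated sum carries only an action of N, so finality is applied a second
    time to reach a representation of G.\<close>
  from final[unfolded orthogonally_final_def, rule_format, OF P]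
  obtain V3 c where V3: "Y.is_rep V3" and c: "c \<in> isoms (fst P) (fst V3)"
    and cN: "\<And>n w. n \<in> N \<Longrightarrow> w \<in> fst P \<Longrightarrow> c (snd P n w) = snd V3 n (c w)"
    and cfix: "c ` fixed_space N P = fixed_space N V3"
    by blast
  let ?V3 = "fst V3"
  have fd3: "fd_subspace ?V3" using Y.rep_fd V3 by blast
  define A where "A = compose ?V1 c a"
  define B where "B = compose ?V2 c b"
  have A: "A \<in> isoms ?V1 ?V3" unfolding A_def by (rule isoms_compose[OF c a sV(1)])
  have B: "B \<in> isoms ?V2 ?V3" unfolding B_def by (rule isoms_compose[OF c b sV(2)])
  have Av: "A v = c (a v)" if "v \<in> ?V1" for v using that by (simp add: A_def compose_eq)
  have Bv: "B v = c (b v)" if "v \<in> ?V2" for v using that by (simp add: B_def compose_eq)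
  have act: "snd V1 n v \<in> ?V1" if "n \<in> N" "v \<in> ?V1" for n v
    using isomsD(1)[OF Y.rep_isom[OF V1 Y.N_carrier[OF that(1)]] that(2)] .
  have act2: "snd V2 n v \<in> ?V2" if "n \<in> N" "v \<in> ?V2" for n v
    using isomsD(1)[OF Y.rep_isom[OF V2 Y.N_carrier[OF that(1)]] that(2)] .
  have AN: "A (snd V1 n v) = snd V3 n (A v)" if "n \<in> N" "v \<in> ?V1" for n v
    using Av[OF act[OF that]] Av[OF that(2)] aN[OF that] cN[OF that(1) isomsD(1)[OF a that(2)]] by simp
  have BN: "B (snd V2 n v) = snd V3 n (B v)" if "n \<in> N" "v \<in> ?V2" for n v
    using Bv[OF act2[OF that]] Bv[OF that(2)] bN[OF that] cN[OF that(1) isomsD(1)[OF b that(2)]] by simp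
  have sub2: "fixed_space N V2 \<subseteq> ?V2" by (auto simp: fixed_space_def)
  have "B ` fixed_space N V2 = c ` (b ` fixed_space N V2)"
    unfolding image_image using Bv sub2 by (intro image_cong) auto
  then have Bfix: "B ` fixed_space N V2 = fixed_space N V3" using bfix cfix by simp
  have AB: "A (e1 w) = B (e2 (f w))" if w: "w \<in> ?W1" for w
    using Av[OF isomsD(1)[OF D1(2) w]] Bv[OF isomsD(1)[OF f2 w]] ab[OF w] f2v[OF w] by simp
  \<comment> \<open>\<open>B\<close> maps V2^N bijectively to V3^N, since neither the amalgamation
    nor finality adds fixed vectors. Hence it is again an embedding of the kind used for
    transport.\<close>
  have eB: "embeds (res_rep H V2) V3 B"
    using V3 B BN Bfix by (simp add: embeds_def res_N N_in_H)
  note X2 = rep_res[OF V2]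
  define \<beta> where "\<beta> = fixed_inv (res_rep H V2) V3 B"
  have \<beta>: "\<beta> \<in> isoms (fixed_space N V3) (fixed_space N V2)"
    "\<And>w. w \<in> fixed_space N V2 \<Longrightarrow> \<beta> (B w) = w" "\<And>w. w \<in> fixed_space N V2 \<Longrightarrow> B w \<in> fixed_space N V3"
    using fixed_inv[OF X2 eB] by (simp_all add: \<beta>_def res_N)
  note back1 = fixed_inv[OF W1 e1] and back2 = fixed_inv[OF W2 e2]
  note sf1 = Y.subspace_fixed_space[OF V1] and sf2 = Y.subspace_fixed_space[OF V2]
    and sf3 = Y.subspace_fixed_space[OF V3]
  have x2: "e2 x \<in> fixed_space N V2" by (rule back2(4)[OF f(3)])
  have Bx: "B (e2 x) \<in> fixed_space N V3" by (rule \<beta>(3)[OF x2])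
  \<comment> \<open>The arrow from \<open>V1\<close> to \<open>V3\<close> corresponding to \<phi>:
    its isometry extends \<open>B e2 f\<close> along \<open>e1\<close>, and its vector is the image
    of \<open>x\<close>. The orthogonality it requires is \<open>perp\<close>, preserved by
    \<open>c\<close>.\<close>
  define \<phi>3 where "\<phi>3 = Some (A, B (e2 x))"
  have "inner (A v) (B (e2 x)) = 0" if v: "v \<in> ?V1" for v
  proof -
    have ex: "e2 x \<in> ?V2" by (rule isomsD(1)[OF D2(2) x])
    have "inner (f2 s) (e2 x) = 0" if "s \<in> ?W1" for s
      using isomsD(4)[OF D2(2) isomsD(1)[OF f(1) that] x] f(2)[OF that] f2v[OF that] by simp
    then have "inner (a v) (b (e2 x)) = 0" by (rule perp[OF v ex])
    then show ?thesis
      using isomsD(4)[OF c isomsD(1)[OF a v] isomsD(1)[OF b ex]] Av[OF v] Bv[OF ex] by simp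
  qed
  moreover have Bx3: "B (e2 x) \<in> ?V3" using Bx by (auto simp: fixed_space_def)
  ultimately have \<phi>3: "\<phi>3 \<in> fixed_omors G N V1 V3"
    unfolding \<phi>3_def Y.fixed_omors_iff[OF V1 V3] using A AN Bx by (auto simp: omors_iff)
  have \<beta>3: "isom_omor B \<in> fixed_omors G N V2 V3"
    unfolding isom_omor_def Y.fixed_omors_iff[OF V2 V3]
    using B BN subspace_0[OF sf3] fd_subspace_imp_subspace[OF fd3] by (simp add: omors_iff subspace_0)

  \<comment> \<open>The coordinate \<psi> is carried along V3^N -> V2^N -> W2^N, the inverses of
    \<open>B\<close> and \<open>e2\<close>. Both transferred points are then identified with points
    at \<open>V3\<close> that have this coordinate: the one from \<open>W2\<close> through
    \<open>B\<close>, the one from \<open>W1\<close> through \<open>\<phi>3\<close>.\<close>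
  define \<psi>2 where "\<psi>2 = ocomp (fixed_space N V2) \<psi> (isom_omor (fixed_inv W2 V2 e2))"
  define \<psi>3 where "\<psi>3 = ocomp (fixed_space N V3) \<psi>2 (isom_omor \<beta>)"
  have bo2: "isom_omor (fixed_inv W2 V2 e2) \<in> omors (fixed_space N V2) (fixed_space N W2)"
    by (rule fixed_inv_omors[OF W2 e2])
  have bo1: "isom_omor (fixed_inv W1 V1 e1) \<in> omors (fixed_space N V1) (fixed_space N W1)"
    by (rule fixed_inv_omors[OF W1 e1])
  have \<beta>o: "isom_omor \<beta> \<in> omors (fixed_space N V3) (fixed_space N V2)" by (rule isom_omor_omors[OF \<beta>(1) sf2])
  have \<psi>2: "\<psi>2 \<in> omors (fixed_space N V2) (Rn m)" unfolding \<psi>2_def by (rule ocomp_omors[OF \<psi> bo2 sf2 subspace_Rn])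
  have \<psi>3: "\<psi>3 \<in> omors (fixed_space N V3) (Rn m)" unfolding \<psi>3_def by (rule ocomp_omors[OF \<psi>2 \<beta>o sf3 subspace_Rn])
  let ?p1 = "ev_map Y ?W1 ?V1 (isom_omor e1) p"
  let ?p2 = "ev_map Y ?W2 ?V2 (isom_omor e2) (ev_map Y ?W1 ?W2 \<phi> p)"
  have p': "p \<in> topspace (ev_space Y ?W1)" using X.ev_fixedD(1)[OF p] by simp
  have \<phi>o: "\<phi> \<in> omors ?W1 ?W2" by (rule X.fixed_omors_omors[OF \<phi>])
  have p1: "?p1 \<in> ev_fixed Y N V1" by (rule ev_map_embeds[OF W1 e1 p])
  have p2: "?p2 \<in> ev_fixed Y N V2"
    using ev_map_embeds[OF W2 e2 X.ev_map_fixed[OF W1 W2 \<phi> p]] by simp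

  have "ocomp (fixed_space N V2) (isom_omor \<beta>) (omor_fix N V2 (isom_omor B)) = omor_id (fixed_space N V2)"
    using isoms_zero[OF \<beta>(1) sf3] \<beta>(2)
    by (auto simp: isom_omor_def omor_fix_def compose_def fun_eq_iff)
  then have "ocomp (fixed_space N V2) \<psi>3 (omor_fix N V2 (isom_omor B)) = \<psi>2"
    unfolding \<psi>3_def
    using ocomp_assoc[OF \<psi>2 \<beta>o Y.omor_fix_omors[OF V2 V3 \<beta>3] sf2] ocomp_id_right[OF \<psi>2 sf2] by simp
  then have right: "Y.cls m (V2, \<psi>2, ?p2) = Y.cls m (V3, \<psi>3, ev_map Y ?V2 ?V3 (isom_omor B) ?p2)"
    using Y.geo_class_rel[OF V2 V3 \<beta>3 \<psi>3 p2] by simp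

  have fx1: "f w \<in> fixed_space N W2" if "w \<in> fixed_space N W1" for w
    using X.omor_fix_omors[OF W1 W2 \<phi>] that isomsD(1)[of "restrict f (fixed_space N W1)" "fixed_space N W1" "fixed_space N W2" w]
    by (auto simp: \<phi>' omor_fix_def omors_iff)
  \<comment> \<open>Equality of the \<psi>-coordinates: on V1^N, passing through
    \<open>\<phi>3\<close> and back to W2^N is the same as going back to W1^N and applying \<phi>.
    The vector part returns to \<open>x\<close>.\<close>
  have key: "ocomp (fixed_space N V1) (isom_omor (fixed_inv W2 V2 e2))
      (ocomp (fixed_space N V1) (isom_omor \<beta>) (omor_fix N V1 \<phi>3))
    = ocomp (fixed_space N V1) (omor_fix N W1 \<phi>) (isom_omor (fixed_inv W1 V1 e1))"
  proof -
    have "fixed_inv W2 V2 e2 (\<beta> (A v)) = f (fixed_inv W1 V1 e1 v)" if v: "v \<in> fixed_space N V1" for v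
    proof -
      let ?w = "fixed_inv W1 V1 e1 v"
      have w: "?w \<in> fixed_space N W1" by (rule isomsD(1)[OF back1(1) v])
      then have "?w \<in> ?W1" by (auto simp: fixed_space_def)
      then have "A v = B (e2 (f ?w))" using AB[of ?w] back1(3)[OF v] by simp
      then show ?thesis using \<beta>(2)[OF back2(4)[OF fx1[OF w]]] back2(2)[OF fx1[OF w]] by simp
    qed
    moreover have "fixed_inv W2 V2 e2 (\<beta> (B (e2 x))) = x" using \<beta>(2)[OF x2] back2(2)[OF f(3)] by simp
    moreover have "f 0 = 0" by (rule isoms_zero[OF f(1) sW(1)])
    ultimately show ?thesis
      using isomsD(1)[OF back1(1)] subspace_0[OF X.subspace_fixed_space[OF W1]]
      by (auto simp: \<phi>' \<phi>3_def isom_omor_def omor_fix_def compose_def fun_eq_iff)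
  qed
  note of3 = Y.omor_fix_omors[OF V1 V3 \<phi>3] and of1 = X.omor_fix_omors[OF W1 W2 \<phi>]
  have "ocomp (fixed_space N V1) \<psi>3 (omor_fix N V1 \<phi>3)
      = ocomp (fixed_space N V1) \<psi> (ocomp (fixed_space N V1) (isom_omor (fixed_inv W2 V2 e2))
          (ocomp (fixed_space N V1) (isom_omor \<beta>) (omor_fix N V1 \<phi>3)))"
    unfolding \<psi>3_def using ocomp_assoc[OF \<psi>2 \<beta>o of3 sf1]
      ocomp_assoc[OF \<psi> bo2 ocomp_omors[OF \<beta>o of3 sf1 sf2] sf1] by (simp add: \<psi>2_def)
  also have "\<dots> = ocomp (fixed_space N V1) (ocomp (fixed_space N W1) \<psi> (omor_fix N W1 \<phi>)) (isom_omor (fixed_inv W1 V1 e1))"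
    unfolding key using ocomp_assoc[OF \<psi> of1 bo1 sf1] by simp
  finally have left: "Y.cls m (transfer W1 V1 e1 (ocomp (fixed_space N W1) \<psi> (omor_fix N W1 \<phi>)) p)
      = Y.cls m (V3, \<psi>3, ev_map Y ?V1 ?V3 \<phi>3 ?p1)"
    using Y.geo_class_rel[OF V1 V3 \<phi>3 \<psi>3 p1] by (simp add: transfer_def)

  \<comment> \<open>Equality of the point coordinates: the square with sides \<open>e1\<close>,
    \<open>\<phi>3\<close>, \<phi> and \<open>B e2\<close> commutes, including vector parts.\<close>
  have "ocomp ?W1 \<phi>3 (isom_omor e1) = ocomp ?W1 (ocomp ?W2 (isom_omor B) (isom_omor e2)) \<phi>"
    using AB isomsD(1)[OF f(1)] isoms_zero[OF A sV(1)] isoms_zero[OF B sV(2)] x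
    by (auto simp: \<phi>' \<phi>3_def isom_omor_def compose_def fun_eq_iff)
  moreover have "ocomp ?W1 (ocomp ?W2 (isom_omor B) (isom_omor e2)) \<phi>
      = ocomp ?W1 (isom_omor B) (ocomp ?W1 (isom_omor e2) \<phi>)"
    by (rule ocomp_assoc[OF Y.fixed_omors_omors[OF \<beta>3] embeds_omors[OF W2 e2] \<phi>o sW(1)])
  moreover have "ev_map Y ?V1 ?V3 \<phi>3 ?p1 = ev_map Y ?W1 ?V3 (ocomp ?W1 \<phi>3 (isom_omor e1)) p"
    by (rule Y.ev_map_comp[OF fdW(1) fdV(1) fd3 Y.fixed_omors_omors[OF \<phi>3] embeds_omors[OF W1 e1] p'])
  moreover have "?p2 = ev_map Y ?W1 ?V2 (ocomp ?W1 (isom_omor e2) \<phi>) p"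
    by (rule Y.ev_map_comp[OF fdW fdV(2) embeds_omors[OF W2 e2] \<phi>o p'])
  moreover have "ev_map Y ?V2 ?V3 (isom_omor B) (ev_map Y ?W1 ?V2 (ocomp ?W1 (isom_omor e2) \<phi>) p)
      = ev_map Y ?W1 ?V3 (ocomp ?W1 (isom_omor B) (ocomp ?W1 (isom_omor e2) \<phi>)) p"
    by (rule Y.ev_map_comp[OF fdW(1) fdV(2) fd3 Y.fixed_omors_omors[OF \<beta>3]
          ocomp_omors[OF embeds_omors[OF W2 e2] \<phi>o sW(1) sV(2)] p'])
  ultimately have "ev_map Y ?V1 ?V3 \<phi>3 ?p1 = ev_map Y ?V2 ?V3 (isom_omor B) ?p2" by simp
  then show ?thesis unfolding left using right by (simp add: transfer_def \<psi>2_def)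
qed

section \<open>The inverse map on coends\<close>

definition emb :: "'g rep \<Rightarrow> 'g rep \<times> (rseq \<Rightarrow> rseq)" where
  "emb W = (SOME z. embeds W (fst z) (snd z))"

lemma emb: "X.is_rep W \<Longrightarrow> embeds W (fst (emb W)) (snd (emb W))"
  unfolding emb_def by (rule someI_ex) (use embeds_exists[of W] in auto)

definition pre_lift :: "('g, 'a) geo_pre \<Rightarrow> ('g, 'a) geo_pre" where
  "pre_lift = (\<lambda>(W, \<psi>, p). transfer W (fst (emb W)) (snd (emb W)) \<psi> p)"

definition lift :: "nat \<Rightarrow> ('g, 'a) geo_pre set \<Rightarrow> ('g, 'a) geo_pre set" where
  "lift m c = the_elem ((\<lambda>z. Y.cls m (pre_lift z)) ` c)"

text \<open>The chosen embedding may vary arbitrarily with W, because the representations index a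
  disjoint sum and continuity is required on each summand separately.\<close>

lemma pre_lift_continuous: "continuous_map (X.pre m) (Y.coend m) (\<lambda>z. Y.cls m (pre_lift z))"
proof (rule X.continuous_map_from_pre)
  fix W assume W: "X.is_rep W"
  let ?E = "subtopology (ev_space X (fst W)) (ev_fixed X N W)"
  let ?Z = "prod_topology (omor_space (fixed_space N W) (Rn m)) ?E"
  obtain V e where Ve: "emb W = (V, e)" by fastforce
  have e: "embeds W V e" using emb[OF W] Ve by simp
  note V = embedsD(1)[OF W e]
  have c: "continuous_map ?Z (omor_space (fixed_space N W) (Rn m)) fst" "continuous_map ?Z (ev_space Y (fst W)) snd"
    using continuous_map_snd[of "omor_space (fixed_space N W) (Rn m)" ?E]
    by (simp_all add: continuous_map_fst continuous_map_in_subtopology)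
  have "continuous_map ?Z (Y.coend m) (\<lambda>z. Y.cls m (V, ocomp (fixed_space N V) (fst z) (isom_omor (fixed_inv W V e)),
      ev_map Y (fst W) (fst V) (isom_omor e) (snd z)))"
  proof (rule Y.continuous_map_cls[OF V])
    show "continuous_map ?Z (omor_space (fixed_space N V) (Rn m))
        (\<lambda>z. ocomp (fixed_space N V) (fst z) (isom_omor (fixed_inv W V e)))"
      using fixed_inv_omors[OF W e]
      by (intro continuous_map_ocomp[OF c(1) _ Y.subspace_fixed_space[OF V] X.fd_fixed_space[OF W] fd_subspace_Rn])
        simp
    show "continuous_map ?Z (ev_space Y (fst V)) (\<lambda>z. ev_map Y (fst W) (fst V) (isom_omor e) (snd z))"
      using continuous_map_compose[OF c(2) Y.continuous_map_ev_map[OF X.rep_fd[OF W] Y.rep_fd[OF V] embeds_omors[OF W e]]]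
      by (simp add: o_def)
    show "ev_map Y (fst W) (fst V) (isom_omor e) (snd z) \<in> ev_fixed Y N V" if "z \<in> topspace ?Z" for z
      using that ev_map_embeds[OF W e] by auto
  qed
  then show "continuous_map ?Z (Y.coend m) (\<lambda>(\<psi>, p). Y.cls m (pre_lift (W, \<psi>, p)))"
    by (simp add: pre_lift_def transfer_def Ve case_prod_beta')
qed

lemma lift_cls:
  assumes z: "z \<in> topspace (X.pre m)"
  shows "lift m (X.cls m z) = Y.cls m (pre_lift z)"
  unfolding lift_def
proof (rule X.the_elem_cls(1)[OF pre_lift_continuous Y.weak_Hausdorff_coend _ _ z])
  fix V W \<phi> \<psi> p
  assume *: "X.is_rep V" "X.is_rep W" "\<phi> \<in> fixed_omors K N V W" "\<psi> \<in> omors (fixed_space N W) (Rn m)"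
    "p \<in> ev_fixed X N V"
  show "Y.cls m (pre_lift (V, ocomp (fixed_space N V) \<psi> (omor_fix N V \<phi>), p))
      = Y.cls m (pre_lift (W, \<psi>, ev_map X (fst V) (fst W) \<phi> p))"
    using transfer_rel[OF *(1,2) emb[OF *(1)] emb[OF *(2)] *(3-5)] by (simp add: pre_lift_def)
next
  fix x y assume xy: "x \<in> geo_basepts K TH N X m" "y \<in> geo_basepts K TH N X m"
  have "pre_lift x \<in> geo_basepts G T N Y m" if "x \<in> geo_basepts K TH N X m" for x
  proof -
    obtain W \<psi> p where x: "x = (W, \<psi>, p)" by (cases x)
    then have W: "X.is_rep W" using that by simp
    show ?thesis using transfer_basept[OF W emb[OF W]] that by (simp add: pre_lift_def x)
  qed
  then show "Y.cls m (pre_lift x) = Y.cls m (pre_lift y)" using Y.geo_class_base xy by blast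
qed

lemma continuous_map_lift: "continuous_map (X.coend m) (Y.coend m) (lift m)"
  by (rule continuous_map_from_cgwh_quotient[OF X.geo_rel_subset pre_lift_continuous])
    (use lift_cls in \<open>simp add: geo_class_def\<close>)

text \<open>The embedding chosen for a restricted representation i^*V is an N-linear map between
  representations of G. It is thus a morphism of the indexing category for G, whose own generator
  identifies the two classes.\<close>

lemma lift_compare:
  assumes "c \<in> topspace (Y.coend m)"
  shows "lift m (geo_compare G T N H Y m c) = c"
proof -
  obtain V \<psi> p where V: "Y.is_rep V" and \<psi>: "\<psi> \<in> omors (fixed_space N V) (Rn m)" and p: "p \<in> ev_fixed Y N V"
    and c: "c = Y.cls m (V, \<psi>, p)" using assms by (rule Y.coendE)
  let ?W = "res_rep H V"
  have W: "X.is_rep ?W" by (rule rep_res[OF V])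
  obtain V' e where Ve: "emb ?W = (V', e)" by fastforce
  have e: "embeds ?W V' e" using emb[OF W] Ve by simp
  note V' = embedsD(1)[OF W e]
  note s = Y.subspace_fixed_space[OF V] and s' = Y.subspace_fixed_space[OF V']
  have b: "isom_omor (fixed_inv ?W V' e) \<in> omors (fixed_space N V') (fixed_space N V)"
    using fixed_inv_omors[OF W e] by (simp add: res_N)
  have e': "isom_omor e \<in> fixed_omors G N V V'"
    unfolding isom_omor_def Y.fixed_omors_iff[OF V V']
    using embeds_omors[OF W e] embedsD(3)[OF W e] subspace_0[OF s'] by (simp add: isom_omor_def N_in_H)
  have "ocomp (fixed_space N V) (isom_omor (fixed_inv ?W V' e)) (omor_fix N V (isom_omor e)) = omor_id (fixed_space N V)"
    using isoms_zero[OF fixed_inv(1)[OF W e] s'] fixed_inv(2)[OF W e]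
    by (auto simp: isom_omor_def omor_fix_def compose_def fun_eq_iff res_N)
  then have "ocomp (fixed_space N V) (ocomp (fixed_space N V') \<psi> (isom_omor (fixed_inv ?W V' e))) (omor_fix N V (isom_omor e)) = \<psi>"
    using ocomp_assoc[OF \<psi> b Y.omor_fix_omors[OF V V' e'] s] ocomp_id_right[OF \<psi> s] by simp
  then have "Y.cls m (transfer ?W V' e \<psi> p) = c"
    using Y.geo_class_rel[OF V V' e' ocomp_omors[OF \<psi> b s' subspace_Rn] p] by (simp add: transfer_def c)
  moreover have "(?W, \<psi>, p) \<in> topspace (X.pre m)" using W \<psi> p by (simp add: res_N)
  moreover have "(V, \<psi>, p) \<in> topspace (Y.pre m)" using V \<psi> p by simp
  ultimately show ?thesis using lift_cls compare_cls by (simp add: c pre_lift_def Ve)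
qed

text \<open>Here the embedding is a morphism from W to a restricted representation in the indexing
  category for H, and its generator gives the identification.\<close>

lemma compare_lift:
  assumes "c \<in> topspace (X.coend m)"
  shows "geo_compare G T N H Y m (lift m c) = c"
proof -
  obtain W \<psi> p where W: "X.is_rep W" and \<psi>: "\<psi> \<in> omors (fixed_space N W) (Rn m)" and p: "p \<in> ev_fixed X N W"
    and c: "c = X.cls m (W, \<psi>, p)" using assms by (rule X.coendE)
  obtain V e where Ve: "emb W = (V, e)" by fastforce
  have e: "embeds W V e" using emb[OF W] Ve by simp
  note V = embedsD(1)[OF W e]
  note s = X.subspace_fixed_space[OF W] and s' = Y.subspace_fixed_space[OF V]
  note b = fixed_inv_omors[OF W e] and e' = embeds_fixed_omors[OF W e]
  have \<psi>b: "ocomp (fixed_space N V) \<psi> (isom_omor (fixed_inv W V e)) \<in> omors (fixed_space N V) (Rn m)"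
    by (rule ocomp_omors[OF \<psi> b s' subspace_Rn])
  have "ocomp (fixed_space N W) (isom_omor (fixed_inv W V e)) (omor_fix N W (isom_omor e)) = omor_id (fixed_space N W)"
    using isoms_zero[OF fixed_inv(1)[OF W e] s'] fixed_inv(2)[OF W e]
    by (auto simp: isom_omor_def omor_fix_def compose_def fun_eq_iff)
  moreover have "omor_fix N W (isom_omor e) \<in> omors (fixed_space N W) (fixed_space N V)"
    using X.omor_fix_omors[OF W rep_res[OF V] e'] by (simp add: res_N)
  ultimately have "ocomp (fixed_space N W) (ocomp (fixed_space N V) \<psi> (isom_omor (fixed_inv W V e))) (omor_fix N W (isom_omor e)) = \<psi>"
    using ocomp_assoc[OF \<psi> b _ s] ocomp_id_right[OF \<psi> s] by simp
  then have "X.cls m (res_rep H V, ocomp (fixed_space N V) \<psi> (isom_omor (fixed_inv W V e)),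
      ev_map Y (fst W) (fst V) (isom_omor e) p) = c"
    using X.geo_class_rel[OF W rep_res[OF V] e' _ p, of "ocomp (fixed_space N V) \<psi> (isom_omor (fixed_inv W V e))" m] \<psi>b
    by (simp add: c res_N)
  moreover have "(W, \<psi>, p) \<in> topspace (X.pre m)" using W \<psi> p by simp
  ultimately show ?thesis
    using lift_cls compare_cls transfer_in[OF W e \<psi> p] by (simp add: c pre_lift_def Ve transfer_def)
qed

theorem compare_iso:
  "spectrum_iso (K Mod N) (quot_topology K TH N)
     (res_spectrum (carrier (K Mod N)) (geo_fix G T N Y)) (geo_fix K TH N X) (geo_compare G T N H Y)"
  by (rule spectrum_isoI[OF compare_hom, where k = lift])
    (simp_all add: level_geo_fix continuous_map_lift lift_compare compare_lift X.topspace_quot)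

text \<open>On representatives the comparison changes only the representation and a morphism of
  spectra only the point, so the two operations commute.\<close>

lemma compare_natural:
  fixes Z :: "('g, 'b) gspectrum"
  assumes h: "spectrum_hom G T Y Z h" and c: "c \<in> topspace (level (geo_fix G T N Y) m)"
  shows "geo_compare G T N H Z m (geo_fix_hom G T N Z h m c)
    = geo_fix_hom K TH N (res_spectrum H Z) h m (geo_compare G T N H Y m c)"
proof -
  have "orthogonal_spectrum G T Z" using h by (simp add: spectrum_hom_def)
  then interpret Z: comparison G T N H Z
    using top_group compact Hausdorff H closed_H N NH final by (intro comparison.intro)
  note hK = spectrum_hom_res[OF h]
  from c have "c \<in> topspace (Y.coend m)" by (simp add: level_geo_fix)
  then obtain W \<psi> p where a: "Y.is_rep W" "\<psi> \<in> omors (fixed_space N W) (Rn m)" "p \<in> ev_fixed Y N W"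
    "c = Y.cls m (W, \<psi>, p)" by (rule Y.coendE)
  have "(W, \<psi>, ev_hom Z h (fst W) p) \<in> topspace (geo_pre G T N Z m)"
    using a ev_hom_fixed[OF top_group compact Hausdorff N h a(1,3)]
    by (auto simp: geo_pre_def ev_fixed_def)
  then show ?thesis
    using geo_fix_hom_class[OF top_group compact Hausdorff N h, of W \<psi> p m]
      geo_fix_hom_class[OF top_group_K compact_TH Hausdorff_TH normal_K hK, of "res_rep H W" \<psi> p m]
      compare_cls[of W \<psi> p m] Z.compare_cls[of W \<psi> "ev_hom Z h (fst W) p" m] a
    by (simp add: rep_res res_N)
qed

end

theorem proposition4p3p8:
  fixes G :: "'g monoid" and T :: "'g topology" and N H :: "'g set"
    and Y :: "('g, 'a) gspectrum"
  assumes "compact_Lie_group G T"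
    and "subgroup H G" and "closedin T H"
    and "N \<lhd> G" and "closedin T N" and "N \<subseteq> H"
    and "orthogonally_final G T N"
    and "orthogonal_spectrum G T Y"
  shows "spectrum_iso (subgrp G H Mod N) (quot_topology (subgrp G H) (subtopology T H) N)
           (res_spectrum (carrier (subgrp G H Mod N)) (geo_fix G T N Y))
           (geo_fix (subgrp G H) (subtopology T H) N (res_spectrum H Y))
           (geo_compare G T N H Y)
       \<and> (\<forall>m. \<forall>(V, \<psi>, p) \<in> topspace (geo_pre G T N Y m).
            geo_compare G T N H Y m (geo_class G T N Y m (V, \<psi>, p))
              = geo_class (subgrp G H) (subtopology T H) N (res_spectrum H Y) m
                  (res_rep H V, \<psi>, p))
       \<and> (\<forall>(Z :: ('g, 'b) gspectrum) h. spectrum_hom G T Y Z h \<longrightarrow>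
            (\<forall>m. \<forall>c \<in> topspace (level (geo_fix G T N Y) m).
               geo_compare G T N H Z m (geo_fix_hom G T N Z h m c)
                 = geo_fix_hom (subgrp G H) (subtopology T H) N (res_spectrum H Z) h m
                     (geo_compare G T N H Y m c)))"
proof -
  have Lie: "topological_group G T" "Hausdorff_space T" "compact_space T"
    using assms(1) by (auto simp: compact_Lie_group_def Lie_group_def)
  interpret C: comparison G T N H Y
    using Lie assms by (intro comparison.intro)
  show ?thesis
    using C.compare_iso C.compare_cls C.compare_natural by fast
qed

end
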